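(* Let $n\ge 2$ and $1\le k\le n$ be integers. Let ${\mathbb F}$ be a field admitting a field automorphism $\sigma$ of order $2$, let $V$ be a $2n$-dimensional vector space over ${\mathbb F}$, and let ${\sf h}$ be a non-degenerate $\sigma$-Hermitian form on $V$ of Witt index $n$ (so that the isometry group of determinant $1$ is $\mathrm{SU}_{2n}({\mathbb F})$). If ${\mathbb F}\neq{\mathbb F}_4$ or $k=1$, then the polar $k$-Grassmannian $\Gamma_k^{\sf h}(V)$ has generating rank $\binom{2n}{k}$.
   Context: A point-line geometry consists of a set of points and a set of lines, each line a subset of the points, with any two distinct points on at most one common line. A subspace is a set $X$ of points such that every line containing at least two points of $X$ is contained in $X$; the span of a set $S$ of points is the smallest subspace containing $S$, and $S$ is a generating set if its span is the whole point set. The generating rank is the minimum cardinality of a generating set. A subspace $U$ of $V$ is totally isotropic (t.i.) if ${\sf h}(u,u')=0$ for all $u,u'\in U$. The polar $k$-Grassmannian $\Gamma_k^{\sf h}(V)$: its points are the t.i. $k$-dimensional subspaces of $V$; for $k<n$ its lines are the sets $\{K \text{ t.i. } k\text{-space}: D\subseteq K\subseteq U\}$ where $D$ is a t.i. $(k-1)$-space and $U\supseteq D$ a t.i. $(k+1)$-space; for $k=n$ its lines are the sets $\{K \text{ t.i. } n\text{-space}: D\subseteq K\}$ for a t.i. $(n-1)$-space $D$. ${\mathbb F}_4$ denotes the field with four elements. *)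

theory Defs
  imports Complex_Main "HOL-Library.Extended_Nat"
begin

section \<open>Point-line geometries\<close>

definition point_line_geometry :: "'p set \<Rightarrow> 'p set set \<Rightarrow> bool" where
  "point_line_geometry P L \<longleftrightarrow>
     (\<forall>l\<in>L. l \<subseteq> P) \<and>
     (\<forall>x\<in>P. \<forall>y\<in>P. x \<noteq> y \<longrightarrow>
        (\<forall>l\<in>L. \<forall>m\<in>L. x \<in> l \<and> y \<in> l \<and> x \<in> m \<and> y \<in> m \<longrightarrow> l = m))"

lemma point_line_geometryI:
  assumes "\<And>x y l. x \<in> P \<Longrightarrow> y \<in> P \<Longrightarrow> x \<noteq> y \<Longrightarrow> l \<in> L \<Longrightarrow> x \<in> l \<Longrightarrow> y \<in> l \<Longrightarrow> l = f x y"
    and "\<And>l. l \<in> L \<Longrightarrow> l \<subseteq> P"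
  shows "point_line_geometry P L"
  unfolding point_line_geometry_def
proof (intro conjI ballI impI)
  fix x y l m
  assume *: "x \<in> P" "y \<in> P" "x \<noteq> y" "l \<in> L" "m \<in> L"
    and **: "x \<in> l \<and> y \<in> l \<and> x \<in> m \<and> y \<in> m"
  from ** have "x \<in> l" "y \<in> l" "x \<in> m" "y \<in> m" by simp_all
  then show "l = m" using assms(1)[OF *(1-4)] assms(1)[OF *(1-3,5)] by simp
qed (rule assms(2))

definition geometry_subspace :: "'p set \<Rightarrow> 'p set set \<Rightarrow> 'p set \<Rightarrow> bool" where
  "geometry_subspace P L X \<longleftrightarrow>
     X \<subseteq> P \<and> (\<forall>l\<in>L. (\<exists>x\<in>l \<inter> X. \<exists>y\<in>l \<inter> X. x \<noteq> y) \<longrightarrow> l \<subseteq> X)"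

definition geometry_span :: "'p set \<Rightarrow> 'p set set \<Rightarrow> 'p set \<Rightarrow> 'p set" where
  "geometry_span P L S = \<Inter>{X. geometry_subspace P L X \<and> S \<subseteq> X}"

definition generating_set :: "'p set \<Rightarrow> 'p set set \<Rightarrow> 'p set \<Rightarrow> bool" where
  "generating_set P L S \<longleftrightarrow> S \<subseteq> P \<and> geometry_span P L S = P"

text \<open>All infinite cardinalities are identified with \<open>\<infinity>\<close>.  The infimum is attained,
  as \<^typ>\<open>enat\<close> is well-ordered and \<open>P\<close> generates itself when its lines are sets of points.\<close>

definition generating_rank :: "'p set \<Rightarrow> 'p set set \<Rightarrow> enat" where
  "generating_rank P L =
     (INF S \<in> {S. generating_set P L S}. if finite S then enat (card S) else \<infinity>)"

section \<open>Hermitian forms\<close>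

definition field_automorphism :: "('f::field \<Rightarrow> 'f) \<Rightarrow> bool" where
  "field_automorphism \<sigma> \<longleftrightarrow> bij \<sigma> \<and> \<sigma> 1 = 1 \<and>
     (\<forall>a b. \<sigma> (a + b) = \<sigma> a + \<sigma> b) \<and> (\<forall>a b. \<sigma> (a * b) = \<sigma> a * \<sigma> b)"

text \<open>Forms are linear in the first argument; \<open>\<sigma>\<close>-semilinearity in the second argument follows
  from the symmetry condition.\<close>

definition hermitian_form ::
  "('f::field \<Rightarrow> 'v::ab_group_add \<Rightarrow> 'v) \<Rightarrow> ('f \<Rightarrow> 'f) \<Rightarrow> ('v \<Rightarrow> 'v \<Rightarrow> 'f) \<Rightarrow> bool" where
  "hermitian_form scale \<sigma> h \<longleftrightarrow>
     (\<forall>u v w. h (u + v) w = h u w + h v w) \<and>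
     (\<forall>a v w. h (scale a v) w = a * h v w) \<and>
     (\<forall>v w. h w v = \<sigma> (h v w))"

definition nondegenerate :: "('v::ab_group_add \<Rightarrow> 'v \<Rightarrow> 'f::field) \<Rightarrow> bool" where
  "nondegenerate h \<longleftrightarrow> (\<forall>v. (\<forall>w. h v w = 0) \<longrightarrow> v = 0)"

definition totally_isotropic ::
  "('f::field \<Rightarrow> 'v::ab_group_add \<Rightarrow> 'v) \<Rightarrow> ('v \<Rightarrow> 'v \<Rightarrow> 'f) \<Rightarrow> 'v set \<Rightarrow> bool" where
  "totally_isotropic scale h U \<longleftrightarrow>
     module.subspace scale U \<and> (\<forall>u\<in>U. \<forall>u'\<in>U. h u u' = 0)"

definition ti_spaces ::
  "('f::field \<Rightarrow> 'v::ab_group_add \<Rightarrow> 'v) \<Rightarrow> ('v \<Rightarrow> 'v \<Rightarrow> 'f) \<Rightarrow> nat \<Rightarrow> 'v set set" where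
  "ti_spaces scale h d = {U. totally_isotropic scale h U \<and> vector_space.dim scale U = d}"

text \<open>Meaningful for finite-dimensional spaces only, where the set of dimensions is finite.\<close>

definition witt_index ::
  "('f::field \<Rightarrow> 'v::ab_group_add \<Rightarrow> 'v) \<Rightarrow> ('v \<Rightarrow> 'v \<Rightarrow> 'f) \<Rightarrow> nat" where
  "witt_index scale h = Max (vector_space.dim scale ` {U. totally_isotropic scale h U})"

section \<open>Polar Grassmannians\<close>

definition polar_grassmannian_points ::
  "('f::field \<Rightarrow> 'v::ab_group_add \<Rightarrow> 'v) \<Rightarrow> ('v \<Rightarrow> 'v \<Rightarrow> 'f) \<Rightarrow> nat \<Rightarrow> 'v set set" where
  "polar_grassmannian_points scale h k = ti_spaces scale h k"

text \<open>Intended for \<open>1 \<le> k \<le> witt_index scale h\<close>.\<close>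

definition polar_grassmannian_lines ::
  "('f::field \<Rightarrow> 'v::ab_group_add \<Rightarrow> 'v) \<Rightarrow> ('v \<Rightarrow> 'v \<Rightarrow> 'f) \<Rightarrow> nat \<Rightarrow> 'v set set set" where
  "polar_grassmannian_lines scale h k =
     (if k < witt_index scale h
      then {{K \<in> ti_spaces scale h k. D \<subseteq> K \<and> K \<subseteq> U} | D U.
              D \<in> ti_spaces scale h (k - 1) \<and> U \<in> ti_spaces scale h (k + 1) \<and> D \<subseteq> U}
      else {{K \<in> ti_spaces scale h k. D \<subseteq> K} | D. D \<in> ti_spaces scale h (k - 1)})"

lemma (in finite_dimensional_vector_space) point_line_geometry_polar_grassmannian:
  assumes k: "1 \<le> k"
  shows "point_line_geometry (polar_grassmannian_points scale h k)
           (polar_grassmannian_lines scale h k)"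
proof -
  have meet: "D = x \<inter> y"
    if "x \<in> ti_spaces scale h k" "y \<in> ti_spaces scale h k" "x \<noteq> y"
       "D \<in> ti_spaces scale h (k - 1)" "D \<subseteq> x" "D \<subseteq> y" for x y D
  proof -
    have s: "subspace x" "subspace y" "subspace D" "dim x = k" "dim y = k" "dim D = k - 1"
      using that by (auto simp: ti_spaces_def totally_isotropic_def)
    have i: "subspace (x \<inter> y)" using s by (simp add: subspace_inter)
    have "dim (x \<inter> y) < k"
    proof (rule ccontr)
      assume "\<not> dim (x \<inter> y) < k"
      then have "x \<inter> y = x" "x \<inter> y = y"
        using subspace_dim_equal[OF i s(1)] subspace_dim_equal[OF i s(2)] s by auto
      then show False using \<open>x \<noteq> y\<close> by auto
    qed
    then show ?thesis
      using subspace_dim_equal[OF s(3) i] that s by auto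
  qed
  have join: "U = span (x \<union> y)"
    if "x \<in> ti_spaces scale h k" "y \<in> ti_spaces scale h k" "x \<noteq> y"
       "U \<in> ti_spaces scale h (k + 1)" "x \<subseteq> U" "y \<subseteq> U" for x y U
  proof -
    have s: "subspace x" "subspace y" "subspace U" "dim x = k" "dim y = k" "dim U = k + 1"
      using that by (auto simp: ti_spaces_def totally_isotropic_def)
    have sub: "span (x \<union> y) \<subseteq> U" using that s by (simp add: span_minimal)
    have xy: "x \<subseteq> span (x \<union> y)" "y \<subseteq> span (x \<union> y)" by (auto intro: span_base)
    have "dim (span (x \<union> y)) > k"
    proof (rule ccontr)
      assume "\<not> dim (span (x \<union> y)) > k"
      then have "x = span (x \<union> y)" "y = span (x \<union> y)"
        using subspace_dim_equal[OF s(1) subspace_span xy(1)]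
          subspace_dim_equal[OF s(2) subspace_span xy(2)] s by auto
      then show False using \<open>x \<noteq> y\<close> by auto
    qed
    then show ?thesis
      using subspace_dim_equal[OF subspace_span s(3) sub] s by auto
  qed
  show ?thesis
  proof (cases "k < witt_index scale h")
    case True
    have "l = {K \<in> ti_spaces scale h k. x \<inter> y \<subseteq> K \<and> K \<subseteq> span (x \<union> y)}"
      if xy: "x \<in> ti_spaces scale h k" "y \<in> ti_spaces scale h k" "x \<noteq> y"
        and l: "l \<in> polar_grassmannian_lines scale h k" "x \<in> l" "y \<in> l" for x y l
    proof -
      obtain D U where DU: "l = {K \<in> ti_spaces scale h k. D \<subseteq> K \<and> K \<subseteq> U}"
        "D \<in> ti_spaces scale h (k - 1)" "U \<in> ti_spaces scale h (k + 1)"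
        using l(1) True by (auto simp: polar_grassmannian_lines_def)
      have "D \<subseteq> x" "D \<subseteq> y" "x \<subseteq> U" "y \<subseteq> U"
        using l(2,3) unfolding DU(1) by simp_all
      then have "D = x \<inter> y" "U = span (x \<union> y)"
        using meet[OF xy DU(2)] join[OF xy DU(3)] by blast+
      then show ?thesis using DU(1) by (simp only:)
    qed
    moreover have "l \<subseteq> ti_spaces scale h k" if "l \<in> polar_grassmannian_lines scale h k" for l
      using that True by (auto simp: polar_grassmannian_lines_def)
    ultimately show ?thesis
      unfolding polar_grassmannian_points_def by (intro point_line_geometryI)
  next
    case False
    have "l = {K \<in> ti_spaces scale h k. x \<inter> y \<subseteq> K}"
      if xy: "x \<in> ti_spaces scale h k" "y \<in> ti_spaces scale h k" "x \<noteq> y"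
        and l: "l \<in> polar_grassmannian_lines scale h k" "x \<in> l" "y \<in> l" for x y l
    proof -
      obtain D where D: "l = {K \<in> ti_spaces scale h k. D \<subseteq> K}" "D \<in> ti_spaces scale h (k - 1)"
        using l(1) False by (auto simp: polar_grassmannian_lines_def)
      have "D \<subseteq> x" "D \<subseteq> y"
        using l(2,3) unfolding D(1) by simp_all
      then have "D = x \<inter> y" by (rule meet[OF xy D(2)])
      then show ?thesis using D(1) by (simp only:)
    qed
    moreover have "l \<subseteq> ti_spaces scale h k" if "l \<in> polar_grassmannian_lines scale h k" for l
      using that False by (auto simp: polar_grassmannian_lines_def)
    ultimately show ?thesis
      unfolding polar_grassmannian_points_def by (intro point_line_geometryI)
  qed
qed

end

theory Submission
  imports Defs "HOL-Library.Multiset"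
begin

text \<open>
  Lower bound: fewer than \<open>2n choose k\<close> totally isotropic \<open>k\<close>-spaces are annihilated by a nonzero alternating
  \<open>k\<close>-form, and the \<open>k\<close>-spaces annihilated by a form are closed under the lines. But a form annihilating
  all totally isotropic \<open>k\<close>-spaces is zero, because isotropic vectors \<open>a + \<omega> b\<close> with \<open>\<omega>\<close> of norm one
  separate the vectors of an orthogonal basis.

  Upper bound for \<open>k = n\<close>: the lines are hyperbolic, \<open>{M + z | z \<in> \<langle>x, y\<rangle> isotropic}\<close> with \<open>h x y \<noteq> 0\<close>, and
  these lines make sense for every \<open>k\<close>. In an orthogonal basis with norms \<open>1, -1, 1, -1, \<dots>\<close> let \<open>Y\<close> be spanned by
  the first \<open>j\<close> vectors. If all \<open>k\<close>-spaces meeting \<open>Y\<close> are known, add those containing \<open>v = a + b\<close>, with \<open>a\<close>, \<open>b\<close> the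
  \<open>j\<close>-th and the next basis vector; by induction this costs as many elements as the problem for \<open>k - 1\<close>, \<open>j - 1\<close> in \<open>v\<^sup>\<bottom> / v\<close>.
  Closure under hyperbolic lines then reaches all isotropic vectors of \<open>Y + b\<close>, since isotropic transvections
  connect the vectors of a given nonzero norm in \<open>Y\<close>; this is where the fixed field must have a third element.

  Upper bound for \<open>k < n\<close>: write \<open>V = \<langle>p, q\<rangle> \<bottom> W\<close>. The \<open>k\<close>-spaces in \<open>W\<close>, through \<open>p\<close> and through \<open>q\<close> generate everything
  except one \<open>k\<close>-space over each \<open>(k - 2)\<close>-space of \<open>W\<close>, which accounts for the terms of
  \<open>2n choose k = (2n-2 choose k) + 2 (2n-2 choose k-1) + (2n-2 choose k-2)\<close>.
\<close>

text \<open>Everything takes place in subspaces \<open>A\<close> of one fixed space. The residue of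
  an isotropic vector \<open>p\<close> is represented by the complement of a hyperbolic pair
  \<open>p\<close>, \<open>q\<close>, so the inductions need no quotient spaces. A scalar
  \<open>\<theta>\<close> of trace one takes the place of one half, which keeps characteristic two
  inside the general argument.

  Two obstacles shape the upper bound. If \<open>k = n - 1\<close>, the \<open>k\<close>-spaces of
  \<open>W\<close> are maximal in \<open>W\<close>, so the lines of \<open>W\<close> are hyperbolic
  and are not contained in lines of \<open>V\<close>; they are recovered from orthogonal
  combinations in which \<open>p\<close> and \<open>q\<close> occur as auxiliary vectors. In top
  rank, adding all spaces through a further isotropic vector costs as much as its whole residue
  unless the spaces already known are discounted; this is why generation is measured relative to a
  subspace \<open>Y\<close>. The induction can start from the line of one basis vector, because that
  line is anisotropic and no t.i. space meets it.\<close>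

locale hermitian_space = finite_dimensional_vector_space scale Basis
  for scale :: "'f::field \<Rightarrow> 'v::ab_group_add \<Rightarrow> 'v" (infixr "*s" 75) and Basis +
  fixes \<sigma> :: "'f \<Rightarrow> 'f" and h :: "'v \<Rightarrow> 'v \<Rightarrow> 'f"
  assumes automorphism: "field_automorphism \<sigma>"
    and involution: "\<sigma> \<circ> \<sigma> = id"
    and not_id: "\<sigma> \<noteq> id"
    and hermitian: "hermitian_form scale \<sigma> h"
begin

section \<open>The involution and the rules of the form\<close>

lemma \<sigma>_add [simp]: "\<sigma> (a + b) = \<sigma> a + \<sigma> b"
  and \<sigma>_mult [simp]: "\<sigma> (a * b) = \<sigma> a * \<sigma> b"
  and \<sigma>_1 [simp]: "\<sigma> 1 = 1"
  using automorphism by (auto simp: field_automorphism_def)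

lemma \<sigma>_\<sigma> [simp]: "\<sigma> (\<sigma> a) = a"
  using involution by (metis comp_apply id_apply)

lemma \<sigma>_0 [simp]: "\<sigma> 0 = 0"
  using \<sigma>_add[of 0 0] by (metis add.right_neutral add_left_cancel)

lemma \<sigma>_minus [simp]: "\<sigma> (- a) = - \<sigma> a"
  using \<sigma>_add[of a "- a"] by (metis \<sigma>_0 add.right_inverse minus_unique)

lemma \<sigma>_diff [simp]: "\<sigma> (a - b) = \<sigma> a - \<sigma> b"
  using \<sigma>_add[of a "- b"] by simp

lemma \<sigma>_eq_0 [simp]: "\<sigma> a = 0 \<longleftrightarrow> a = 0"
  by (metis \<sigma>_0 \<sigma>_\<sigma>)

lemma \<sigma>_inverse [simp]: "\<sigma> (inverse a) = inverse (\<sigma> a)"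
proof (cases "a = 0")
  case False
  then have "\<sigma> a * \<sigma> (inverse a) = 1" by (simp flip: \<sigma>_mult)
  then show ?thesis by (metis inverse_unique)
qed simp

lemma \<sigma>_divide [simp]: "\<sigma> (a / b) = \<sigma> a / \<sigma> b"
  by (simp add: divide_inverse)

lemma \<sigma>_eq_iff: "\<sigma> a = \<sigma> b \<longleftrightarrow> a = b"
  by (metis \<sigma>_\<sigma>)

lemma h_add_left: "h (u + v) w = h u w + h v w"
  and h_scale_left: "h (a *s v) w = a * h v w"
  and h_sym: "h w v = \<sigma> (h v w)"
  using hermitian unfolding hermitian_form_def by blast+

lemma h_add_right: "h w (u + v) = h w u + h w v"
  using h_sym[of w "u + v"] by (simp add: h_add_left flip: h_sym)

lemma h_scale_right: "h w (a *s v) = \<sigma> a * h w v"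
  using h_sym[of w "a *s v"] by (simp add: h_scale_left flip: h_sym)

lemma h_zero_left [simp]: "h 0 v = 0"
  using h_scale_left[of 0 v] by simp

lemma h_zero_right [simp]: "h v 0 = 0"
  using h_sym[of v 0] by simp

lemma h_minus_left: "h (- u) w = - h u w"
  using h_scale_left[of "- 1" u w] by simp

lemma h_minus_right: "h w (- u) = - h w u"
  using h_scale_right[of w "- 1" u] by simp

lemma h_diff_left: "h (u - v) w = h u w - h v w"
  using h_add_left[of u "- v" w] by (simp add: h_minus_left)

lemma h_diff_right: "h w (u - v) = h w u - h w v"
  using h_add_right[of w u "- v"] by (simp add: h_minus_right)

lemmas h_simps = h_add_left h_add_right h_scale_left h_scale_right
  h_diff_left h_diff_right h_minus_left h_minus_right

lemma h_eq_0_sym: "h x y = 0 \<longleftrightarrow> h y x = 0"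
  using h_sym[of x y] by simp

lemma h_self_fixed: "\<sigma> (h x x) = h x x"
  using h_sym[of x x] by simp

lemma exists_nonfixed: "\<exists>x. \<sigma> x \<noteq> x"
  using not_id by (metis eq_id_iff)

text \<open>If all traces vanished, the trace of \<open>1\<close> would force characteristic two,
  where \<open>x + \<sigma> x = 0\<close> makes \<open>\<sigma>\<close> the identity.\<close>

lemma exists_trace_one: "\<exists>\<theta>. \<theta> + \<sigma> \<theta> = 1"
proof -
  obtain y where y: "\<sigma> y \<noteq> y" using exists_nonfixed by blast
  have "\<exists>x. x + \<sigma> x \<noteq> 0"
  proof (rule ccontr)
    assume "\<not> ?thesis"
    then have *: "x + \<sigma> x = 0" for x by blast
    have "(1::'f) + 1 = 0" using *[of 1] by simp
    then have "y + y = 0" by (metis mult.right_neutral distrib_left mult_zero_right)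
    then show False using *[of y] y by (metis add_left_imp_eq)
  qed
  then obtain x where x: "x + \<sigma> x \<noteq> 0" by blast
  have "\<sigma> (x / (x + \<sigma> x)) = \<sigma> x / (x + \<sigma> x)" by (simp add: add.commute)
  then have "x / (x + \<sigma> x) + \<sigma> (x / (x + \<sigma> x)) = 1"
    using x by (metis add_divide_distrib divide_self)
  then show ?thesis by blast
qed

definition \<theta> :: 'f where "\<theta> = (SOME t. t + \<sigma> t = 1)"

lemma \<theta>: "\<theta> + \<sigma> \<theta> = 1"
  unfolding \<theta>_def by (rule someI_ex[OF exists_trace_one])

lemma \<sigma>_\<theta>: "\<sigma> \<theta> = 1 - \<theta>"
  using \<theta> by (simp add: eq_diff_eq add.commute)

text \<open>Quotients \<open>\<sigma> x / x\<close> have norm one, as in Hilbert 90, and differ from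
  \<open>1\<close> when \<open>x\<close> is not fixed.\<close>

lemma exists_norm_one: "\<exists>\<omega>. \<omega> * \<sigma> \<omega> = 1 \<and> \<omega> \<noteq> 1"
proof -
  obtain x where x: "\<sigma> x \<noteq> x" using exists_nonfixed by blast
  then have "x \<noteq> 0" by auto
  then have "(\<sigma> x / x) * \<sigma> (\<sigma> x / x) = 1 \<and> \<sigma> x / x \<noteq> 1" using x by (auto simp: field_simps)
  then show ?thesis by blast
qed

section \<open>Orthogonal complements\<close>

definition perp :: "'v set \<Rightarrow> 'v set \<Rightarrow> 'v set" where
  "perp A B = {x \<in> A. \<forall>b\<in>B. h x b = 0}"

definition nondeg :: "'v set \<Rightarrow> bool" where
  "nondeg A \<longleftrightarrow> perp A A \<subseteq> {0}"

definition ti :: "'v set \<Rightarrow> nat \<Rightarrow> 'v set set" where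
  "ti A d = {U \<in> ti_spaces scale h d. U \<subseteq> A}"

text \<open>An intrinsic description of the orthogonal sums of \<open>m\<close> hyperbolic planes,
  stated for subspaces so that the complement of a hyperbolic pair is of the same kind.\<close>

definition hyp :: "'v set \<Rightarrow> nat \<Rightarrow> bool" where
  "hyp A m \<longleftrightarrow> subspace A \<and> nondeg A \<and> dim A = 2 * m \<and> ti A m \<noteq> {}"

lemma perpI: "x \<in> A \<Longrightarrow> (\<And>b. b \<in> B \<Longrightarrow> h x b = 0) \<Longrightarrow> x \<in> perp A B"
  and perpD1: "x \<in> perp A B \<Longrightarrow> x \<in> A"
  and perpD2: "x \<in> perp A B \<Longrightarrow> b \<in> B \<Longrightarrow> h x b = 0"
  and perpD3: "x \<in> perp A B \<Longrightarrow> b \<in> B \<Longrightarrow> h b x = 0"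
  by (auto simp: perp_def h_eq_0_sym)

lemma subspace_perp: "subspace A \<Longrightarrow> subspace (perp A B)"
  by (auto simp: perp_def subspace_def h_simps)

lemma perp_span: "perp A (span B) = perp A B"
proof
  show "perp A B \<subseteq> perp A (span B)"
  proof
    fix x assume x: "x \<in> perp A B"
    have "h x b = 0" if "b \<in> span B" for b
      using that
    proof (induction rule: span_induct_alt)
      case (step c a y)
      then show ?case using x by (simp add: h_simps perpD2)
    qed simp
    then show "x \<in> perp A (span B)" using x by (auto simp: perp_def)
  qed
  show "perp A (span B) \<subseteq> perp A B"
    by (auto simp: perp_def span_base)
qed

lemma perp_insert: "perp A (insert x B) = perp (perp A B) {x}"
  by (auto simp: perp_def)

lemma perp_mono: "B \<subseteq> C \<Longrightarrow> perp A C \<subseteq> perp A B"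
  by (auto simp: perp_def)

lemma span_eqI: "subspace S \<Longrightarrow> span S = S"
  by simp

lemma dim_le_kernel:
  assumes S: "subspace S" and add: "\<And>x y. g (x + y) = g x + g y" and sc: "\<And>c x. g (c *s x) = c * (g x :: 'f)"
  shows "dim S \<le> Suc (dim {x \<in> S. g x = 0})"
proof (cases "\<exists>s\<in>S. g s \<noteq> 0")
  case True
  then obtain s where s: "s \<in> S" "g s \<noteq> 0" by blast
  let ?K = "{x \<in> S. g x = 0}"
  have "x \<in> span (insert s ?K)" if "x \<in> S" for x
  proof -
    have "g x = g (x - (g x / g s) *s s) + g ((g x / g s) *s s)"
      using add by (metis diff_add_cancel)
    then have "g (x - (g x / g s) *s s) = 0"
      unfolding sc using s by simp
    then have "x - (g x / g s) *s s \<in> span ?K"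
      using subspace_diff[OF S that subspace_scale[OF S s(1)]] by (simp add: span_base)
    then show ?thesis by (auto simp: span_breakdown_eq)
  qed
  then have "dim S \<le> dim (insert s ?K)" by (intro dim_mono) auto
  also have "\<dots> \<le> Suc (dim ?K)" by (auto simp: dim_insert)
  finally show ?thesis .
next
  case False
  then have "{x \<in> S. g x = 0} = S" by auto
  then show ?thesis by simp
qed

lemma dim_perp_vector:
  assumes "subspace A" shows "dim A \<le> Suc (dim (perp A {x}))"
  using dim_le_kernel[OF assms, of "\<lambda>y. h y x"] by (simp add: perp_def h_simps)

lemma dim_perp_le:
  assumes A: "subspace A" and B: "subspace B"
  shows "dim A \<le> dim (perp A B) + dim B"
proof -
  obtain C where C: "finite C" "span C = B" "card C = dim B"
    using basis_subspace_exists[OF B] by metis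
  have "dim A \<le> dim (perp A C) + card C"
    using C(1)
  proof (induction C rule: finite_induct)
    case empty
    have "perp A {} = A" by (auto simp: perp_def)
    then show ?case by simp
  next
    case (insert x F)
    have "dim (perp A F) \<le> Suc (dim (perp A (insert x F)))"
      by (subst perp_insert) (rule dim_perp_vector[OF subspace_perp[OF A]])
    moreover have "card (insert x F) = Suc (card F)" using insert by simp
    ultimately show ?case using insert.IH by linarith
  qed
  moreover have "perp A C = perp A B" using perp_span[of A C] C(2) by simp
  ultimately show ?thesis using C(3) by simp
qed

lemma complement_exists:
  assumes A: "subspace A" and B: "subspace B" and BA: "B \<subseteq> A"
  obtains C where "subspace C" "C \<subseteq> A" "B \<inter> C = {0}" "dim B + dim C = dim A"
    "\<And>a. a \<in> A \<Longrightarrow> \<exists>b\<in>B. \<exists>c\<in>C. a = b + c"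
proof -
  obtain S where S: "finite S" "S \<subseteq> B" "independent S" "span S = B" "card S = dim B"
    using basis_subspace_exists[OF B] by metis
  obtain T where T: "S \<subseteq> T" "T \<subseteq> A" "independent T" "A \<subseteq> span T"
    using maximal_independent_subset_extend[of S A] S BA by auto
  have TA: "span T = A" using T A by (simp add: span_subspace)
  have finT: "finite T" using T finiteI_independent by blast
  let ?C = "span (T - S)"
  have iC: "independent (T - S)" using T(3) by (rule independent_mono) auto
  have dC: "dim ?C = card (T - S)" using iC by (rule dim_span_eq_card_independent)
  have dA: "dim A = card T" using T TA dim_span_eq_card_independent by metis
  have "T = S \<union> (T - S)" using T by auto
  then have un: "A = {x + y |x y. x \<in> B \<and> y \<in> ?C}" using span_Un[of S "T - S"] S TA by simp
  have "x = 0" if "x \<in> B" "x \<in> ?C" for x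
  proof -
    have "representation T x = representation S x"
      by (rule representation_extend[OF T(3)]) (use that S T in auto)
    moreover have "representation T x = representation (T - S) x"
      by (rule representation_extend[OF T(3)]) (use that S T in auto)
    ultimately have "representation T x b = 0" for b
      by (metis DiffD2 representation_ne_zero)
    moreover have "x = (\<Sum>b | representation T x b \<noteq> 0. representation T x b *s b)"
      using sum_nonzero_representation_eq[OF T(3), of x] TA that BA by auto
    ultimately show ?thesis by simp
  qed
  then have "B \<inter> ?C = {0}" using B by (auto simp: subspace_0 span_zero)
  moreover have "?C \<subseteq> A" using T A by (intro span_minimal) auto
  moreover have "dim B + dim ?C = dim A"
    using dC dA S T finT by (metis card_Diff_subset card_mono le_add_diff_inverse)
  ultimately show ?thesis using that[of ?C] un by blast
qed

text \<open>Nondegeneracy enters through a complement \<open>C\<close> of \<open>perp A B\<close> in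
  \<open>A\<close>: a vector of \<open>B\<close> orthogonal to \<open>C\<close> is orthogonal to all
  of \<open>A\<close>, hence zero, so \<open>dim B \<le> dim C\<close>.\<close>

lemma dim_perp:
  assumes A: "subspace A" "nondeg A" and B: "subspace B" "B \<subseteq> A"
  shows "dim (perp A B) + dim B = dim A"
proof -
  have P: "subspace (perp A B)" "perp A B \<subseteq> A"
    using subspace_perp[OF A(1)] perpD1 by blast+
  obtain C where C: "subspace C" "C \<subseteq> A" "dim (perp A B) + dim C = dim A"
    "\<And>a. a \<in> A \<Longrightarrow> \<exists>b\<in>perp A B. \<exists>c\<in>C. a = b + c"
    using complement_exists[OF A(1) P] by metis
  have "perp B C \<subseteq> perp A A"
  proof
    fix x assume x: "x \<in> perp B C"
    show "x \<in> perp A A"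
    proof (rule perpI)
      show "x \<in> A" using x B by (auto simp: perp_def)
      fix a assume "a \<in> A"
      then obtain b c where "b \<in> perp A B" "c \<in> C" "a = b + c" using C(4) by blast
      then show "h x a = 0" using x by (auto simp: h_simps perp_def h_eq_0_sym)
    qed
  qed
  then have "dim (perp B C) = 0" using A(2) by (auto simp: nondeg_def)
  then have "dim B \<le> dim C" using dim_perp_le[OF B(1) C(1)] by (simp del: dim_eq_0)
  moreover have "dim A \<le> dim (perp A B) + dim B" by (rule dim_perp_le[OF A(1) B(1)])
  ultimately show ?thesis using C(3) by simp
qed

lemma perp_perp:
  assumes A: "subspace A" "nondeg A" and B: "subspace B" "B \<subseteq> A"
  shows "perp A (perp A B) = B"
proof -
  have P: "subspace (perp A B)" "perp A B \<subseteq> A"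
    using subspace_perp[OF A(1)] perpD1 by blast+
  have "B \<subseteq> perp A (perp A B)" using B by (auto simp: perp_def h_eq_0_sym)
  moreover have "dim (perp A (perp A B)) = dim B"
    using dim_perp[OF A B] dim_perp[OF A P] by simp
  ultimately show ?thesis
    using subspace_dim_equal[OF B(1) subspace_perp[OF A(1)]] by (metis order_refl)
qed

section \<open>Totally isotropic subspaces\<close>

lemma ti_iff: "U \<in> ti A d \<longleftrightarrow> subspace U \<and> (\<forall>u\<in>U. \<forall>v\<in>U. h u v = 0) \<and> dim U = d \<and> U \<subseteq> A"
  by (auto simp: ti_def ti_spaces_def totally_isotropic_def)

lemma ti_subspace: "U \<in> ti A d \<Longrightarrow> subspace U"
  and ti_sub: "U \<in> ti A d \<Longrightarrow> U \<subseteq> A"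
  and ti_dim: "U \<in> ti A d \<Longrightarrow> dim U = d"
  and ti_h: "U \<in> ti A d \<Longrightarrow> u \<in> U \<Longrightarrow> v \<in> U \<Longrightarrow> h u v = 0"
  by (auto simp: ti_iff)

lemma ti_0: "subspace A \<Longrightarrow> ti A 0 = {{0}}"
  by (auto simp: ti_iff subspace_0)

lemma ti_mono: "A \<subseteq> B \<Longrightarrow> U \<in> ti A d \<Longrightarrow> U \<in> ti B d"
  by (auto simp: ti_iff)

lemma ti_subset: "U \<in> ti A d \<Longrightarrow> subspace D \<Longrightarrow> D \<subseteq> U \<Longrightarrow> D \<in> ti A (dim D)"
  by (auto simp: ti_iff)

lemma mem_span_insert:
  "subspace D \<Longrightarrow> y \<in> span (insert x D) \<longleftrightarrow> (\<exists>c. \<exists>d\<in>D. y = d + c *s x)"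
  using span_breakdown_eq[of y x D] span_eqI by (metis add_diff_cancel_right' diff_add_cancel)

lemma dim_span_insert:
  "subspace D \<Longrightarrow> x \<notin> D \<Longrightarrow> dim (span (insert x D)) = Suc (dim D)"
  by (simp add: dim_insert span_eqI)

lemma span_insert_subset:
  "subspace K \<Longrightarrow> D \<subseteq> K \<Longrightarrow> x \<in> K \<Longrightarrow> span (insert x D) \<subseteq> K"
  by (simp add: span_minimal)

lemma ti_insert:
  assumes A: "subspace A" and D: "D \<in> ti A d" and x: "x \<in> perp A D" "h x x = 0" "x \<notin> D"
  shows "span (insert x D) \<in> ti A (Suc d)"
proof -
  have s: "subspace D" and d: "dim D = d" using D by (simp_all add: ti_iff)
  have "h u v = 0" if "u \<in> span (insert x D)" "v \<in> span (insert x D)" for u v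
    using that ti_h[OF D] perpD2[OF x(1)] perpD3[OF x(1)] x(2)
    by (auto simp: mem_span_insert[OF s] h_simps)
  then show ?thesis
    using D x span_insert_subset[OF A ti_sub[OF D] perpD1[OF x(1)]] dim_span_insert[OF s x(3)] d subspace_span
    unfolding ti_iff by metis
qed

lemma ti_insert_eq:
  assumes K: "K \<in> ti A (Suc d)" and D: "subspace D" "dim D = d" "D \<subseteq> K" and x: "x \<in> K" "x \<notin> D"
  shows "span (insert x D) = K"
  using subspace_dim_equal[OF subspace_span ti_subspace[OF K] span_insert_subset[OF ti_subspace[OF K] D(3) x(1)]]
    dim_span_insert[OF D(1) x(2)] ti_dim[OF K] D(2) by simp

lemma ti_extension_vector:
  assumes K: "K \<in> ti A (Suc d)" and D: "subspace D" "dim D = d" "D \<subseteq> K"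
  obtains x where "x \<in> K" "x \<notin> D" "K = span (insert x D)" "x \<in> perp A D" "h x x = 0"
proof -
  have "K \<noteq> D" using ti_dim[OF K] D(2) by auto
  then obtain x where x: "x \<in> K" "x \<notin> D" using D(3) by auto
  moreover have "h x y = 0" if "y \<in> K" for y by (rule ti_h[OF K x(1) that])
  then have "x \<in> perp A D" "h x x = 0" using ti_sub[OF K] x D by (auto intro!: perpI)
  ultimately show ?thesis using that ti_insert_eq[OF K D x] by blast
qed

lemma ti_hyperplane_perp:
  assumes K: "K \<in> ti A (Suc d)" and z: "z \<in> K" "h z x \<noteq> 0"
  shows "perp K {x} \<in> ti A d" "z \<notin> perp K {x}" "K = span (insert z (perp K {x}))"
proof -
  let ?M = "perp K {x}"
  have s: "subspace ?M" using K by (simp add: subspace_perp ti_subspace)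
  have MK: "?M \<subseteq> K" by (auto simp: perp_def)
  show z': "z \<notin> ?M" using z by (auto simp: perp_def)
  have "Suc (dim ?M) \<le> dim K"
    using dim_span_insert[OF s z'] dim_subset[OF span_insert_subset[OF ti_subspace[OF K] MK z(1)]] by simp
  moreover have "dim K \<le> Suc (dim ?M)" by (rule dim_perp_vector[OF ti_subspace[OF K]])
  ultimately have d: "dim ?M = d" using ti_dim[OF K] by simp
  then show "?M \<in> ti A d" using ti_subset[OF K s MK] by simp
  show "K = span (insert z ?M)" using ti_insert_eq[OF K s d MK z(1) z'] by simp
qed

lemma ti_subspace_exists:
  assumes K: "K \<in> ti A d" and D: "D \<in> ti A e" "D \<subseteq> K" and b: "e \<le> b" "b \<le> d"
  obtains M where "M \<in> ti A b" "D \<subseteq> M" "M \<subseteq> K"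
proof -
  have "\<exists>M. M \<in> ti A b \<and> D \<subseteq> M \<and> M \<subseteq> K"
    using b
  proof (induction b rule: dec_induct)
    case base
    then show ?case using D by blast
  next
    case (step b)
    then obtain M where M: "M \<in> ti A b" "D \<subseteq> M" "M \<subseteq> K" by auto
    then have "M \<noteq> K" using step ti_dim[OF K] ti_dim[of M] by auto
    then obtain x where x: "x \<in> K" "x \<notin> M" using M by auto
    have "span (insert x M) \<subseteq> K" using M x K by (simp add: span_insert_subset ti_subspace)
    moreover have "span (insert x M) \<in> ti A (Suc b)"
      using ti_subset[OF K subspace_span calculation] dim_span_insert[OF ti_subspace[OF M(1)] x(2)] ti_dim[OF M(1)]
      by simp
    ultimately show ?case using M span_superset[of "insert x M"] by blast
  qed
  then show ?thesis using that by blast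
qed

section \<open>Hyperbolic spaces\<close>

definition hpair :: "'v set \<Rightarrow> 'v \<Rightarrow> 'v \<Rightarrow> bool" where
  "hpair A p q \<longleftrightarrow> p \<in> A \<and> q \<in> A \<and> h p p = 0 \<and> h q q = 0 \<and> h p q = 1 \<and> h q p = 1"

lemma hpair_sym: "hpair A p q \<Longrightarrow> hpair A q p"
  by (auto simp: hpair_def)

lemma isotropic_shift:
  assumes "h z z = 0" and "h w z \<noteq> 0"
  shows "\<exists>t. h (w + t *s z) (w + t *s z) = 0"
proof -
  \<comment> \<open>\<open>\<theta>\<close> splits the norm of \<open>w\<close>: the two cross terms
    become \<open>- h w w * \<theta>\<close> and \<open>- h w w * \<sigma> \<theta>\<close>, which
    add up to \<open>- h w w\<close>.\<close>
  define t where "t = - \<sigma> (h w w * \<theta> / h w z)"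
  have 1: "\<sigma> t * h w z = - (h w w * \<theta>)" unfolding t_def using assms(2) by simp
  have "t * h z w = \<sigma> (\<sigma> t * h w z)" by (simp flip: h_sym)
  also have "\<dots> = - (h w w * \<sigma> \<theta>)" unfolding 1 by (simp add: h_self_fixed)
  finally have 2: "t * h z w = - (h w w * \<sigma> \<theta>)" .
  have "h (w + t *s z) (w + t *s z) = h w w + \<sigma> t * h w z + t * h z w"
    using assms(1) by (simp add: h_simps)
  also have "\<dots> = h w w * (1 - (\<theta> + \<sigma> \<theta>))" unfolding 1 2 by (simp add: algebra_simps)
  finally show ?thesis using \<theta> by auto
qed

lemma not_perp_perp:
  assumes A: "subspace A" "nondeg A" and B: "subspace B" "B \<subseteq> A" and c: "c \<in> A" "c \<notin> B"
  obtains w where "w \<in> perp A B" "h w c \<noteq> 0"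
proof -
  have "c \<notin> perp A (perp A B)" using perp_perp[OF A B] c by simp
  then show ?thesis using that c h_eq_0_sym[of c] unfolding perp_def[of A "perp A B"] by blast
qed

text \<open>Any \<open>w\<close> not orthogonal to \<open>z\<close> becomes isotropic after a shift
  along \<open>z\<close>. If \<open>c\<close> were orthogonal to all isotropic vectors of
  \<open>perp A B\<close>, it would be orthogonal to all such \<open>w\<close>, and every other
  vector is a difference of two of them; so \<open>c\<close> would lie in the double complement,
  which is \<open>B\<close>.\<close>

lemma isotropic_avoiding:
  assumes A: "subspace A" "nondeg A" and B: "subspace B" "B \<subseteq> A"
    and z: "z \<in> perp A B" "h z z = 0" "z \<notin> B" and c: "c \<in> A" "c \<notin> B"
  obtains w where "w \<in> perp A B" "h w w = 0" "h w c \<noteq> 0"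
proof -
  note sp = subspace_perp[OF A(1), of B]
  obtain w1 where w1: "w1 \<in> perp A B" "h w1 z \<noteq> 0" using not_perp_perp[OF A B perpD1[OF z(1)] z(3)] .
  obtain w2 where w2: "w2 \<in> perp A B" "h w2 c \<noteq> 0" using not_perp_perp[OF A B c] .
  have "\<exists>w. w \<in> perp A B \<and> h w w = 0 \<and> h w c \<noteq> 0"
  proof (rule ccontr)
    assume "\<not> ?thesis"
    then have iso: "h w c = 0" if "w \<in> perp A B" "h w w = 0" for w using that by blast
    have *: "h w c = 0" if w: "w \<in> perp A B" "h w z \<noteq> 0" for w
    proof -
      obtain t where t: "h (w + t *s z) (w + t *s z) = 0" using isotropic_shift[OF z(2) w(2)] by blast
      have "w + t *s z \<in> perp A B" using sp w z by (simp add: subspace_add subspace_scale)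
      then have "h (w + t *s z) c = 0" using iso t by blast
      then show ?thesis using iso[OF z(1,2)] by (simp add: h_simps)
    qed
    have "h w2 z = 0" using * w2 by blast
    then have "h (w1 + w2) z \<noteq> 0" using w1 by (simp add: h_simps)
    then have "h (w1 + w2) c = 0" using * sp w1 w2 by (simp add: subspace_add)
    then show False using *[OF w1] w2 by (simp add: h_simps)
  qed
  then show ?thesis using that by blast
qed

text \<open>Let \<open>C\<close> be a complement of \<open>perp B T\<close> in \<open>B\<close>. By
  dimension some vector of \<open>T\<close> orthogonal to \<open>C\<close> is not in
  \<open>perp B T\<close>. Being in \<open>T\<close>, it is orthogonal to \<open>perp B T\<close> as
  well, hence to \<open>B\<close>, and it is not in \<open>B\<close>, where it would belong to
  \<open>perp B T\<close>.\<close>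

lemma isotropic_outside:
  assumes T: "T \<in> ti A m" and B: "subspace B" "B \<subseteq> A" "dim B < m"
  obtains z where "z \<in> perp A B" "h z z = 0" "z \<notin> B"
proof -
  let ?S = "perp B T"
  have S: "subspace ?S" "?S \<subseteq> B" using B subspace_perp perpD1 by blast+
  obtain C where C: "subspace C" "C \<subseteq> B" "dim ?S + dim C = dim B"
      "\<And>a. a \<in> B \<Longrightarrow> \<exists>b\<in>?S. \<exists>c\<in>C. a = b + c"
    using complement_exists[OF B(1) S] by metis
  have "dim T \<le> dim (perp T C) + dim C" by (rule dim_perp_le[OF ti_subspace[OF T] C(1)])
  then have "\<not> perp T C \<subseteq> ?S" using dim_subset[of "perp T C" ?S] C(3) B(3) ti_dim[OF T] by linarith
  then obtain z where z: "z \<in> perp T C" "z \<notin> ?S" by blast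
  have zT: "z \<in> T" using z by (rule_tac perpD1)
  then have zt: "h z t = 0" if "t \<in> T" for t using ti_h[OF T] that by blast
  have "z \<in> perp A B"
  proof (rule perpI)
    show "z \<in> A" using zT ti_sub[OF T] by blast
    fix b assume "b \<in> B"
    then obtain s c where "s \<in> ?S" "c \<in> C" "b = s + c" using C(4) by blast
    then show "h z b = 0" using perpD3[of s B T z] perpD2[OF z(1)] zT by (simp add: h_simps)
  qed
  moreover have "z \<notin> B" using z(2) zt by (auto simp: perp_def)
  ultimately show ?thesis using that zt[OF zT] by blast
qed

lemma hyp_subspace: "hyp A m \<Longrightarrow> subspace A"
  and hyp_nondeg: "hyp A m \<Longrightarrow> nondeg A"
  and hyp_dim: "hyp A m \<Longrightarrow> dim A = 2 * m"
  by (auto simp: hyp_def)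

lemma hyp_maximal_ti: assumes "hyp A m" obtains T where "T \<in> ti A m"
  using assms by (auto simp: hyp_def)

lemma ti_dim_le:
  assumes A: "hyp A m" and U: "U \<in> ti A d" shows "d \<le> m"
proof -
  have "U \<subseteq> perp A U" using ti_sub[OF U] ti_h[OF U] by (auto intro!: perpI)
  then have "d \<le> dim (perp A U)" using dim_subset ti_dim[OF U] by blast
  then show ?thesis
    using dim_perp[OF hyp_subspace[OF A] hyp_nondeg[OF A] ti_subspace[OF U] ti_sub[OF U]] ti_dim[OF U] hyp_dim[OF A]
    by linarith
qed

lemma ti_extend:
  assumes A: "hyp A m" and U: "U \<in> ti A d"
  obtains T where "T \<in> ti A m" "U \<subseteq> T"
proof -
  have "\<exists>T. T \<in> ti A m \<and> U \<subseteq> T"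
    using U
  proof (induction "m - d" arbitrary: U d)
    case 0
    then show ?case using ti_dim_le[OF A 0(2)] by auto
  next
    case (Suc j)
    obtain T where T: "T \<in> ti A m" using hyp_maximal_ti[OF A] .
    have "dim U < m" using ti_dim[OF Suc(3)] Suc(2) by linarith
    then obtain z where z: "z \<in> perp A U" "h z z = 0" "z \<notin> U"
      using isotropic_outside[OF T ti_subspace[OF Suc(3)] ti_sub[OF Suc(3)]] by blast
    have "j = m - Suc d" using Suc(2) by simp
    from Suc(1)[OF this ti_insert[OF hyp_subspace[OF A] Suc(3) z]]
    show ?case using span_superset[of "insert z U"] by blast
  qed
  then show ?thesis using that by blast
qed

text \<open>The span of \<open>x\<close>, \<open>y\<close> and \<open>M\<close> may have dimension
  \<open>m\<close>, which \<open>isotropic_outside\<close> excludes. Here \<open>z\<close> comes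
  from a maximal t.i. space through \<open>M\<close> and \<open>x\<close>: orthogonal to
  \<open>y\<close> and outside \<open>M\<close>.\<close>

lemma isotropic_outside_pair:
  assumes A: "hyp A m" and M: "M \<in> ti A d" "Suc d < m"
    and x: "x \<in> perp A M" "h x x = 0" and y: "y \<in> perp A M" and xy: "h x y \<noteq> 0"
  obtains z where "z \<in> perp A (span (insert x (insert y M)))" "h z z = 0" "z \<notin> span (insert x (insert y M))"
proof -
  note sM = ti_subspace[OF M(1)]
  have "x \<notin> M" using xy perpD3[OF y] by blast
  then have Mx: "span (insert x M) \<in> ti A (Suc d)" using ti_insert[OF hyp_subspace[OF A] M(1) x] by blast
  obtain T where T: "T \<in> ti A m" "span (insert x M) \<subseteq> T" using ti_extend[OF A Mx] .
  have xMT: "x \<in> T" "M \<subseteq> T" using T(2) span_superset[of "insert x M"] by auto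
  have "m \<le> Suc (dim (perp T {y}))" using dim_perp_vector[OF ti_subspace[OF T(1)]] ti_dim[OF T(1)] by simp
  then have "\<not> perp T {y} \<subseteq> M" using dim_subset[of "perp T {y}" M] M(2) ti_dim[OF M(1)] by linarith
  then obtain z where z: "z \<in> perp T {y}" "z \<notin> M" by blast
  have zT: "z \<in> T" "h z y = 0" using z by (auto simp: perp_def)
  have zt: "h z t = 0" if "t \<in> T" for t using ti_h[OF T(1) zT(1) that] .
  have "z \<in> perp A (insert x (insert y M))"
    using zT zt xMT ti_sub[OF T(1)] by (auto simp: perp_def)
  moreover have "z \<notin> span (insert x (insert y M))"
  proof
    assume "z \<in> span (insert x (insert y M))"
    then obtain a b mm where mm: "mm \<in> M" "z = mm + a *s y + b *s x"
      unfolding span_breakdown_eq span_eqI[OF sM]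
      by (metis (no_types, lifting) add.commute diff_add_cancel add.assoc diff_diff_eq)
    have mx: "h mm x = 0" "h mm y = 0" using mm perpD3[OF x(1)] perpD3[OF y] by auto
    have "h z x = a * h y x" using mm mx x(2) by (simp add: h_simps)
    then have "a = 0" using zt[OF xMT(1)] xy h_eq_0_sym[of x y] by simp
    then have "h z y = b * h x y" using mm mx by (simp add: h_simps)
    then have "b = 0" using zT(2) xy by simp
    then show False using mm \<open>a = 0\<close> z(2) by simp
  qed
  ultimately show ?thesis using that zt[OF zT(1)] by (simp add: perp_span)
qed

lemma hyp_hpair:
  assumes A: "hyp A m" and p: "p \<in> A" "p \<noteq> 0" "h p p = 0"
  obtains q where "hpair A p q"
proof -
  note sA = hyp_subspace[OF A]
  have "p \<notin> perp A A" using hyp_nondeg[OF A] p by (auto simp: nondeg_def)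
  then obtain y where y: "y \<in> A" "h p y \<noteq> 0" using p by (auto simp: perp_def)
  then obtain t where t: "h (y + t *s p) (y + t *s p) = 0" using isotropic_shift[OF p(3), of y] h_eq_0_sym by blast
  let ?y = "y + t *s p"
  have 1: "h p ?y = h p y" using p by (simp add: h_simps)
  define q where "q = \<sigma> (inverse (h p ?y)) *s ?y"
  have "h p q = 1" using y(2) unfolding q_def 1 h_scale_right by simp
  moreover have "h q q = 0" unfolding q_def h_scale_right h_scale_left t by simp
  moreover have "q \<in> A" using sA y p unfolding q_def by (simp add: subspace_add subspace_scale)
  ultimately show ?thesis using that p h_sym[of q p] by (simp add: hpair_def)
qed

lemma hyp_hpair_exists:
  assumes A: "hyp A (Suc m)" obtains p q where "hpair A p q"
proof -
  obtain T where T: "T \<in> ti A (Suc m)" using hyp_maximal_ti[OF A] .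
  have "\<not> T \<subseteq> {0}" using ti_dim[OF T] dim_eq_0[of T] by (metis nat.distinct(1))
  then obtain p where p: "p \<in> T" "p \<noteq> 0" by auto
  then show ?thesis using hyp_hpair[OF A, of p] ti_h[OF T p(1) p(1)] ti_sub[OF T] that by blast
qed

lemma hpair_decomp:
  assumes A: "subspace A" and pq: "hpair A p q" and x: "x \<in> A"
  obtains w where "w \<in> perp A {p, q}" "x = h x q *s p + h x p *s q + w"
proof -
  let ?w = "x - h x q *s p - h x p *s q"
  have "?w \<in> A" using A x pq by (simp add: hpair_def subspace_diff subspace_scale)
  then have "?w \<in> perp A {p, q}" using pq by (auto simp: perp_def h_simps hpair_def)
  then show ?thesis using that by (simp add: algebra_simps)
qed

lemma hpair_dim: assumes "hpair A p q" shows "dim (span {p, q}) = 2"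
proof -
  have "q \<notin> span {}" using assms by (auto simp: hpair_def)
  moreover have "p \<notin> span {q}" using assms by (auto simp: hpair_def span_singleton h_simps)
  ultimately show ?thesis by (simp add: dim_insert)
qed

text \<open>Together with \<open>ti_cone\<close> this identifies the t.i. spaces through
  \<open>p\<close> with the t.i. spaces of \<open>perp A {p, q}\<close>, one dimension
  lower.\<close>

lemma ti_residue:
  assumes pq: "hpair A p q" and K: "K \<in> ti A (Suc d)" "p \<in> K"
  obtains K' where "K' \<in> ti (perp A {p, q}) d" "K = span (insert p K')"
proof -
  have 1: "h p q \<noteq> 0" using pq by (simp add: hpair_def)
  note * = ti_hyperplane_perp[OF K 1]
  have "perp K {q} \<subseteq> perp A {p, q}" using ti_sub[OF K(1)] ti_h[OF K(1) _ K(2)] by (auto simp: perp_def)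
  then have "perp K {q} \<in> ti (perp A {p, q}) d" using *(1) by (auto simp: ti_iff)
  then show ?thesis using that *(3) by blast
qed

lemma ti_cone:
  assumes A: "subspace A" and pq: "hpair A p q" and K: "K \<in> ti (perp A {p, q}) d"
  shows "span (insert p K) \<in> ti A (Suc d)" "p \<notin> K"
proof -
  have KA: "K \<in> ti A d" using K by (rule ti_mono[rotated]) (auto simp: perp_def)
  show pK: "p \<notin> K" using ti_sub[OF K] pq by (auto simp: perp_def hpair_def)
  have "p \<in> perp A K" using pq ti_sub[OF K] by (auto simp: perp_def hpair_def h_eq_0_sym)
  then show "span (insert p K) \<in> ti A (Suc d)" using ti_insert[OF A KA _ _ pK] pq by (simp add: hpair_def)
qed

lemma hyp_perp:
  assumes A: "hyp A (Suc m)" and pq: "hpair A p q"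
  shows "hyp (perp A {p, q}) m"
proof -
  let ?W = "perp A {p, q}"
  note sA = hyp_subspace[OF A] and nA = hyp_nondeg[OF A]
  have "{p, q} \<subseteq> A" using pq by (simp add: hpair_def)
  then have "dim (perp A (span {p, q})) + dim (span {p, q}) = dim A"
    using dim_perp[OF sA nA subspace_span] span_minimal[OF _ sA] by blast
  then have "dim ?W = 2 * m" unfolding hpair_dim[OF pq] perp_span hyp_dim[OF A] by simp
  moreover have "nondeg ?W"
    unfolding nondeg_def
  proof
    fix x assume x: "x \<in> perp ?W ?W"
    have "x \<in> perp A A"
    proof (rule perpI)
      show "x \<in> A" using x by (auto simp: perp_def)
      fix y assume "y \<in> A"
      then obtain w where "w \<in> ?W" "y = h y q *s p + h y p *s q + w" using hpair_decomp[OF sA pq] by blast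
      moreover have "h x p = 0" "h x q = 0" using x by (auto simp: perp_def)
      ultimately show "h x y = 0" using perpD2[OF x] by (metis add_0 h_add_right h_scale_right mult_zero_right)
    qed
    then show "x \<in> {0}" using nA by (auto simp: nondeg_def)
  qed
  moreover have "ti ?W m \<noteq> {}"
  proof -
    have "p \<notin> {0}" using pq by (auto simp: hpair_def)
    moreover have "{0} \<in> ti A 0" using ti_0[OF sA] by simp
    moreover have "p \<in> perp A {0}" "h p p = 0" using pq by (auto simp: perp_def hpair_def)
    ultimately have "span (insert p {0}) \<in> ti A (Suc 0)" using ti_insert[OF sA] by blast
    then obtain T where T: "T \<in> ti A (Suc m)" "span (insert p {0}) \<subseteq> T" using ti_extend[OF A] by blast
    then have "p \<in> T" using span_base by blast
    then show ?thesis using ti_residue[OF pq T(1)] by blast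
  qed
  ultimately show ?thesis using subspace_perp[OF sA] by (simp add: hyp_def)
qed

text \<open>A list, because its prefixes span the growing subspaces \<open>Y\<close> and the parity
  of a position gives the norm.\<close>

definition alt :: "'v list \<Rightarrow> bool" where
  "alt L \<longleftrightarrow> even (length L) \<and>
    (\<forall>i<length L. \<forall>j<length L. h (L ! i) (L ! j) = (if i = j then (- 1) ^ i else 0))"

lemma hyp_alt:
  assumes "hyp A m"
  shows "\<exists>L. alt L \<and> length L = 2 * m \<and> span (set L) = A"
  using assms
proof (induction m arbitrary: A)
  case 0
  have "A \<subseteq> {0}" using hyp_dim[OF 0] by simp
  then have "A = {0}" using subspace_0[OF hyp_subspace[OF 0]] by auto
  then show ?case by (intro exI[of _ "[]"]) (simp add: alt_def)
next
  case (Suc m)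
  note sA = hyp_subspace[OF Suc(2)]
  obtain p q where pq: "hpair A p q" using hyp_hpair_exists[OF Suc(2)] .
  let ?W = "perp A {p, q}"
  obtain L where L: "alt L" "length L = 2 * m" "span (set L) = ?W" using Suc(1)[OF hyp_perp[OF Suc(2) pq]] by blast
  \<comment> \<open>The norm of \<open>a\<close> is the trace of \<open>\<theta>\<close>, that of
    \<open>b\<close> its negative; conjugating the second coefficient makes the cross terms
    cancel.\<close>
  define a b where "a = p + \<theta> *s q" and "b = p - \<sigma> \<theta> *s q"
  have hab: "h a a = 1" "h b b = -1" "h a b = 0" "h b a = 0"
    using pq unfolding a_def b_def hpair_def by (auto simp: h_simps \<sigma>_\<theta>)
  have LW: "x \<in> ?W" if "x \<in> set L" for x using L(3) that span_base by blast
  have orth: "h a x = 0" "h x a = 0" "h b x = 0" "h x b = 0" if "x \<in> set L" for x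
    using perpD2[OF LW[OF that]] perpD3[OF LW[OF that]] unfolding a_def b_def by (simp_all add: h_simps)
  have "alt (a # b # L)"
    unfolding alt_def
  proof (intro conjI allI impI)
    show "even (length (a # b # L))" using L(2) by simp
    fix i j assume ij: "i < length (a # b # L)" "j < length (a # b # L)"
    have c: "k = 0 \<or> k = 1 \<or> (\<exists>k'. k = Suc (Suc k') \<and> k' < length L)" if "k < length (a # b # L)" for k
      using that by (cases k; cases "k - 1") auto
    show "h ((a # b # L) ! i) ((a # b # L) ! j) = (if i = j then (- 1) ^ i else 0)"
      using c[OF ij(1)] c[OF ij(2)]
    proof (elim disjE exE conjE)
      fix k l assume "i = Suc (Suc k)" "k < length L" "j = Suc (Suc l)" "l < length L"
      then show ?thesis using L(1) by (simp add: alt_def)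
    qed (use hab orth in auto)
  qed
  moreover have "span (set (a # b # L)) = A"
  proof (rule span_subspace)
    show "set (a # b # L) \<subseteq> A"
      using pq LW sA by (auto simp: hpair_def a_def b_def perp_def intro!: subspace_add subspace_diff subspace_scale)
    show "A \<subseteq> span (set (a # b # L))"
    proof
      fix x assume "x \<in> A"
      then obtain w where w: "w \<in> ?W" "x = h x q *s p + h x p *s q + w" using hpair_decomp[OF sA pq] by blast
      let ?S = "span (set (a # b # L))"
      have ab: "a \<in> ?S" "b \<in> ?S" by (auto intro: span_base)
      have "a - b = (\<theta> + \<sigma> \<theta>) *s q" unfolding a_def b_def by (simp add: scale_left_distrib)
      then have q: "q \<in> ?S" using \<theta> span_diff[OF ab] by simp
      have "p = a - \<theta> *s q" by (simp add: a_def)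
      then have p: "p \<in> ?S" using ab q by (metis span_diff span_scale)
      have "w \<in> ?S" using w(1) L(3) span_mono[of "set L" "set (a # b # L)"] by auto
      then show "x \<in> ?S" using p q w(2) by (metis span_add span_scale)
    qed
    show "subspace A" by (rule sA)
  qed
  ultimately show ?case using L(2) by (intro exI[of _ "a # b # L"]) simp
qed

section \<open>Polar Grassmannians below the top rank\<close>

text \<open>Phrased with three members of a line, and tested on \<open>ti A k\<close> only, so that
  \<open>X\<close> may be any family, for instance the preimage of a closed family under a
  cone.\<close>

definition pclosed :: "'v set \<Rightarrow> nat \<Rightarrow> nat \<Rightarrow> 'v set set \<Rightarrow> bool" where
  "pclosed A m k X \<longleftrightarrow>
    (\<forall>D\<in>ti A (k - 1). \<forall>K1\<in>ti A k \<inter> X. \<forall>K2\<in>ti A k \<inter> X. \<forall>K\<in>ti A k.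
      K1 \<noteq> K2 \<and> D \<subseteq> K1 \<and> D \<subseteq> K2 \<and> D \<subseteq> K \<and>
      (k < m \<longrightarrow> (\<exists>U\<in>ti A (k + 1). K1 \<subseteq> U \<and> K2 \<subseteq> U \<and> K \<subseteq> U)) \<longrightarrow> K \<in> X)"

text \<open>An upper bound instead of an exact size, since images of generators under cones may
  coincide.\<close>

definition gen :: "'v set \<Rightarrow> nat \<Rightarrow> nat \<Rightarrow> nat \<Rightarrow> bool" where
  "gen A m k b \<longleftrightarrow> (\<exists>S. finite S \<and> card S \<le> b \<and> S \<subseteq> ti A k \<and>
     (\<forall>X. pclosed A m k X \<and> S \<subseteq> X \<longrightarrow> ti A k \<subseteq> X))"

text \<open>The points of the polar space \<open>D\<^sup>\<bottom> / D\<close> belonging to \<open>X\<close>, as vectors; the vectors of \<open>D\<close> represent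
  zero and are included to make the set closed under orthogonal linear combinations.\<close>

definition pencil :: "'v set \<Rightarrow> 'v set set \<Rightarrow> 'v set \<Rightarrow> 'v set" where
  "pencil A X D = {x \<in> perp A D. h x x = 0 \<and> (x \<in> D \<or> span (insert x D) \<in> X)}"

lemma span_insert_eq:
  assumes D: "subspace D" and z: "z \<in> span (insert x D)" "z \<notin> D"
  shows "span (insert z D) = span (insert x D)"
proof
  show "span (insert z D) \<subseteq> span (insert x D)"
    using z by (intro span_minimal) (auto simp: span_base)
  have "x \<in> span (insert z D)" using in_span_insert[OF z(1)] z(2) D by (simp add: span_eqI)
  then show "span (insert x D) \<subseteq> span (insert z D)"
    by (intro span_minimal) (auto simp: span_base)
qed

lemma span_insert_span: "span (insert x (span S)) = span (insert x S)"
proof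
  show "span (insert x (span S)) \<subseteq> span (insert x S)"
    using span_mono[of S "insert x S"] by (intro span_minimal) (auto simp: span_base)
  show "span (insert x S) \<subseteq> span (insert x (span S))"
    by (intro span_mono) (auto simp: span_base)
qed

lemma span_insert_commute: "span (insert x (span (insert y S))) = span (insert y (span (insert x S)))"
  by (simp add: span_insert_span insert_commute)

lemma pclosedD:
  assumes "pclosed A m k X" "D \<in> ti A (k - 1)" "K1 \<in> ti A k" "K1 \<in> X" "K2 \<in> ti A k" "K2 \<in> X" "K \<in> ti A k"
    "K1 \<noteq> K2" "D \<subseteq> K1" "D \<subseteq> K2" "D \<subseteq> K" "U \<in> ti A (k + 1)" "K1 \<subseteq> U" "K2 \<subseteq> U" "K \<subseteq> U"
  shows "K \<in> X"
  using assms unfolding pclosed_def by (meson IntI)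

text \<open>Orthogonality makes \<open>D\<close>, \<open>x\<close> and \<open>y\<close> span a t.i.
  space \<open>U\<close>, so the three spaces over \<open>D\<close> lie on the line of
  \<open>D\<close> and \<open>U\<close>. If \<open>x\<close> and \<open>y\<close> are dependent
  modulo \<open>D\<close>, the new space is one of the two old ones.\<close>

lemma pencil_combine:
  assumes A: "subspace A" and X: "pclosed A m (Suc d) X" and D: "D \<in> ti A d"
    and x: "x \<in> pencil A X D" and y: "y \<in> pencil A X D" and xy: "h x y = 0"
  shows "a *s x + b *s y \<in> pencil A X D"
proof -
  let ?z = "a *s x + b *s y"
  note sD = ti_subspace[OF D]
  have yx: "h y x = 0" using xy h_eq_0_sym by blast
  have px: "x \<in> perp A D" "h x x = 0" and py: "y \<in> perp A D" "h y y = 0" using x y by (auto simp: pencil_def)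
  have pz: "?z \<in> perp A D" using px py subspace_perp[OF A] by (simp add: subspace_add subspace_scale)
  have hz: "h ?z ?z = 0" using px py xy yx by (simp add: h_simps)
  have "span (insert ?z D) \<in> X" if z: "?z \<notin> D"
  proof (cases "x \<in> D \<or> y \<in> span (insert x D)")
    case True
    show ?thesis
    proof (cases "x \<in> D")
      case True
      then have "y \<notin> D" using z sD by (auto simp: subspace_add subspace_scale)
      then have "span (insert y D) \<in> X" using y by (auto simp: pencil_def)
      moreover have "?z \<in> span (insert y D)" using True by (simp add: span_base span_add span_scale)
      ultimately show ?thesis using span_insert_eq[OF sD _ z] by simp
    next
      case False
      then have "span (insert x D) \<in> X" using x by (auto simp: pencil_def)
      moreover have "?z \<in> span (insert x D)"
        using True False by (simp add: span_base span_add span_scale)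
      ultimately show ?thesis using span_insert_eq[OF sD _ z] by simp
    qed
  next
    case False
    then have xD: "x \<notin> D" and yx': "y \<notin> span (insert x D)" by auto
    show ?thesis
    proof (cases "y \<in> D")
      case True
      then show ?thesis using yx' span_base by blast
    next
      case False
      let ?K1 = "span (insert x D)" and ?K2 = "span (insert y D)" and ?K = "span (insert ?z D)"
      let ?U = "span (insert y ?K1)"
      have K1: "?K1 \<in> ti A (Suc d)" "?K1 \<in> X" using ti_insert[OF A D px xD] x xD by (auto simp: pencil_def)
      have K2: "?K2 \<in> ti A (Suc d)" "?K2 \<in> X" using ti_insert[OF A D py False] y False by (auto simp: pencil_def)
      have K: "?K \<in> ti A (Suc d)" using ti_insert[OF A D pz hz z] .
      have "y \<in> perp A ?K1" using py yx unfolding perp_span by (auto simp: perp_def)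
      then have U: "?U \<in> ti A (Suc d + 1)" using ti_insert[OF A K1(1) _ py(2) yx'] by simp
      have U': "?U = span (insert y (insert x D))" by (rule span_insert_span)
      have ne: "?K1 \<noteq> ?K2" using yx' span_base[of y "insert y D"] by blast
      have zU: "?z \<in> span (insert y (insert x D))" by (simp add: span_base span_add span_scale)
      have "?K1 \<subseteq> ?U" "?K2 \<subseteq> ?U" unfolding U' by (intro span_mono; blast)+
      moreover have "?K \<subseteq> ?U" unfolding U' using zU by (intro span_minimal) (auto simp: span_base)
      moreover have "D \<subseteq> ?K1" "D \<subseteq> ?K2" "D \<subseteq> ?K" by (auto intro: span_base)
      moreover have "D \<in> ti A (Suc d - 1)" using D by simp
      ultimately show ?thesis using pclosedD[OF X _ K1 K2 K ne _ _ _ U] by blast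
    qed
  qed
  then show ?thesis using pz hz by (auto simp: pencil_def)
qed

lemma pencil_base:
  assumes D: "D \<in> ti A d" and x: "x \<in> D" shows "x \<in> pencil A X D"
  using ti_h[OF D x] ti_sub[OF D] x by (auto simp: pencil_def perp_def)

lemma pencil_all:
  assumes D: "D \<in> ti A d" and all: "\<And>x. x \<in> perp A D \<Longrightarrow> h x x = 0 \<Longrightarrow> x \<in> pencil A X D"
    and K: "K \<in> ti A (Suc d)" "D \<subseteq> K"
  shows "K \<in> X"
proof -
  obtain x where "x \<in> K" "x \<notin> D" "K = span (insert x D)" "x \<in> perp A D" "h x x = 0"
    using ti_extension_vector[OF K(1) ti_subspace[OF D] ti_dim[OF D] K(2)] .
  then show ?thesis using all[of x] by (auto simp: pencil_def)
qed

text \<open>The points outside a hyperplane of a polar space of rank at least two are connected by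
  collinearity, and a line through two of them meets the hyperplane: a hyperplane is a maximal subspace.\<close>

lemma hyperplane_maximal:
  assumes A: "hyp A m" and d: "Suc d < m" and X: "pclosed A m (Suc d) X" and M: "M \<in> ti A d" and c: "c \<in> A"
    and hyperplane: "\<And>x. x \<in> perp A M \<Longrightarrow> h x x = 0 \<Longrightarrow> h x c = 0 \<Longrightarrow> x \<in> pencil A X M"
    and y: "y \<in> pencil A X M" "h y c \<noteq> 0" and x: "x \<in> perp A M" "h x x = 0"
  shows "x \<in> pencil A X M"
proof -
  note sA = hyp_subspace[OF A] and nA = hyp_nondeg[OF A] and sM = ti_subspace[OF M]
  note sP = subspace_perp[OF sA, of M]
  have edge: "u \<in> pencil A X M" if u: "u \<in> perp A M" "h u u = 0" and v: "v \<in> pencil A X M" "h v c \<noteq> 0" and uv: "h u v = 0" for u v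
  proof -
    have v': "v \<in> perp A M" "h v v = 0" using v by (auto simp: pencil_def)
    \<comment> \<open>\<open>u - l *s v\<close> is the point of the line through \<open>u\<close>
      and \<open>v\<close> that lies in the hyperplane of \<open>c\<close>.\<close>
    define l where "l = h u c / h v c"
    have vu: "h v u = 0" using uv h_eq_0_sym by blast
    have "u - l *s v \<in> perp A M" using u v' sP by (simp add: subspace_diff subspace_scale)
    moreover have "h (u - l *s v) (u - l *s v) = 0" using u v' uv vu by (simp add: h_simps)
    moreover have "h (u - l *s v) c = 0" using v(2) by (simp add: h_simps l_def)
    ultimately have 1: "u - l *s v \<in> pencil A X M" by (rule hyperplane)
    have "h v (u - l *s v) = 0" using v' vu by (simp add: h_simps)
    from pencil_combine[OF sA X M v(1) 1 this, of l 1] show ?thesis by simp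
  qed
  have y': "y \<in> perp A M" "h y y = 0" using y by (auto simp: pencil_def)
  \<comment> \<open>If \<open>u\<close> is not collinear with \<open>y\<close>, both have a common
    neighbour \<open>w\<close> off the hyperplane; the condition on \<open>c\<close> is what
    \<open>isotropic_avoiding\<close> needs to find it.\<close>
  have two_step: "u \<in> pencil A X M"
    if u: "u \<in> perp A M" "h u u = 0" and uy: "h u y \<noteq> 0" and cB: "c \<notin> span (insert u (insert y M))" for u
  proof -
    let ?B = "span (insert u (insert y M))"
    have "insert u (insert y M) \<subseteq> A" using u y' ti_sub[OF M] by (auto simp: perp_def)
    then have B: "subspace ?B" "?B \<subseteq> A" using span_minimal[OF _ sA] by simp_all
    obtain z where z: "z \<in> perp A ?B" "h z z = 0" "z \<notin> ?B"
      using isotropic_outside_pair[OF A M d u y'(1) uy] .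
    obtain w where w: "w \<in> perp A ?B" "h w w = 0" "h w c \<noteq> 0"
      using isotropic_avoiding[OF sA nA B z c cB] .
    have wP: "w \<in> perp A M" using w(1) unfolding perp_span by (auto simp: perp_def)
    have "h w y = 0" "h w u = 0" using w(1) unfolding perp_span by (auto simp: perp_def)
    then have "w \<in> pencil A X M" using edge[OF wP w(2) y] by blast
    then show ?thesis using edge[OF u _ w(3)] \<open>h w u = 0\<close> h_eq_0_sym by blast
  qed
  show ?thesis
  proof (cases "h x y = 0")
    case True
    then show ?thesis using edge[OF x y] by blast
  next
    case xy: False
    let ?B = "span (insert x (insert y M))"
    show ?thesis
    proof (cases "c \<in> ?B")
      case False
      then show ?thesis using two_step[OF x xy] by blast
    next
      case True
      obtain z where z: "z \<in> perp A ?B" "h z z = 0" "z \<notin> ?B"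
        using isotropic_outside_pair[OF A M d x y'(1) xy] .
      have zM: "z \<in> perp A M" and zx: "h z x = 0" "h x z = 0" and zy: "h z y = 0"
        using z(1) unfolding perp_span by (auto simp: perp_def h_eq_0_sym)
      have zc: "h z c = 0" using perpD2[OF z(1) True] .
      show ?thesis
      proof (cases "h x c = 0")
        case True
        then show ?thesis using hyperplane x by blast
      next
        case False
        \<comment> \<open>A detour through a point collinear with \<open>x\<close>. If
          \<open>c\<close> were in its critical span too, then, as \<open>z\<close> is not in
          \<open>?B\<close>, it would lie in the span of \<open>y\<close> and \<open>M\<close> and
          be orthogonal to \<open>y\<close>.\<close>
        let ?x = "x + z"
        have x1: "?x \<in> perp A M" "h ?x ?x = 0" using x zM sP zx z(2) by (auto simp: subspace_add h_simps)
        have x1y: "h ?x y \<noteq> 0" using xy zy by (simp add: h_simps)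
        have "c \<notin> span (insert ?x (insert y M))"
        proof
          assume "c \<in> span (insert ?x (insert y M))"
          then obtain a where a: "c - a *s ?x \<in> span (insert y M)" unfolding span_breakdown_eq by blast
          have sub: "span (insert y M) \<subseteq> ?B" by (rule span_mono) blast
          have "x \<in> ?B" by (simp add: span_base)
          have "a *s z = c - (c - a *s ?x) - a *s x" by (simp add: scale_right_distrib)
          moreover have "c - (c - a *s ?x) - a *s x \<in> ?B"
            using span_diff[OF span_diff[OF True subsetD[OF sub a]] span_scale[OF \<open>x \<in> ?B\<close>]] .
          ultimately have "a *s z \<in> ?B" by simp
          then have "inverse a *s (a *s z) \<in> ?B" by (rule span_scale)
          then have "a = 0" using z(3) by (cases "a = 0") simp_all
          then have "c \<in> span (insert y M)" using a by simp
          then obtain b where b: "c - b *s y \<in> M" unfolding span_breakdown_eq span_eqI[OF sM] by blast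
          have "h y (c - b *s y) = 0" using perpD2[OF y'(1) b] .
          then show False using y'(2) y(2) by (simp add: h_simps)
        qed
        then have "?x \<in> pencil A X M" using two_step[OF x1 x1y] by blast
        moreover have "h ?x c \<noteq> 0" using False zc by (simp add: h_simps)
        moreover have "h x ?x = 0" using x zx by (simp add: h_simps)
        ultimately show ?thesis using edge[OF x] by blast
      qed
    qed
  qed
qed

lemma h_one_sym: "h x y = 1 \<Longrightarrow> h y x = 1"
  using h_sym[of y x] by simp

text \<open>\<open>r\<close> and \<open>s\<close> are not orthogonal and cannot be combined
  directly. The second pair mediates: \<open>p + r\<close> and \<open>s - q\<close> are orthogonal,
  and \<open>p\<close> and \<open>q\<close> are eliminated again at the end.\<close>

lemma frame_step:
  assumes A: "subspace A" and X: "pclosed A m (Suc d) X" and D: "D \<in> ti A d"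
    and Q: "p \<in> pencil A X D" "q \<in> pencil A X D" "r \<in> pencil A X D" "s \<in> pencil A X D"
    and pq: "h p q = 1" and rs: "h r s = 1" and orth: "h p r = 0" "h p s = 0" "h q r = 0" "h q s = 0"
    and \<delta>: "\<sigma> \<delta> = - \<delta>"
  shows "r + \<delta> *s s \<in> pencil A X D"
proof -
  note comb = pencil_combine[OF A X D]
  have iso: "h p p = 0" "h q q = 0" "h r r = 0" "h s s = 0" using Q by (auto simp: pencil_def)
  have sym: "h q p = 1" "h s r = 1" "h r p = 0" "h s p = 0" "h r q = 0" "h s q = 0"
    using h_one_sym[OF pq] h_one_sym[OF rs] orth h_eq_0_sym by auto
  note hh = iso sym pq rs orth
  \<comment> \<open>Additive Hilbert 90, made explicit by \<open>\<theta>\<close>: a skew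
    \<open>\<delta>\<close> has the form \<open>\<sigma> \<gamma> - \<gamma>\<close>.\<close>
  define \<gamma> where "\<gamma> = - (\<delta> * \<theta>)"
  have \<gamma>: "\<sigma> \<gamma> - \<gamma> = \<delta>" unfolding \<gamma>_def using \<delta> \<theta> by (simp add: \<sigma>_\<theta> algebra_simps)
  have t1: "p + r \<in> pencil A X D" using comb[OF Q(1) Q(3), of 1 1] hh by simp
  have t2: "s - q \<in> pencil A X D" using comb[OF Q(4) Q(2), of 1 "-1"] hh by simp
  have "h (p + r) (s - q) = 0" using hh by (simp add: h_simps)
  from comb[OF t1 t2 this, of 1 "\<sigma> \<gamma>"] have t3: "p + r + \<sigma> \<gamma> *s (s - q) \<in> pencil A X D" by simp
  have t4: "p + \<gamma> *s s \<in> pencil A X D" using comb[OF Q(1) Q(4), of 1 \<gamma>] hh by simp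
  have "h (p + r + \<sigma> \<gamma> *s (s - q)) (p + \<gamma> *s s) = 0" using hh by (simp add: h_simps)
  from comb[OF t3 t4 this, of 1 "-1"]
  have t5: "p + r + \<sigma> \<gamma> *s (s - q) - (p + \<gamma> *s s) \<in> pencil A X D" by simp
  have "h (p + r + \<sigma> \<gamma> *s (s - q) - (p + \<gamma> *s s)) q = 0" using hh by (simp add: h_simps)
  from comb[OF t5 Q(2) this, of 1 "\<sigma> \<gamma>"]
  have "p + r + \<sigma> \<gamma> *s (s - q) - (p + \<gamma> *s s) + \<sigma> \<gamma> *s q \<in> pencil A X D" by simp
  moreover have "p + r + \<sigma> \<gamma> *s (s - q) - (p + \<gamma> *s s) + \<sigma> \<gamma> *s q = r + (\<sigma> \<gamma> - \<gamma>) *s s"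
    by (simp add: algebra_simps)
  ultimately show ?thesis using \<gamma> by metis
qed

lemma perp_hpair_sub: "perp A {p, q} \<subseteq> A"
  by (auto simp: perp_def)

lemma cone_inject:
  assumes K: "K \<in> ti (perp A {p, q}) d" and pq: "hpair A p q"
  shows "perp (span (insert p K)) {q} = K"
proof -
  have "x \<in> K \<longleftrightarrow> x \<in> span (insert p K) \<and> h x q = 0" for x
  proof
    assume x: "x \<in> K"
    then show "x \<in> span (insert p K) \<and> h x q = 0" using ti_sub[OF K] by (auto simp: perp_def intro: span_base)
  next
    assume "x \<in> span (insert p K) \<and> h x q = 0"
    then obtain c y where y: "y \<in> K" "x = y + c *s p" "h x q = 0"
      using mem_span_insert[OF ti_subspace[OF K]] by blast
    have "h y q = 0" using y(1) ti_sub[OF K] by (auto simp: perp_def)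
    then have "c = 0" using y pq by (simp add: h_simps hpair_def)
    then show "x \<in> K" using y by simp
  qed
  then show ?thesis by (auto simp: perp_def)
qed

text \<open>As \<open>d < m\<close>, a line of the complement has an upper space \<open>U\<close>,
  and the cones over its \<open>D\<close> and \<open>U\<close> determine a line of
  \<open>A\<close>.\<close>

lemma pclosed_residue:
  assumes A: "subspace A" and pq: "hpair A p q" and d: "d < m" and X: "pclosed A (Suc m) (Suc d) X"
  shows "pclosed (perp A {p, q}) m d {K. span (insert p K) \<in> X}"
proof (cases d)
  case 0
  \<comment> \<open>Here \<open>d - 1\<close> is truncated to zero, but there is only one
    \<open>0\<close>-space and a line needs two distinct members.\<close>
  then show ?thesis using ti_0[OF subspace_perp[OF A]] by (auto simp: pclosed_def)
next
  case (Suc e)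
  let ?W = "perp A {p, q}"
  show ?thesis
    unfolding pclosed_def
  proof (intro ballI impI, elim conjE)
    fix D K1 K2 K
    assume D: "D \<in> ti ?W (d - 1)" and K1: "K1 \<in> ti ?W d \<inter> {K. span (insert p K) \<in> X}"
      and K2: "K2 \<in> ti ?W d \<inter> {K. span (insert p K) \<in> X}" and K: "K \<in> ti ?W d" and ne: "K1 \<noteq> K2"
      and sub: "D \<subseteq> K1" "D \<subseteq> K2" "D \<subseteq> K"
      and "d < m \<longrightarrow> (\<exists>U\<in>ti ?W (d + 1). K1 \<subseteq> U \<and> K2 \<subseteq> U \<and> K \<subseteq> U)"
    then obtain U where U: "U \<in> ti ?W (Suc d)" "K1 \<subseteq> U" "K2 \<subseteq> U" "K \<subseteq> U" using d by auto
    let ?c = "\<lambda>K. span (insert p K)"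
    have mono: "S \<subseteq> T \<Longrightarrow> ?c S \<subseteq> ?c T" for S T by (intro span_mono) auto
    have "?c K1 \<noteq> ?c K2" using cone_inject[OF _ pq] K1 K2 ne by (metis IntD1)
    moreover have "?c D \<in> ti A (Suc d - 1)" using ti_cone(1)[OF A pq D] Suc by simp
    moreover have "?c U \<in> ti A (Suc d + 1)" using ti_cone(1)[OF A pq U(1)] by simp
    moreover have "?c K1 \<in> ti A (Suc d)" "?c K2 \<in> ti A (Suc d)" "?c K \<in> ti A (Suc d)"
      using ti_cone(1)[OF A pq] K1 K2 K by auto
    ultimately have "?c K \<in> X"
      using pclosedD[OF X, of "?c D" "?c K1" "?c K2" "?c K" "?c U"] K1 K2 sub U mono by blast
    then show "K \<in> {K. span (insert p K) \<in> X}" by simp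
  qed
qed

section \<open>From the complement of a hyperbolic pair to the whole space\<close>

context
  fixes A m p q W
  assumes A: "hyp A (Suc m)" and pq: "hpair A p q" and W: "W = perp A {p, q}"
begin

lemma A_subspace: "subspace A" and A_nondeg: "nondeg A" and W_subspace: "subspace W" and W_subset: "W \<subseteq> A"
  and W_hyp: "hyp W m"
  using A pq hyp_subspace hyp_nondeg subspace_perp perp_hpair_sub hyp_perp[OF A pq] unfolding W by blast+

lemma W_orth: "w \<in> W \<Longrightarrow> h w p = 0" "w \<in> W \<Longrightarrow> h w q = 0" "w \<in> W \<Longrightarrow> h p w = 0" "w \<in> W \<Longrightarrow> h q w = 0"
  unfolding W by (auto simp: perp_def h_eq_0_sym)

lemma pq_facts: "p \<in> A" "q \<in> A" "h p p = 0" "h q q = 0" "h p q = 1" "h q p = 1"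
  using pq by (auto simp: hpair_def)

lemma ti_W_A: "D \<in> ti W k \<Longrightarrow> D \<in> ti A k"
  using ti_mono[OF W_subset] .

lemma perp_W_A: "perp W D \<subseteq> perp A D"
  using W_subset by (auto simp: perp_def)

text \<open>If \<open>h r r' = - 1\<close>, the vectors \<open>p + r\<close> and
  \<open>q + r'\<close> are orthogonal and \<open>roof r r' N\<close> is a t.i. space meeting
  \<open>W\<close> in \<open>N\<close> only. Such spaces are the last kind of generator, one for
  each generator in degree \<open>k - 2\<close>.\<close>

definition roof :: "'v \<Rightarrow> 'v \<Rightarrow> 'v set \<Rightarrow> 'v set" where
  "roof r r' N = span (insert (q + r') (span (insert (p + r) N)))"

lemma roof:
  assumes N: "N \<in> ti W e" and r: "r \<in> perp W N" "h r r = 0" and r': "r' \<in> perp W N" "h r' r' = 0" and rr: "h r r' = - 1"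
  shows "roof r r' N \<in> ti A (Suc (Suc e))" "roof r r' N \<inter> W = N" "N \<subseteq> roof r r' N"
proof -
  have r'r: "h r' r = - 1" using h_sym[of r' r] rr by simp
  have rW: "r \<in> W" "r' \<in> W" using r r' perpD1 by blast+
  note N_subspace = ti_subspace[OF N]
  have NW: "x \<in> W" if "x \<in> N" for x using ti_sub[OF N] that by blast
  have pA: "p + r \<in> A" "q + r' \<in> A" using pq_facts(1,2) rW W_subset A_subspace by (auto intro: subspace_add)
  have "h (p + r) n = 0" "h (q + r') n = 0" if "n \<in> N" for n
    using W_orth[OF NW[OF that]] perpD2[OF r(1) that] perpD2[OF r'(1) that] by (simp_all add: h_simps)
  then have perp: "p + r \<in> perp A N" "q + r' \<in> perp A N" using pA by (auto simp: perp_def)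
  have iso: "h (p + r) (p + r) = 0" "h (q + r') (q + r') = 0" "h (q + r') (p + r) = 0"
    using r r' r'r pq_facts W_orth[OF rW(1)] W_orth[OF rW(2)] by (simp_all add: h_simps)
  have hpq: "h (p + r) q = 1" "h (q + r') q = 0" "h (q + r') p = 1" "h (p + r) p = 0"
    using pq_facts W_orth[OF rW(1)] W_orth[OF rW(2)] by (simp_all add: h_simps)
  have 1: "p + r \<notin> N" using hpq W_orth(2)[OF NW] by fastforce
  have 2: "q + r' \<notin> span (insert (p + r) N)"
  proof
    assume "q + r' \<in> span (insert (p + r) N)"
    then obtain n c where nc: "n \<in> N" "q + r' = n + c *s (p + r)" using mem_span_insert[OF N_subspace] by blast
    have "h (n + c *s (p + r)) p = 0" using hpq W_orth(1)[OF NW[OF nc(1)]] by (simp add: h_simps)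
    then show False using hpq(3) nc(2) by simp
  qed
  have cone: "span (insert (p + r) N) \<in> ti A (Suc e)" using ti_insert[OF A_subspace ti_W_A[OF N] perp(1) iso(1) 1] .
  have "q + r' \<in> perp A (span (insert (p + r) N))" using perp iso unfolding perp_span by (auto simp: perp_def)
  then show "roof r r' N \<in> ti A (Suc (Suc e))"
    unfolding roof_def using ti_insert[OF A_subspace cone _ iso(2) 2] by blast
  show sup: "N \<subseteq> roof r r' N" unfolding roof_def span_insert_span by (auto intro: span_base)
  have "x \<in> N" if x: "x \<in> roof r r' N" "x \<in> W" for x
  proof -
    obtain y b where y: "y \<in> span (insert (p + r) N)" "x = y + b *s (q + r')"
      using x(1) mem_span_insert[OF subspace_span] unfolding roof_def by blast
    obtain n a where n: "n \<in> N" "y = n + a *s (p + r)" using y(1) mem_span_insert[OF N_subspace] by blast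
    have "h x p = b" "h x q = a" unfolding y n using hpq W_orth(1,2)[OF NW[OF n(1)]] by (simp_all add: h_simps)
    then show ?thesis using W_orth(1,2)[OF x(2)] y n by simp
  qed
  then show "roof r r' N \<inter> W = N" using sup NW by blast
qed

lemma roof_vectors:
  assumes N: "N \<in> ti W e" and e: "e < m"
  obtains r r' where "r \<in> perp W N" "h r r = 0" "r' \<in> perp W N" "h r' r' = 0" "h r r' = - 1"
proof -
  note N_subspace = ti_subspace[OF N] and NW = ti_sub[OF N]
  obtain r where r: "r \<in> perp W N" "h r r = 0" "r \<notin> N"
    using hyp_maximal_ti[OF W_hyp] isotropic_outside[OF _ N_subspace NW] ti_dim[OF N] e by metis
  obtain w where w: "w \<in> perp W N" "h w w = 0" "h w r \<noteq> 0"
    using isotropic_avoiding[OF W_subspace hyp_nondeg[OF W_hyp] N_subspace NW r perpD1[OF r(1)] r(3)] .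
  define r' where "r' = - (inverse (h w r)) *s w"
  have "h r' r = - 1" unfolding r'_def using w(3) by (simp add: h_simps)
  then have "h r r' = - 1" using h_sym[of r r'] by simp
  moreover have "r' \<in> perp W N" "h r' r' = 0" unfolding r'_def
    using w subspace_perp[OF W_subspace] by (auto simp: h_simps intro: subspace_scale subspace_neg)
  ultimately show ?thesis using that r by blast
qed

context
  fixes d X
  assumes dm: "d < m" and X: "pclosed A (Suc m) (Suc d) X"
    and through: "\<And>K. K \<in> ti A (Suc d) \<Longrightarrow> p \<in> K \<or> q \<in> K \<Longrightarrow> K \<in> X"
begin

lemma pq_pencil:
  assumes D: "D \<in> ti W d" shows "p \<in> pencil A X D" "q \<in> pencil A X D"
proof -
  have "z \<in> pencil A X D" if z: "z = p \<or> z = q" for z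
  proof -
    have "z \<in> A" "h z z = 0" using z pq_facts by auto
    moreover have "h z w = 0" if "w \<in> D" for w using z ti_sub[OF D] that W_orth(3,4) by blast
    ultimately have zp: "z \<in> perp A D" "h z z = 0" by (auto simp: perp_def)
    have "z \<notin> W" using z pq_facts W_orth(1,2) by (metis zero_neq_one)
    then have "z \<notin> D" using ti_sub[OF D] by blast
    then have "span (insert z D) \<in> ti A (Suc d)" using ti_insert[OF A_subspace ti_W_A[OF D] zp] by blast
    moreover have "z \<in> span (insert z D)" by (simp add: span_base)
    ultimately have "span (insert z D) \<in> X" using through z by blast
    then show ?thesis using zp by (simp add: pencil_def)
  qed
  then show "p \<in> pencil A X D" "q \<in> pencil A X D" by auto
qed

text \<open>The difficulty is \<open>Suc d = m\<close>: a line of \<open>W\<close> then consists of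
  points that are pairwise nonorthogonal modulo \<open>D\<close>, and no line of \<open>A\<close>
  contains it. Two of its points and \<open>p\<close>, \<open>q\<close> form the frame for
  \<open>frame_step\<close>.\<close>

lemma pclosed_base: "pclosed W m (Suc d) X"
proof (cases "Suc d < m")
  case True
  show ?thesis
    unfolding pclosed_def
  proof (intro ballI impI, elim conjE)
    fix D K1 K2 K
    assume *: "D \<in> ti W (Suc d - 1)" "K1 \<in> ti W (Suc d) \<inter> X" "K2 \<in> ti W (Suc d) \<inter> X" "K \<in> ti W (Suc d)"
       "K1 \<noteq> K2" "D \<subseteq> K1" "D \<subseteq> K2" "D \<subseteq> K"
      and "Suc d < m \<longrightarrow> (\<exists>U\<in>ti W (Suc d + 1). K1 \<subseteq> U \<and> K2 \<subseteq> U \<and> K \<subseteq> U)"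
    then obtain U where "U \<in> ti W (Suc d + 1)" "K1 \<subseteq> U" "K2 \<subseteq> U" "K \<subseteq> U" using True by blast
    then show "K \<in> X" using pclosedD[OF X, of D K1 K2 K U] * ti_W_A by blast
  qed
next
  case False
  then have m: "m = Suc d" using dm by simp
  show ?thesis
    unfolding pclosed_def
  proof (intro ballI impI, elim conjE)
    fix D K1 K2 K
    assume D: "D \<in> ti W (Suc d - 1)" and K12: "K1 \<in> ti W (Suc d) \<inter> X" "K2 \<in> ti W (Suc d) \<inter> X"
       and K: "K \<in> ti W (Suc d)" and ne: "K1 \<noteq> K2" and sub: "D \<subseteq> K1" "D \<subseteq> K2" "D \<subseteq> K"
    have D: "D \<in> ti W d" using D by simp
    note sD = ti_subspace[OF D]
    note K1 = IntD1[OF K12(1)] and K2 = IntD1[OF K12(2)]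
    obtain r1 where r1: "r1 \<in> K1" "r1 \<notin> D" "K1 = span (insert r1 D)" "r1 \<in> perp W D" "h r1 r1 = 0"
      using ti_extension_vector[OF K1 sD ti_dim[OF D] sub(1)] .
    obtain r2 where r2: "r2 \<in> K2" "r2 \<notin> D" "K2 = span (insert r2 D)" "r2 \<in> perp W D" "h r2 r2 = 0"
      using ti_extension_vector[OF K2 sD ti_dim[OF D] sub(2)] .
    obtain r3 where r3: "r3 \<in> K" "r3 \<notin> D" "K = span (insert r3 D)" "r3 \<in> perp W D" "h r3 r3 = 0"
      using ti_extension_vector[OF K sD ti_dim[OF D] sub(3)] .
    have r2K1: "r2 \<notin> K1" using span_insert_eq[OF sD, of r2 r1] r1(3) r2 ne by auto
    \<comment> \<open>Otherwise \<open>r2\<close> would enlarge \<open>K1\<close>, which is already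
      maximal in \<open>W\<close>.\<close>
    have r12: "h r2 r1 \<noteq> 0"
    proof
      assume "h r2 r1 = 0"
      then have "r2 \<in> perp W K1" using r2(4) unfolding r1(3) perp_span by (auto simp: perp_def)
      then have "span (insert r2 K1) \<in> ti W (Suc (Suc d))" using ti_insert[OF W_subspace K1 _ r2(5) r2K1] by blast
      then show False using ti_dim_le[OF W_hyp] m by fastforce
    qed
    define s where "s = inverse (h r2 r1) *s r2"
    have "h s r1 = 1" using r12 unfolding s_def by (simp add: h_simps)
    then have hs: "h s r1 = 1" "h r1 s = 1" using h_one_sym by auto
    have "r1 \<in> pencil A X D" "r2 \<in> pencil A X D" using r1 r2 perp_W_A K12 by (auto simp: pencil_def)
    moreover have "h r2 r2 = 0" using r2 by simp
    ultimately have Q: "r1 \<in> pencil A X D" "s \<in> pencil A X D"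
      using pencil_combine[OF A_subspace X ti_W_A[OF D], of r2 r2 "inverse (h r2 r1)" 0] by (simp_all add: s_def)
    \<comment> \<open>Modulo \<open>D\<close>, the complement of \<open>D\<close> in
      \<open>W\<close> is the hyperbolic plane of \<open>r1\<close> and \<open>r2\<close>, so
      \<open>r3\<close> has coordinates in it.\<close>
    have "dim (perp W D) = dim (span (insert r2 K1))"
      using dim_perp[OF W_subspace hyp_nondeg[OF W_hyp] sD ti_sub[OF D]] ti_dim[OF D] hyp_dim[OF W_hyp] m
        dim_span_insert[OF ti_subspace[OF K1] r2K1] ti_dim[OF K1] by simp
    moreover have "span (insert r2 K1) \<subseteq> perp W D"
      using r1(4) r2(4) ti_h[OF D] ti_sub[OF D] subspace_perp[OF W_subspace, of D] unfolding r1(3) span_insert_span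
      by (intro span_minimal) (auto intro: perpI)
    ultimately have "span (insert r2 K1) = perp W D"
      by (intro subspace_dim_equal[OF subspace_span subspace_perp[OF W_subspace]]) simp_all
    then have "r3 \<in> span (insert r2 K1)" using r3(4) by blast
    then obtain b k1 where b: "k1 \<in> K1" "r3 = k1 + b *s r2" using mem_span_insert[OF ti_subspace[OF K1]] by blast
    then obtain a e where e: "e \<in> D" "k1 = e + a *s r1" using mem_span_insert[OF sD] r1(3) by blast
    define c where "c = b * h r2 r1"
    have "b *s r2 = c *s s" unfolding s_def c_def using r12 by simp
    then have r3e: "r3 = e + (a *s r1 + c *s s)" using b e by simp
    define t where "t = a *s r1 + c *s s"
    have "h e r1 = 0" "h e s = 0" "h r1 e = 0" "h s e = 0" "h e e = 0"
      using e(1) perpD3[OF r1(4)] perpD3[OF r2(4)] perpD2[OF r1(4)] perpD2[OF r2(4)] ti_h[OF D]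
      unfolding s_def by (auto simp: h_simps)
    moreover have "h s s = 0" using Q by (simp add: pencil_def)
    ultimately have tr: "a * \<sigma> c + c * \<sigma> a = 0" using r3(5) r1(5) hs unfolding r3e by (simp add: h_simps ac_simps)
    have "t \<in> pencil A X D"
    proof (cases "a = 0 \<or> c = 0")
      case True
      have "0 \<in> D" using sD by (rule subspace_0)
      then have z: "0 \<in> pencil A X D" using pencil_base[OF ti_W_A[OF D]] by blast
      show ?thesis unfolding t_def
        using True pencil_combine[OF A_subspace X ti_W_A[OF D] Q(1) z, of a 0] pencil_combine[OF A_subspace X ti_W_A[OF D] Q(2) z, of c 0] by auto
    next
      case False
      \<comment> \<open>Isotropy of \<open>t\<close> says that \<open>a * \<sigma> c\<close> is
        skew, and hence that \<open>c / a\<close> is.\<close>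
      define \<delta> where "\<delta> = c / a"
      have "\<sigma> \<delta> = - \<delta>" unfolding \<delta>_def using False tr
        by (simp add: field_simps eq_neg_iff_add_eq_0)
      moreover have "h p r1 = 0" "h p s = 0" "h q r1 = 0" "h q s = 0"
        using W_orth perpD1[OF r1(4)] perpD1[OF r2(4)] unfolding s_def by (auto simp: h_simps)
      ultimately have f: "r1 + \<delta> *s s \<in> pencil A X D"
        using frame_step[OF A_subspace X ti_W_A[OF D] pq_pencil[OF D] Q pq_facts(5) hs(2)] by blast
      then have "h (r1 + \<delta> *s s) (r1 + \<delta> *s s) = 0" by (simp add: pencil_def)
      from pencil_combine[OF A_subspace X ti_W_A[OF D] f f this, of a 0] show ?thesis
        unfolding t_def \<delta>_def using False by (simp add: scale_right_distrib)
    qed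
    moreover have "e \<in> pencil A X D" using pencil_base[OF ti_W_A[OF D] e(1)] .
    moreover have "h e t = 0" using \<open>h e r1 = 0\<close> \<open>h e s = 0\<close> unfolding t_def by (simp add: h_simps)
    ultimately have "r3 \<in> pencil A X D" using pencil_combine[OF A_subspace X ti_W_A[OF D], of e t 1 1] unfolding r3e t_def by simp
    then show "K \<in> X" using r3 by (auto simp: pencil_def)
  qed
qed

context
  assumes base: "\<And>K. K \<in> ti W (Suc d) \<Longrightarrow> K \<in> X"
begin

text \<open>Unless \<open>K\<close> is inside \<open>W\<close>, it is, modulo
  \<open>perp K {q}\<close>, a point on the line joining \<open>p\<close> to a vector of
  \<open>W\<close>, namely to the projection along \<open>p\<close> of one of its vectors.\<close>

lemma in_p_perp:
  assumes K: "K \<in> ti A (Suc d)" and Kp: "\<And>x. x \<in> K \<Longrightarrow> h x p = 0"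
  shows "K \<in> X"
proof (cases "\<exists>z\<in>K. h z q \<noteq> 0")
  case False
  then have "K \<subseteq> W" unfolding W using Kp ti_sub[OF K] by (auto simp: perp_def)
  then have "K \<in> ti W (Suc d)" using K by (auto simp: ti_iff)
  then show ?thesis by (rule base)
next
  case True
  then obtain z where z: "z \<in> K" "h z q \<noteq> 0" by blast
  let ?D = "perp K {q}"
  note * = ti_hyperplane_perp[OF K z]
  have "?D \<subseteq> W" unfolding W using Kp ti_sub[OF K] by (auto simp: perp_def)
  then have D: "?D \<in> ti W d" using *(1) by (auto simp: ti_iff)
  define w where "w = z - h z q *s p"
  have zA: "z \<in> A" using z ti_sub[OF K] by blast
  have zp: "h z p = 0" "h z z = 0" using Kp z ti_h[OF K] by auto
  then have zp': "h p z = 0" using h_eq_0_sym by blast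
  have "w \<in> W" unfolding W w_def using zA zp pq_facts A_subspace
    by (auto simp: perp_def h_simps intro: subspace_diff subspace_scale)
  moreover have "h w x = 0" if "x \<in> ?D" for x
    using that ti_h[OF K z(1)] W_orth(3)[of x] \<open>?D \<subseteq> W\<close> unfolding w_def by (auto simp: h_simps perp_def)
  ultimately have w: "w \<in> perp W ?D" by (auto simp: perp_def)
  have ww: "h w w = 0" unfolding w_def using zp zp' pq_facts by (simp add: h_simps)
  have "span (insert w ?D) \<in> X" if "w \<notin> ?D" using base[OF ti_insert[OF W_subspace D w ww that]] .
  then have "w \<in> pencil A X ?D" using w ww perp_W_A by (auto simp: pencil_def)
  moreover have "h p w = 0" using W_orth(3) perpD1[OF w] by blast
  ultimately have "h z q *s p + 1 *s w \<in> pencil A X ?D" using pencil_combine[OF A_subspace X ti_W_A[OF D] pq_pencil(1)[OF D]] by blast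
  then have "z \<in> pencil A X ?D" unfolding w_def by simp
  then show ?thesis using * by (auto simp: pencil_def)
qed

text \<open>In the polar space of \<open>M\<close> the points orthogonal to \<open>p\<close> are
  known by \<open>in_p_perp\<close> and form a hyperplane. Hyperplanes are maximal, so one known
  point outside suffices.\<close>

lemma cone_top:
  assumes M: "M \<in> ti A d" "\<And>x. x \<in> M \<Longrightarrow> h x p = 0" and y: "y \<in> pencil A X M" "h y p \<noteq> 0"
    and x: "x \<in> perp A M" "h x x = 0"
  shows "x \<in> pencil A X M"
proof (rule hyperplane_maximal[OF A _ X M(1) pq_facts(1) _ y x])
  show "Suc d < Suc m" using dm by simp
  fix u assume u: "u \<in> perp A M" "h u u = 0" "h u p = 0"
  have "span (insert u M) \<in> X" if "u \<notin> M"
  proof (rule in_p_perp)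
    show "span (insert u M) \<in> ti A (Suc d)" using ti_insert[OF A_subspace M(1) u(1,2) that] .
    fix z assume "z \<in> span (insert u M)"
    then show "h z p = 0" using M(2) u(3) by (auto simp: mem_span_insert[OF ti_subspace[OF M(1)]] h_simps)
  qed
  then show "u \<in> pencil A X M" using u by (auto simp: pencil_def)
qed

text \<open>For \<open>M\<close> inside \<open>W\<close> the vector \<open>q\<close> is a known
  point off the hyperplane of \<open>p\<close>.\<close>

lemma over_base:
  assumes M: "M \<in> ti W d" and K: "K \<in> ti A (Suc d)" "M \<subseteq> K"
  shows "K \<in> X"
proof (rule pencil_all[OF ti_W_A[OF M] _ K])
  fix x assume "x \<in> perp A M" "h x x = 0"
  then show "x \<in> pencil A X M"
    using cone_top[OF ti_W_A[OF M] _ pq_pencil(2)[OF M]] ti_sub[OF M] W_orth(1) pq_facts(6) by (metis subsetD zero_neq_one)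
qed

context
  fixes e N
  assumes d: "d = Suc e" and N: "N \<in> ti W e"
begin

abbreviation cone :: "'v \<Rightarrow> 'v set" where "cone r \<equiv> span (insert (p + r) N)"

lemma N_subspace: "subspace N"
  using ti_subspace[OF N] .

lemma N_orth: "x \<in> N \<Longrightarrow> h x p = 0" "x \<in> N \<Longrightarrow> h x q = 0" "x \<in> N \<Longrightarrow> h p x = 0" "x \<in> N \<Longrightarrow> h q x = 0"
  using ti_sub[OF N] W_orth by blast+

lemma cone_facts:
  assumes r: "r \<in> perp W N" "h r r = 0"
  shows "p + r \<in> perp A N" "h (p + r) (p + r) = 0" "p + r \<notin> N" "h (p + r) p = 0" "h (p + r) q = 1"
    "cone r \<in> ti A d" "\<And>x. x \<in> cone r \<Longrightarrow> h x p = 0"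
proof -
  have rW: "r \<in> W" using r perpD1 by blast
  have "p \<in> perp A N" using pq_facts(1) N_orth(3) by (auto simp: perp_def)
  then show 1: "p + r \<in> perp A N" using r(1) perp_W_A subspace_add[OF subspace_perp[OF A_subspace]] by blast
  show 2: "h (p + r) (p + r) = 0" using r(2) pq_facts W_orth[OF rW] by (simp add: h_simps)
  show 4: "h (p + r) p = 0" and 5: "h (p + r) q = 1" using pq_facts W_orth[OF rW] by (simp_all add: h_simps)
  show 3: "p + r \<notin> N" using 5 N_orth(2) by fastforce
  show "cone r \<in> ti A d" using ti_insert[OF A_subspace ti_W_A[OF N] 1 2 3] d by simp
  show "h x p = 0" if "x \<in> cone r" for x
    using that 4 N_orth(1) by (auto simp: mem_span_insert[OF N_subspace] h_simps)
qed

text \<open>By \<open>cone_top\<close> this one witness puts all \<open>k\<close>-spaces over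
  \<open>cone r\<close> into \<open>X\<close>.\<close>

definition good :: "'v \<Rightarrow> bool" where
  "good r \<longleftrightarrow> (\<exists>y\<in>pencil A X (cone r). h y p \<noteq> 0)"

lemma good_all:
  assumes r: "r \<in> perp W N" "h r r = 0" and g: "good r" and K: "K \<in> ti A (Suc d)" "cone r \<subseteq> K"
  shows "K \<in> X"
  using g cone_top[OF cone_facts(6,7)[OF r]] pencil_all[OF cone_facts(6)[OF r] _ K] unfolding good_def by blast

text \<open>For \<open>w\<close> orthogonal to \<open>N\<close>, \<open>p + r\<close> and \<open>p + r1\<close> but not to \<open>p\<close>, the points over \<open>N + w\<close> that meet \<open>W\<close> form
  a hyperplane, and \<open>p + r\<close> lies outside it; hence \<open>p + r1\<close> is reached as well.\<close>

lemma good_step: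
  assumes r: "r \<in> perp W N" "h r r = 0" and r1: "r1 \<in> perp W N" "h r1 r1 = 0" and g: "good r"
    and ind: "p \<notin> span (insert (p + r) (insert (p + r1) N))"
  shows "good r1"
proof -
  let ?B = "span (insert (p + r) (insert (p + r1) N))"
  note pr0 = cone_facts[OF r] and pr1 = cone_facts[OF r1]
  have "insert (p + r) (insert (p + r1) N) \<subseteq> A" using pr0(1) pr1(1) ti_sub[OF ti_W_A[OF N]] by (auto simp: perp_def)
  then have B: "subspace ?B" "?B \<subseteq> A" using span_minimal[OF _ A_subspace] by simp_all
  have "dim ?B \<le> Suc (Suc (dim N))" by (simp add: dim_insert)
  then have "dim ?B < Suc m" using ti_dim[OF N] d dm by simp
  then obtain z where z: "z \<in> perp A ?B" "h z z = 0" "z \<notin> ?B"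
    using hyp_maximal_ti[OF A] isotropic_outside[OF _ B] by metis
  obtain w where w: "w \<in> perp A ?B" "h w w = 0" "h w p \<noteq> 0"
    using isotropic_avoiding[OF A_subspace A_nondeg B z pq_facts(1) ind] .
  have wr: "h w (p + r) = 0" "h (p + r) w = 0" "h w (p + r1) = 0" "h (p + r1) w = 0" and wN: "w \<in> perp A N"
    using w(1) unfolding perp_span by (auto simp: perp_def h_eq_0_sym)
  have wN': "w \<notin> N" using w(3) N_orth(1) by blast
  let ?D = "span (insert w N)"
  have D: "?D \<in> ti A d" using ti_insert[OF A_subspace ti_W_A[OF N] wN w(2) wN'] d by simp
  have ND: "N \<subseteq> ?D" "w \<in> ?D" by (auto simp: span_base)
  have not_D: "x \<notin> ?D" if "h x p = 0" "x \<notin> N" for x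
  proof
    assume "x \<in> ?D"
    then obtain c n where "n \<in> N" "x = n + c *s w" using mem_span_insert[OF N_subspace] by blast
    then show False using that w(3) N_orth(1) by (auto simp: h_simps)
  qed
  have memD: "x \<in> perp A ?D \<longleftrightarrow> x \<in> perp A N \<and> h x w = 0" for x
    unfolding perp_span by (auto simp: perp_def)
  have comm: "span (insert x ?D) = span (insert w (span (insert x N)))" for x
    by (rule span_insert_commute)
  have Q0: "p + r \<in> pencil A X ?D"
  proof -
    obtain y where y: "y \<in> pencil A X (cone r)" "h y p \<noteq> 0" using g unfolding good_def by blast
    have "w \<in> perp A (cone r)" using wN wr unfolding perp_span by (auto simp: perp_def)
    then have "w \<in> pencil A X (cone r)" using cone_top[OF pr0(6,7) y _ w(2)] by blast
    moreover have "w \<notin> cone r" using pr0(7) w(3) by blast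
    ultimately have "span (insert (p + r) ?D) \<in> X" unfolding comm by (auto simp: pencil_def)
    then show ?thesis using pr0 wr memD by (auto simp: pencil_def)
  qed
  define a b where "a = h w q" and "b = h w p"
  \<comment> \<open>Orthogonality to \<open>c\<close> means that the pairings of \<open>x\<close>
    with \<open>p\<close> and \<open>q\<close> are proportional to those of \<open>w\<close>, so
    that subtracting a multiple of \<open>w\<close> moves \<open>x\<close> into
    \<open>W\<close>.\<close>
  define c where "c = \<sigma> a *s p - \<sigma> b *s q"
  have b: "b \<noteq> 0" using w(3) by (simp add: b_def)
  have cA: "c \<in> A" unfolding c_def using pq_facts A_subspace by (simp add: subspace_diff subspace_scale)
  have hc: "h x c = a * h x p - b * h x q" for x unfolding c_def by (simp add: h_simps)
  have "p + r1 \<in> pencil A X ?D"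
  proof (rule hyperplane_maximal[OF A _ X D cA _ Q0])
    show "Suc d < Suc m" using dm by simp
    show "h (p + r) c \<noteq> 0" unfolding hc using pr0(4,5) b by simp
    show "p + r1 \<in> perp A ?D" using memD pr1(1) wr by blast
    show "h (p + r1) (p + r1) = 0" by (rule pr1(2))
    fix x assume x: "x \<in> perp A ?D" "h x x = 0" "h x c = 0"
    define l v where "l = h x p / b" and "v = x - l *s w"
    have xw: "h x w = 0" "h w x = 0" using x(1) memD h_eq_0_sym by auto
    have vp: "h v p = 0" unfolding v_def l_def using b by (simp add: h_simps b_def)
    have "h v q = 0" unfolding v_def l_def using b x(3) unfolding hc by (simp add: h_simps a_def[symmetric] field_simps)
    moreover have "v \<in> perp A N" unfolding v_def
      using x(1) wN memD subspace_perp[OF A_subspace] by (auto intro: subspace_diff subspace_scale)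
    ultimately have vN: "v \<in> perp W N" unfolding W using vp by (auto simp: perp_def)
    have vv: "h v v = 0" unfolding v_def using x(2) xw w(2) by (simp add: h_simps)
    have vw: "h v w = 0" "h w v = 0" unfolding v_def using xw w(2) by (simp_all add: h_simps)
    have "span (insert v ?D) \<in> X" if "v \<notin> ?D"
    proof (rule over_base)
      have "v \<notin> N" using that ND by blast
      then show "span (insert v N) \<in> ti W d" using ti_insert[OF W_subspace N vN vv] d by simp
      show "span (insert v ?D) \<in> ti A (Suc d)"
        using ti_insert[OF A_subspace D _ vv that] memD vN vw perp_W_A by blast
      show "span (insert v N) \<subseteq> span (insert v ?D)" using ND by (intro span_mono) auto
    qed
    then have "v \<in> pencil A X ?D" using memD vN vw vv perp_W_A by (auto simp: pencil_def)
    from pencil_combine[OF A_subspace X D pencil_base[OF D ND(2)] this vw(2), of l 1]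
    show "x \<in> pencil A X ?D" by (simp add: v_def)
  qed
  then have "span (insert w (cone r1)) \<in> X"
    using not_D[OF pr1(4) pr1(3)] unfolding comm[symmetric] by (auto simp: pencil_def)
  moreover have "w \<in> perp A (cone r1)" using wN wr unfolding perp_span by (auto simp: perp_def)
  ultimately have "w \<in> pencil A X (cone r1)" using w(2) by (auto simp: pencil_def)
  then show ?thesis using w(3) unfolding good_def by blast
qed

text \<open>The case that \<open>good_step\<close> leaves out, turned into an affine relation modulo
  \<open>N\<close> inside \<open>W\<close>; pairing with \<open>q\<close> shows that the
  coefficients sum to one.\<close>

lemma not_independent:
  assumes "r \<in> perp W N" "r1 \<in> perp W N" "p \<in> span (insert (p + r) (insert (p + r1) N))"
  shows "\<exists>a b n. n \<in> N \<and> a + b = 1 \<and> a *s r + b *s r1 = n"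
proof -
  obtain a where "p - a *s (p + r) \<in> span (insert (p + r1) N)" using assms(3) unfolding span_breakdown_eq by blast
  then obtain b where "p - a *s (p + r) - b *s (p + r1) \<in> span N" unfolding span_breakdown_eq by blast
  moreover have "span N = N" using span_eqI[OF N_subspace] .
  moreover define n where "n = p - a *s (p + r) - b *s (p + r1)"
  ultimately have n: "n \<in> N" by simp
  have W': "r \<in> W" "r1 \<in> W" using assms(1,2) perpD1 by blast+
  have "h n q = 1 - a - b" unfolding n_def using W_orth(2)[OF W'(1)] W_orth(2)[OF W'(2)] pq_facts by (simp add: h_simps)
  then have ab: "a + b = 1" using N_orth(2)[OF n] by (simp add: algebra_simps)
  then have "a *s p + b *s p = p" by (simp flip: scale_left_distrib)
  then have "a *s r + b *s r1 = - n" unfolding n_def by (simp add: algebra_simps)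
  then show ?thesis using ab subspace_neg[OF N_subspace n] by blast
qed

text \<open>The given roof makes \<open>r\<close> good, \<open>good_step\<close> passes this on to
  \<open>r'\<close>, and from these two to every isotropic \<open>r1\<close> outside
  \<open>N\<close>: an affine relation of \<open>r1\<close> with both is impossible because
  \<open>r\<close> and \<open>r'\<close> are not orthogonal. A space over \<open>N\<close> is
  orthogonal to \<open>p\<close>, contains \<open>p\<close>, lies over a \<open>d\<close>-space of
  \<open>W\<close>, or lies over such a \<open>cone r1\<close>.\<close>

lemma over_codim_two:
  assumes r: "r \<in> perp W N" "h r r = 0" and r': "r' \<in> perp W N" "h r' r' = 0" and rr: "h r r' = - 1"
    and K0: "span (insert (q + r') (cone r)) \<in> X" and K: "K \<in> ti A (Suc d)" "N \<subseteq> K"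
  shows "K \<in> X"
proof -
  have r'r: "h r' r = - 1" using h_sym[of r' r] rr by simp
  have rW: "r \<in> W" "r' \<in> W" using r r' perpD1 by blast+
  have goodr: "good r"
  proof -
    have "q + r' \<in> A" using pq_facts rW W_subset A_subspace by (auto intro: subspace_add)
    moreover have "h (q + r') (p + r) = 0" using pq_facts W_orth[OF rW(1)] W_orth[OF rW(2)] r'r by (simp add: h_simps)
    moreover have "h (q + r') n = 0" if "n \<in> N" for n
      using N_orth(4)[OF that] perpD2[OF r'(1) that] by (simp add: h_simps)
    ultimately have "q + r' \<in> perp A (cone r)" unfolding perp_span by (auto simp: perp_def)
    moreover have "h (q + r') (q + r') = 0" using pq_facts W_orth[OF rW(2)] r'(2) by (simp add: h_simps)
    ultimately have "q + r' \<in> pencil A X (cone r)" using K0 by (auto simp: pencil_def)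
    moreover have "h (q + r') p \<noteq> 0" using pq_facts W_orth[OF rW(2)] by (simp add: h_simps)
    ultimately show ?thesis unfolding good_def by blast
  qed
  have rn: "h r n = 0" "h r' n = 0" "h n r = 0" "h n r' = 0" if "n \<in> N" for n
    using perpD2[OF r(1) that] perpD2[OF r'(1) that] perpD3[OF r(1) that] perpD3[OF r'(1) that] by auto
  have goodr': "good r'"
  proof (rule good_step[OF r r' goodr], rule notI)
    assume "p \<in> span (insert (p + r) (insert (p + r') N))"
    then obtain a b n where n: "n \<in> N" "a + b = 1" "a *s r + b *s r' = n" using not_independent r r' by metis
    have "h (a *s r + b *s r') r = - b" "h (a *s r + b *s r') r' = - a" using r(2) r'(2) rr r'r by (simp_all add: h_simps)
    then have "a = 0" "b = 0" using n rn by auto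
    then show False using n(2) by simp
  qed
  have all_good: "good r1" if r1: "r1 \<in> perp W N" "h r1 r1 = 0" "r1 \<notin> N" for r1
  proof (rule ccontr)
    assume ng: "\<not> good r1"
    obtain a b n where n: "n \<in> N" "a + b = 1" "a *s r + b *s r1 = n"
      using good_step[OF r r1(1,2) goodr] not_independent r r1 ng by metis
    obtain a' b' n' where n': "n' \<in> N" "a' + b' = 1" "a' *s r' + b' *s r1 = n'"
      using good_step[OF r' r1(1,2) goodr'] not_independent r' r1 ng by metis
    have b: "b \<noteq> 0"
    proof
      assume "b = 0"
      then have "r \<in> N" using n by simp
      then show False using rn(4) rr by fastforce
    qed
    have b': "b' \<noteq> 0"
    proof
      assume "b' = 0"
      then have "r' \<in> N" using n' by simp
      then show False using rn(3) r'r by fastforce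
    qed
    have "h (a *s r + b *s r1) r = b * h r1 r" using r(2) by (simp add: h_simps)
    then have 1: "h r1 r = 0" using n rn(3) b by simp
    have "h (a' *s r' + b' *s r1) r = - a' + b' * h r1 r" using r'r by (simp add: h_simps)
    then have "a' = 0" using n' rn(3) 1 by simp
    then have "b' *s r1 \<in> N" using n' by simp
    then have "inverse b' *s (b' *s r1) \<in> N" by (rule subspace_scale[OF N_subspace])
    then show False using b' r1(3) by simp
  qed
  show ?thesis
  proof (cases "\<exists>z\<in>K. h z p \<noteq> 0")
    case False
    then show ?thesis using in_p_perp[OF K(1)] by blast
  next
    case True
    then obtain z where z: "z \<in> K" "h z p \<noteq> 0" by blast
    let ?M = "perp K {p}"
    note * = ti_hyperplane_perp[OF K(1) z]
    have MK: "?M \<subseteq> K" by (auto simp: perp_def)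
    have NM: "N \<subseteq> ?M" using K(2) N_orth(1) by (auto simp: perp_def)
    have M: "?M \<in> ti A (Suc e)" using *(1) d by simp
    obtain x where x: "x \<in> ?M" "x \<notin> N" "?M = span (insert x N)" "x \<in> perp A N" "h x x = 0"
      using ti_extension_vector[OF M N_subspace ti_dim[OF N] NM] .
    have xA: "x \<in> A" using x(4) by (rule perpD1)
    have xp: "h x p = 0" using x(1) by (rule perpD2) simp
    \<comment> \<open>Projection along \<open>p\<close> into \<open>W\<close>; if \<open>x\<close>
      is not already in \<open>W\<close>, scaling it gives a vector of the form
      \<open>p + r1\<close>.\<close>
    define x' where "x' = x - h x q *s p"
    have px: "h p x = 0" using xp h_eq_0_sym by blast
    have x'W: "x' \<in> W" unfolding x'_def W using xA xp pq_facts A_subspace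
      by (auto simp: perp_def h_simps intro: subspace_diff subspace_scale)
    have x'N: "x' \<in> perp W N"
    proof (rule perpI[OF x'W])
      fix n assume "n \<in> N"
      then show "h x' n = 0" using perpD2[OF x(4)] N_orth(3) unfolding x'_def by (simp add: h_simps)
    qed
    have x'x': "h x' x' = 0" unfolding x'_def using x(5) xp px pq_facts by (simp add: h_simps)
    show ?thesis
    proof (cases "h x q = 0")
      case True
      then have "?M = span (insert x' N)" "x' \<notin> N" using x by (simp_all add: x'_def)
      then have "?M \<in> ti W d" using ti_insert[OF W_subspace N x'N x'x'] d by simp
      then show ?thesis using over_base[OF _ K(1) MK] by blast
    next
      case False
      define r1 where "r1 = inverse (h x q) *s x'"
      have pr1: "p + r1 = inverse (h x q) *s x" unfolding r1_def x'_def using False by (simp add: algebra_simps)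
      have r1: "r1 \<in> perp W N" "h r1 r1 = 0" unfolding r1_def
        using x'N x'x' subspace_perp[OF W_subspace] by (auto simp: h_simps intro: subspace_scale)
      have "cone r1 = ?M" unfolding x(3)
      proof (rule span_insert_eq[OF N_subspace])
        show "p + r1 \<in> span (insert x N)" unfolding pr1 by (simp add: span_base span_scale)
        show "p + r1 \<notin> N" by (rule cone_facts(3)[OF r1])
      qed
      then have sub: "cone r1 \<subseteq> K" using MK by simp
      show ?thesis
      proof (cases "r1 \<in> N")
        case True
        have "p + r1 \<in> K" using sub span_base by blast
        then have "p + r1 - r1 \<in> K" using True K(2) by (intro subspace_diff[OF ti_subspace[OF K(1)]]) auto
        then show ?thesis using through[OF K(1)] by simp
      next
        case False
        then show ?thesis using good_all[OF r1 all_good[OF r1] K(1) sub] by blast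
      qed
    qed
  qed
qed

end
text \<open>One pair \<open>r\<close>, \<open>r'\<close> orthogonal to the upper space
  \<open>U\<close> serves every space of the line, so taking roofs maps the line of \<open>W\<close>
  into a line of \<open>A\<close>. One roof over \<open>N\<close> then suffices by
  \<open>over_codim_two\<close>.\<close>

lemma pclosed_codim_two:
  assumes d: "d = Suc e"
  shows "pclosed W m e {N. \<forall>K\<in>ti A (Suc d). N \<subseteq> K \<longrightarrow> K \<in> X}"
proof (cases e)
  case 0
  then show ?thesis using ti_0[OF W_subspace] by (auto simp: pclosed_def)
next
  case (Suc e')
  show ?thesis
    unfolding pclosed_def
  proof (intro ballI impI, elim conjE)
    let ?G = "{N. \<forall>K\<in>ti A (Suc d). N \<subseteq> K \<longrightarrow> K \<in> X}"
    fix D N1 N2 N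
    assume D: "D \<in> ti W (e - 1)" and N1: "N1 \<in> ti W e \<inter> ?G" and N2: "N2 \<in> ti W e \<inter> ?G" and N: "N \<in> ti W e"
      and ne: "N1 \<noteq> N2" and sub: "D \<subseteq> N1" "D \<subseteq> N2" "D \<subseteq> N"
      and "e < m \<longrightarrow> (\<exists>U\<in>ti W (e + 1). N1 \<subseteq> U \<and> N2 \<subseteq> U \<and> N \<subseteq> U)"
    then obtain U where U: "U \<in> ti W d" "N1 \<subseteq> U" "N2 \<subseteq> U" "N \<subseteq> U" using d dm by auto
    obtain r r' where r: "r \<in> perp W U" "h r r = 0" "r' \<in> perp W U" "h r' r' = 0" "h r r' = - 1"
      using roof_vectors[OF U(1) dm] .
    have rM: "r \<in> perp W M" "r' \<in> perp W M" if "M \<subseteq> U" for M using r perp_mono[OF that] by blast+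
    note roof' = roof[OF _ rM(1) r(2) rM(2) r(4,5)]
    let ?g = "roof r r'"
    have mono: "S \<subseteq> T \<Longrightarrow> ?g S \<subseteq> ?g T" for S T
      unfolding roof_def span_insert_span by (intro span_mono) auto
    have "D \<subseteq> U" using sub U by blast
    note N1' = IntD1[OF N1] and N2' = IntD1[OF N2]
    have g: "?g N1 \<in> ti A (Suc d)" "?g N2 \<in> ti A (Suc d)" "?g N \<in> ti A (Suc d)"
      using roof'(1)[OF N1' U(2,2)] roof'(1)[OF N2' U(3,3)] roof'(1)[OF N U(4,4)] unfolding d .
    have gD: "?g D \<in> ti A (Suc d - 1)" using roof'(1)[OF D \<open>D \<subseteq> U\<close> \<open>D \<subseteq> U\<close>] d Suc by simp
    have gU: "?g U \<in> ti A (Suc d + 1)" using roof'(1)[OF U(1) order_refl order_refl] by simp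
    have X12: "?g N1 \<in> X" "?g N2 \<in> X"
      using N1 N2 g roof'(3)[OF N1' U(2,2)] roof'(3)[OF N2' U(3,3)] by blast+
    have "?g N1 \<noteq> ?g N2" using roof'(2)[OF N1' U(2,2)] roof'(2)[OF N2' U(3,3)] ne by metis
    then have "?g N \<in> X"
      using pclosedD[OF X gD g(1) X12(1) g(2) X12(2) g(3) _ mono[OF sub(1)] mono[OF sub(2)] mono[OF sub(3)] gU
        mono[OF U(2)] mono[OF U(3)] mono[OF U(4)]] by blast
    then show "N \<in> ?G"
      using over_codim_two[OF d N rM(1)[OF U(4)] r(2) rM(2)[OF U(4)] r(4,5)] unfolding roof_def by blast
  qed
qed

end
end
end

section \<open>Counting generators below the top rank\<close>

lemma gen_0:
  assumes "subspace A" shows "gen A m 0 1"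
  unfolding gen_def by (rule exI[of _ "{{0}}"]) (simp add: ti_0[OF assms])

text \<open>In rank and degree one all points form a single line, whatever the field; this frees
  \<open>k = 1\<close> from the restriction on the field.\<close>

lemma gen_1_1:
  assumes A: "hyp A 1" shows "gen A 1 1 2"
proof -
  obtain p q where pq: "hpair A p q" using hyp_hpair_exists[of A 0] A by auto
  note sA = hyp_subspace[OF A]
  have z: "{0} \<in> ti A 0" using ti_0[OF sA] by simp
  have pt: "span (insert x {0}) \<in> ti A 1" if "x \<in> A" "h x x = 0" "x \<noteq> 0" for x
    using ti_insert[OF sA z, of x] that by (auto simp: perp_def)
  have nz: "p \<noteq> 0" "q \<noteq> 0" using pq by (auto simp: hpair_def)
  let ?P = "span (insert p {0})" and ?Q = "span (insert q {0})"
  have P: "?P \<in> ti A 1" "?Q \<in> ti A 1" using pt pq nz by (auto simp: hpair_def)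
  have "p \<in> ?P" "q \<in> ?Q" by (auto intro: span_base)
  then have ne: "?P \<noteq> ?Q" using ti_h[OF P(1)] pq by (metis hpair_def zero_neq_one)
  have "ti A 1 \<subseteq> X" if X: "pclosed A 1 1 X" "{?P, ?Q} \<subseteq> X" for X
  proof
    fix K assume K: "K \<in> ti A 1"
    have "{0} \<subseteq> K" "{0} \<subseteq> ?P" "{0} \<subseteq> ?Q" using subspace_0[OF ti_subspace[OF K]] by (simp_all add: span_zero)
    moreover have "{0} \<in> ti A (1 - 1)" using z by simp
    moreover have "?P \<in> ti A 1 \<inter> X" "?Q \<in> ti A 1 \<inter> X" using P X(2) by blast+
    ultimately show "K \<in> X" using X(1) K ne unfolding pclosed_def by (meson less_irrefl)
  qed
  moreover have "card {?P, ?Q} \<le> 2" by (metis card_2_iff ne order_refl)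
  ultimately show ?thesis unfolding gen_def using P by (intro exI[of _ "{?P, ?Q}"]) auto
qed

lemma gen_step:
  assumes A: "hyp A (Suc m)" and dm: "d < m"
    and g1: "\<And>W. hyp W m \<Longrightarrow> gen W m (Suc d) b1"
    and g2: "\<And>W. hyp W m \<Longrightarrow> gen W m d b2"
    and g3: "\<And>W e. hyp W m \<Longrightarrow> d = Suc e \<Longrightarrow> gen W m e b3"
  shows "gen A (Suc m) (Suc d) (b1 + 2 * b2 + b3)"
proof -
  obtain p q where pq: "hpair A p q" using hyp_hpair_exists[OF A] .
  note sA = hyp_subspace[OF A]
  define W where "W = perp A {p, q}"
  have W': "W = perp A {q, p}" unfolding W_def by (simp add: insert_commute)
  have hW: "hyp W m" unfolding W_def by (rule hyp_perp[OF A pq])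
  have WA: "W \<subseteq> A" unfolding W_def by (rule perp_hpair_sub)
  obtain S1 where S1: "finite S1" "card S1 \<le> b1" "S1 \<subseteq> ti W (Suc d)"
    "\<And>X. pclosed W m (Suc d) X \<Longrightarrow> S1 \<subseteq> X \<Longrightarrow> ti W (Suc d) \<subseteq> X"
    using g1[OF hW] unfolding gen_def by metis
  obtain S2 where S2: "finite S2" "card S2 \<le> b2" "S2 \<subseteq> ti W d"
    "\<And>X. pclosed W m d X \<Longrightarrow> S2 \<subseteq> X \<Longrightarrow> ti W d \<subseteq> X"
    using g2[OF hW] unfolding gen_def by metis
  let ?R = "\<lambda>e N K. \<exists>r r'. r \<in> perp W N \<and> h r r = 0 \<and> r' \<in> perp W N \<and> h r' r' = 0 \<and> h r r' = - 1 \<and>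
     K = span (insert (q + r') (span (insert (p + r) N))) \<and> K \<in> ti A (Suc (Suc e))"
  obtain S3 f where S3: "finite S3" "card S3 \<le> b3"
    "\<And>e. d = Suc e \<Longrightarrow> S3 \<subseteq> ti W e \<and> (\<forall>X. pclosed W m e X \<longrightarrow> S3 \<subseteq> X \<longrightarrow> ti W e \<subseteq> X)"
    "\<And>N. N \<in> S3 \<Longrightarrow> \<exists>e. d = Suc e \<and> ?R e N (f N)"
  proof (cases d)
    case 0
    then show ?thesis using that[of "{}"] by auto
  next
    case (Suc e)
    obtain S3 where S3: "finite S3" "card S3 \<le> b3" "S3 \<subseteq> ti W e"
      "\<And>X. pclosed W m e X \<Longrightarrow> S3 \<subseteq> X \<Longrightarrow> ti W e \<subseteq> X"
      using g3[OF hW Suc] unfolding gen_def by metis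
    have "\<exists>K. ?R e N K" if "N \<in> S3" for N
    proof -
      have N: "N \<in> ti W e" using S3 that by blast
      have "e < m" using Suc dm by simp
      then obtain r r' where r: "r \<in> perp W N" "h r r = 0" "r' \<in> perp W N" "h r' r' = 0" "h r r' = - 1"
        using roof_vectors[OF A pq W_def N] by blast
      have "span (insert (q + r') (span (insert (p + r) N))) \<in> ti A (Suc (Suc e))"
        using roof(1)[OF A pq W_def N r] unfolding roof_def[OF A pq W_def] .
      then show ?thesis using r by (intro exI[of _ "span (insert (q + r') (span (insert (p + r) N)))"] exI conjI) auto
    qed
    then obtain f where "\<forall>N\<in>S3. ?R e N (f N)" by metis
    then show ?thesis using that[of S3 f] S3 Suc by auto
  qed
  let ?cp = "\<lambda>K. span (insert p K)" and ?cq = "\<lambda>K. span (insert q K)"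
  define S where "S = S1 \<union> ?cp ` S2 \<union> ?cq ` S2 \<union> f ` S3"
  have "finite S" unfolding S_def using S1 S2 S3 by simp
  moreover have "card S \<le> b1 + 2 * b2 + b3"
  proof -
    have "card S \<le> card S1 + card (?cp ` S2) + card (?cq ` S2) + card (f ` S3)"
      unfolding S_def by (intro order_trans[OF card_Un_le] add_mono) auto
    then show ?thesis using S1(2) S2(2) S3(2) card_image_le[OF S2(1), of ?cp] card_image_le[OF S2(1), of ?cq]
        card_image_le[OF S3(1), of f] by linarith
  qed
  moreover have "S \<subseteq> ti A (Suc d)"
    using S1(3) ti_mono[OF WA] S2(3) ti_cone(1)[OF sA pq] ti_cone(1)[OF sA hpair_sym[OF pq]] S3(4)
    unfolding S_def W_def[symmetric] W'[symmetric] by blast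
  moreover have "ti A (Suc d) \<subseteq> X" if X: "pclosed A (Suc m) (Suc d) X" "S \<subseteq> X" for X
  proof -
    have "ti W d \<subseteq> {K. ?cp K \<in> X}"
      using S2(4) pclosed_residue[OF sA pq dm X(1)] X(2) unfolding S_def W_def[symmetric] by blast
    moreover have "ti W d \<subseteq> {K. ?cq K \<in> X}"
      using S2(4) pclosed_residue[OF sA hpair_sym[OF pq] dm X(1)] X(2) unfolding S_def W'[symmetric] by blast
    ultimately have through: "K \<in> X" if "K \<in> ti A (Suc d)" "p \<in> K \<or> q \<in> K" for K
      using ti_residue[OF pq that(1)] ti_residue[OF hpair_sym[OF pq] that(1)] that(2)
      unfolding W_def[symmetric] W'[symmetric] by (metis mem_Collect_eq subsetD)
    note ctx = A pq W_def dm X(1) through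
    have base: "K \<in> X" if "K \<in> ti W (Suc d)" for K
      using S1(4)[OF pclosed_base[OF ctx]] X(2) that unfolding S_def by blast
    show ?thesis
    proof (cases d)
      case 0
      have "{0} \<in> ti W d" using ti_0[OF hyp_subspace[OF hW]] 0 by simp
      moreover have "{0} \<subseteq> K" if "K \<in> ti A (Suc d)" for K using subspace_0[OF ti_subspace[OF that]] by simp
      ultimately show ?thesis using over_base[OF ctx base] by blast
    next
      case (Suc e)
      let ?G = "{N. \<forall>K\<in>ti A (Suc d). N \<subseteq> K \<longrightarrow> K \<in> X}"
      have "S3 \<subseteq> ?G"
      proof (intro subsetI CollectI ballI impI)
        fix N K assume N: "N \<in> S3" and K: "K \<in> ti A (Suc d)" "N \<subseteq> K"
        then have NW: "N \<in> ti W e" using S3(3)[OF Suc] by blast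
        obtain r r' where r: "r \<in> perp W N" "h r r = 0" "r' \<in> perp W N" "h r' r' = 0" "h r r' = - 1"
          "f N = span (insert (q + r') (span (insert (p + r) N)))" using S3(4)[OF N] by blast
        moreover have "f N \<in> X" using X(2) N unfolding S_def by blast
        ultimately show "K \<in> X"
          using over_codim_two[OF ctx base Suc NW r(1-5) _ K] by simp
      qed
      then have G: "ti W e \<subseteq> ?G" using S3(3)[OF Suc] pclosed_codim_two[OF ctx base Suc] by blast
      show ?thesis
      proof
        fix K assume K: "K \<in> ti A (Suc d)"
        \<comment> \<open>Cutting \<open>K\<close> with \<open>W\<close> loses at most two
          dimensions, so \<open>K\<close> lies over an \<open>e\<close>-space of
          \<open>W\<close>.\<close>
        have dimK: "dim (perp K {p, q}) \<ge> e"
        proof -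
          have "Suc d \<le> Suc (dim (perp K {p}))" using dim_perp_vector[OF ti_subspace[OF K]] ti_dim[OF K] by metis
          moreover have "dim (perp K {p}) \<le> Suc (dim (perp (perp K {p}) {q}))"
            by (rule dim_perp_vector[OF subspace_perp[OF ti_subspace[OF K]]])
          moreover have "perp (perp K {p}) {q} = perp K {p, q}" by (auto simp: perp_def)
          ultimately show ?thesis using Suc by simp
        qed
        have sub: "perp K {p, q} \<subseteq> K" "perp K {p, q} \<subseteq> W"
          unfolding W_def using ti_sub[OF K] by (auto simp: perp_def)
        have "perp K {p, q} \<in> ti W (dim (perp K {p, q}))"
          using ti_subset[OF K subspace_perp[OF ti_subspace[OF K]] sub(1)] sub(2) by (auto simp: ti_iff)
        moreover have "{0} \<in> ti W 0" using ti_0[OF hyp_subspace[OF hW]] by simp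
        ultimately obtain N where N: "N \<in> ti W e" "N \<subseteq> perp K {p, q}"
          using ti_subspace_exists[of _ W _ "{0}" 0 e] dimK subspace_0[OF subspace_perp[OF ti_subspace[OF K]]] by (metis empty_subsetI insert_subset le0)
        then show "K \<in> X" using G K sub by blast
      qed
    qed
  qed
  ultimately show ?thesis unfolding gen_def by blast
qed

text \<open>Pascal's rule twice; in degree one there is no \<open>(k - 2)\<close>-space and the last
  term is absent.\<close>

lemma choose_step: "(2 * Suc m) choose (Suc d) = ((2 * m) choose (Suc d)) + 2 * ((2 * m) choose d) +
   (case d of 0 \<Rightarrow> 0 | Suc e \<Rightarrow> (2 * m) choose e)"
  by (cases d) simp_all

text \<open>The recursion ends in top cases whose rank is at most the initial degree;
  \<open>c\<close> records this bound, so that degree one calls for rank one only.\<close>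

lemma gen_below_top:
  assumes top: "\<And>A m. hyp A m \<Longrightarrow> 0 < m \<Longrightarrow> m \<le> c \<Longrightarrow> gen A m m ((2 * m) choose m)"
    and A: "hyp A m" and k: "k \<le> m" "k \<le> c"
  shows "gen A m k ((2 * m) choose k)"
  using A k
proof (induction m arbitrary: A k)
  case 0
  then show ?case using gen_0[OF hyp_subspace] by simp
next
  case (Suc m)
  show ?case
  proof (cases k)
    case 0
    then show ?thesis using gen_0[OF hyp_subspace[OF Suc(2)]] by simp
  next
    case d: (Suc d)
    show ?thesis
    proof (cases "k = Suc m")
      case True
      then show ?thesis using top[OF Suc(2)] Suc(4) by simp
    next
      case False
      then have dm: "d < m" using d Suc(3) by simp
      have "gen A (Suc m) (Suc d) (((2 * m) choose (Suc d)) + 2 * ((2 * m) choose d) +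
         (case d of 0 \<Rightarrow> 0 | Suc e \<Rightarrow> (2 * m) choose e))"
      proof (rule gen_step[OF Suc(2) dm])
        fix W assume W: "hyp W m"
        show "gen W m (Suc d) ((2 * m) choose (Suc d))" "gen W m d ((2 * m) choose d)"
          using Suc(1)[OF W] dm d Suc(4) by simp_all
        fix e assume "d = Suc e"
        then show "gen W m e (case d of 0 \<Rightarrow> 0 | Suc e \<Rightarrow> (2 * m) choose e)"
          using Suc(1)[OF W] dm d Suc(4) by simp
      qed
      then show ?thesis unfolding d choose_step .
    qed
  qed
qed

section \<open>Vectors of a given norm\<close>

lemma exists_skew: "\<exists>\<tau>. \<tau> \<noteq> 0 \<and> \<sigma> \<tau> = - \<tau>"
proof -
  obtain x where "\<sigma> x \<noteq> x" using exists_nonfixed by blast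
  then have "x - \<sigma> x \<noteq> 0 \<and> \<sigma> (x - \<sigma> x) = - (x - \<sigma> x)" by simp
  then show ?thesis by blast
qed

text \<open>Cramer's rule for a linear system in \<open>X\<close> and \<open>\<sigma> X\<close> with
  determinant \<open>\<sigma> \<kappa> - \<kappa>\<close> up to sign; as \<open>r\<close> and
  \<open>s\<close> are fixed, the second unknown comes out as the conjugate of the first.\<close>

lemma solve_traces:
  assumes \<kappa>: "\<sigma> \<kappa> \<noteq> \<kappa>" and r: "\<sigma> r = r" and s: "\<sigma> s = s"
  obtains X where "X + \<sigma> X = s" "X * \<sigma> \<kappa> + \<sigma> X * \<kappa> = r"
proof -
  define D where "D = \<sigma> \<kappa> - \<kappa>"
  have D: "D \<noteq> 0" using \<kappa> by (simp add: D_def)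
  have sD: "\<sigma> D = - D" by (simp add: D_def)
  define X where "X = (r - s * \<kappa>) / D"
  have "\<sigma> X = (r - s * \<sigma> \<kappa>) / - D" unfolding X_def \<sigma>_divide sD using r s by simp
  then have sX: "\<sigma> X = (s * \<sigma> \<kappa> - r) / D" by (metis minus_diff_eq minus_divide_divide)
  have "X + \<sigma> X = (s * D) / D" unfolding sX unfolding X_def D_def by (simp add: add_divide_distrib[symmetric] algebra_simps)
  then have 1: "X + \<sigma> X = s" using D by simp
  have "X * \<sigma> \<kappa> + \<sigma> X * \<kappa> = (r * D) / D"
    unfolding sX unfolding X_def by (simp add: add_divide_distrib[symmetric] D_def algebra_simps)
  then show ?thesis using that 1 D by simp
qed

text \<open>Adding a fixed \<open>l\<close> to \<open>x\<close> changes the norm by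
  \<open>l * (l + T)\<close>, where \<open>T\<close> is the trace of \<open>x\<close>. One of the
  fixed scalars \<open>1\<close> and \<open>a\<close> differs from \<open>- T\<close>, so two
  nonfixed elements have different norms and one of them avoids \<open>t\<close>.\<close>

lemma nonfixed_norms:
  assumes "\<sigma> a = a" "a \<noteq> 0" "a \<noteq> 1"
  shows "\<exists>\<rho>. \<sigma> \<rho> \<noteq> \<rho> \<and> \<rho> * \<sigma> \<rho> \<noteq> t"
proof -
  obtain x where x: "\<sigma> x \<noteq> x" using exists_nonfixed by blast
  define T where "T = x + \<sigma> x"
  have "\<exists>l. \<sigma> l = l \<and> l \<noteq> 0 \<and> l + T \<noteq> 0"
  proof (rule ccontr)
    assume "\<not> ?thesis"
    then have *: "l = 0 \<or> l + T = 0" if "\<sigma> l = l" for l using that by blast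
    have "1 + T = 0" "a + T = 0" using *[OF \<sigma>_1] *[OF assms(1)] assms by auto
    then show False using assms(3) by (metis add_right_imp_eq)
  qed
  then obtain l where l: "\<sigma> l = l" "l \<noteq> 0" "l + T \<noteq> 0" by blast
  have "(x + l) * \<sigma> (x + l) - x * \<sigma> x = l * (l + T)" using l unfolding T_def by (simp add: algebra_simps)
  then have "(x + l) * \<sigma> (x + l) \<noteq> x * \<sigma> x" using l by (metis eq_iff_diff_eq_0 mult_eq_0_iff)
  moreover have "\<sigma> (x + l) \<noteq> x + l" using x l by simp
  ultimately show ?thesis using x by metis
qed

context
  fixes Y p q c U
  assumes Y: "subspace Y" and pq: "hpair Y p q" and c: "c \<noteq> 0"
    and U: "U \<subseteq> {u \<in> Y. h u u = c}"
    and closed: "\<And>u w. u \<in> U \<Longrightarrow> w \<in> Y \<Longrightarrow> h w w = 0 \<Longrightarrow> h u w \<noteq> 0 \<Longrightarrow> h (u + w) (u + w) = c \<Longrightarrow> u + w \<in> U"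
begin

lemma hyp_pq: "p \<in> Y" "q \<in> Y" "h p p = 0" "h q q = 0" "h p q = 1" "h q p = 1"
  using pq by (auto simp: hpair_def)

lemma move:
  assumes u: "u \<in> U" and v: "v \<in> Y" "h v v = c" and d: "h (v - u) (v - u) = 0" and uv: "h u v \<noteq> c"
  shows "v \<in> U"
proof -
  have "u \<in> Y" "h u u = c" using u U by auto
  then have "v - u \<in> Y" "h u (v - u) \<noteq> 0" using v Y uv by (auto simp: subspace_diff h_simps)
  then show ?thesis using closed[OF u _ d] v by simp
qed

lemma move_p:
  assumes u: "u \<in> U" "h u p \<noteq> 0" and v: "u + t *s p \<in> Y" "h (u + t *s p) (u + t *s p) = c"
  shows "u + t *s p \<in> U"
proof (cases "t = 0")
  case False
  then have "h u (t *s p) \<noteq> 0" "h (t *s p) (t *s p) = 0" using u hyp_pq by (auto simp: h_simps)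
  then show ?thesis using closed[OF u(1)] hyp_pq(1) Y v by (simp add: subspace_scale)
qed (use u in simp)

lemma leave_p_perp:
  assumes v: "v \<in> Y" "h v v = c" "h v p = 0"
  shows "\<exists>w. w \<in> Y \<and> h w w = 0 \<and> h v w \<noteq> 0 \<and> h (v + w) (v + w) = c \<and> h (v + w) p \<noteq> 0"
proof -
  obtain \<tau> where \<tau>: "\<tau> \<noteq> 0" "\<sigma> \<tau> = - \<tau>" using exists_skew by blast
  have pv: "h p v = 0" using v(3) h_eq_0_sym by blast
  show ?thesis
  proof (cases "h v q = 0")
    case True
    then have qv: "h q v = 0" using h_eq_0_sym by blast
    \<comment> \<open>As \<open>\<tau>\<close> is skew, the cross terms of \<open>v\<close> and
      \<open>w\<close> cancel; \<open>q\<close> leads out of the hyperplane of \<open>p\<close>, and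
      the multiple of \<open>p\<close> makes \<open>w\<close> isotropic.\<close>
    define w where "w = \<tau> *s v + q - (\<tau> * \<sigma> \<tau> * c * \<theta>) *s p"
    have wY: "w \<in> Y" unfolding w_def using v(1) hyp_pq Y by (simp add: subspace_add subspace_diff subspace_scale)
    have vw: "h v w = - \<tau> * c" unfolding w_def using v True by (simp add: h_simps \<tau>)
    have sc: "\<sigma> c = c" using v(2) h_self_fixed by blast
    have "h w w = \<tau> * \<sigma> \<tau> * c * (1 - \<theta> - \<sigma> \<theta>)"
      unfolding w_def using v True pv qv hyp_pq sc \<tau> by (simp add: h_simps algebra_simps)
    then have ww: "h w w = 0" using \<theta> by (simp add: \<sigma>_\<theta>)
    have "h w v = \<sigma> (- \<tau> * c)" unfolding h_sym[of w v] vw ..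
    then have "h w v = \<tau> * c" using sc \<tau> by simp
    then have "h (v + w) (v + w) = c" using vw ww v by (simp add: h_simps)
    moreover have "h (v + w) p \<noteq> 0" unfolding w_def using v hyp_pq by (simp add: h_simps)
    ultimately show ?thesis using wY ww vw \<tau> c by (metis mult_eq_0_iff neg_equal_0_iff_equal)
  next
    case False
    define t where "t = \<sigma> (\<tau> / h v q)"
    have t0: "t \<noteq> 0" unfolding t_def using False \<tau> by simp
    have 1: "\<sigma> t * h v q = \<tau>" unfolding t_def using False by simp
    have vw: "h v (t *s q) = \<tau>" using 1 by (simp add: h_simps)
    then have "h (t *s q) v = - \<tau>" using h_sym[of "t *s q" v] \<tau> by simp
    then have "h (v + t *s q) (v + t *s q) = c" using vw v hyp_pq by (simp add: h_add_left h_add_right) (simp add: h_simps hyp_pq)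
    moreover have "h (v + t *s q) p \<noteq> 0" using v hyp_pq t0 by (simp add: h_simps)
    moreover have "t *s q \<in> Y" "h (t *s q) (t *s q) = 0" using hyp_pq Y by (simp_all add: subspace_scale h_simps)
    ultimately show ?thesis using vw \<tau> by blast
  qed
qed

text \<open>Scaling the \<open>q\<close>-coordinate by a nonfixed \<open>\<kappa>\<close> leaves
  enough freedom in the \<open>p\<close>-coordinate for two conditions: \<open>v\<close> has norm
  \<open>c\<close> and \<open>v - u\<close> is isotropic. The hypothesis \<open>ne\<close> keeps
  \<open>h u v\<close> away from \<open>c\<close>, as \<open>move\<close> demands.\<close>

lemma change_component:
  assumes u: "u \<in> U" "y = h u p" "z = u - h u q *s p - y *s q" and y: "y \<noteq> 0"
    and \<kappa>: "\<sigma> \<kappa> \<noteq> \<kappa>" and z': "z' \<in> perp Y {p, q}"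
    and ne: "c * ((\<kappa> - 1) * \<sigma> (\<kappa> - 1)) \<noteq> h (\<kappa> *s z - z') (\<kappa> *s z - z')"
  shows "\<exists>x'. x' *s p + (\<kappa> * y) *s q + z' \<in> U"
proof -
  define x where "x = h u q"
  have uY: "u \<in> Y" "h u u = c" using u U by auto
  have sc: "\<sigma> c = c" using uY(2) h_self_fixed by blast
  have udec: "u = x *s p + y *s q + z" using u(3) unfolding x_def by simp
  have z: "z \<in> Y" "h z p = 0" "h z q = 0"
    using u uY hyp_pq Y by (auto simp: h_simps x_def intro: subspace_diff subspace_scale)
  then have z0: "h p z = 0" "h q z = 0" using h_eq_0_sym by auto
  have z'0: "z' \<in> Y" "h z' p = 0" "h z' q = 0" "h p z' = 0" "h q z' = 0"
    using z' by (auto simp: perp_def h_eq_0_sym)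
  let ?T = "\<lambda>a. a + \<sigma> a"
  \<comment> \<open>\<open>X\<close> stands for \<open>x' * \<sigma> y\<close>. The first equation
    fixes the trace of \<open>h u v\<close>, the second the norm of \<open>v\<close>.\<close>
  obtain X where X: "X + \<sigma> X = (c + c) - ?T (x * \<sigma> (\<kappa> * y)) - ?T (h z z')"
    "X * \<sigma> \<kappa> + \<sigma> X * \<kappa> = c - h z' z'"
  proof (rule solve_traces[OF \<kappa>])
    show "\<sigma> (c - h z' z') = c - h z' z'" using sc h_self_fixed by simp
    have "\<sigma> (?T a) = ?T a" for a by (simp add: add.commute)
    then show "\<sigma> ((c + c) - ?T (x * \<sigma> (\<kappa> * y)) - ?T (h z z')) = (c + c) - ?T (x * \<sigma> (\<kappa> * y)) - ?T (h z z')"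
      unfolding \<sigma>_diff using sc by (metis \<sigma>_add)
  qed
  define x' where "x' = X / \<sigma> y"
  have Xx: "x' * \<sigma> y = X" unfolding x'_def using y by simp
  have sX: "y * \<sigma> x' = \<sigma> X" unfolding Xx[symmetric] by simp
  define v where "v = x' *s p + (\<kappa> * y) *s q + z'"
  have vY: "v \<in> Y" unfolding v_def using hyp_pq z'0 Y by (simp add: subspace_add subspace_scale)
  have "h v v = (x' * \<sigma> y) * \<sigma> \<kappa> + (y * \<sigma> x') * \<kappa> + h z' z'"
    unfolding v_def using hyp_pq z'0 by (simp add: h_simps)
  then have vv: "h v v = c" unfolding Xx sX X(2) by simp
  have uv: "h u v = x * \<sigma> (\<kappa> * y) + y * \<sigma> x' + h z z'"
    unfolding v_def udec using hyp_pq z'0 z z0 by (simp add: h_simps)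
  have "h u v + \<sigma> (h u v) = ?T (x * \<sigma> (\<kappa> * y)) + (X + \<sigma> X) + ?T (h z z')"
    unfolding uv sX by (simp add: algebra_simps)
  then have tr: "h u v + \<sigma> (h u v) = (c + c)" unfolding X(1) by simp
  have vu: "h v u = \<sigma> (h u v)" by (rule h_sym)
  have "h (v - u) (v - u) = (c + c) - (h u v + \<sigma> (h u v))" using uY vv vu by (simp add: h_simps algebra_simps)
  then have iso: "h (v - u) (v - u) = 0" using tr by simp
  have "h u v \<noteq> c"
  proof
    assume eq: "h u v = c"
    then have vu: "h v u = c" using vu sc by simp
    \<comment> \<open>\<open>\<kappa> u - v\<close> has no \<open>q\<close>-component, so its norm is that of its part in \<open>{p, q}\<^sup>\<bottom>\<close>\<close>
    have 1: "\<kappa> *s u - v = (\<kappa> * x - x') *s p + (\<kappa> *s z - z')" unfolding udec v_def by (simp add: algebra_simps)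
    have "h (\<kappa> *s u - v) (\<kappa> *s u - v) = c * ((\<kappa> - 1) * \<sigma> (\<kappa> - 1))"
      using uY vv eq vu by (simp add: h_simps algebra_simps)
    moreover have "h (\<kappa> *s u - v) (\<kappa> *s u - v) = h (\<kappa> *s z - z') (\<kappa> *s z - z')"
      unfolding 1 using hyp_pq z z0 z'0 by (simp add: h_simps)
    ultimately show False using ne by simp
  qed
  then have "v \<in> U" using move[OF u(1) vY vv iso] by blast
  then show ?thesis unfolding v_def by blast
qed

lemma coords:
  assumes "z \<in> perp Y {p, q}"
  shows "h (x *s p + y *s q + z) p = y" "h (x *s p + y *s q + z) q = x"
    "(x *s p + y *s q + z) - h (x *s p + y *s q + z) q *s p - y *s q = z"
  using assms hyp_pq by (auto simp: h_simps perp_def)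

text \<open>With \<open>z' = \<kappa> *s z\<close> the right-hand side of \<open>ne\<close> is zero,
  and the left-hand side is not because \<open>\<kappa> \<noteq> 1\<close>.\<close>

lemma reach_scaled:
  assumes "x *s p + y *s q + z \<in> U" "z \<in> perp Y {p, q}" "y \<noteq> 0" "\<sigma> \<kappa> \<noteq> \<kappa>"
  shows "\<exists>x'. x' *s p + (\<kappa> * y) *s q + \<kappa> *s z \<in> U"
proof (rule change_component[OF assms(1) coords(1)[OF assms(2), symmetric] coords(3)[OF assms(2), symmetric] assms(3,4)])
  show "\<kappa> *s z \<in> perp Y {p, q}" using assms(2) subspace_perp[OF Y] by (simp add: subspace_scale)
  have "\<kappa> \<noteq> 1" using assms(4) by auto
  then have "\<kappa> - 1 \<noteq> 0" by simp
  then show "c * ((\<kappa> - 1) * \<sigma> (\<kappa> - 1)) \<noteq> h (\<kappa> *s z - \<kappa> *s z) (\<kappa> *s z - \<kappa> *s z)"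
    using c \<sigma>_eq_0 by (metis diff_self h_zero_left mult_eq_0_iff)
qed

text \<open>Starting off the hyperplane of \<open>p\<close>, the \<open>q\<close>-coordinate, the
  component orthogonal to \<open>p\<close> and \<open>q\<close>, and the \<open>p\<close>-coordinate
  are adjusted in this order. The third fixed scalar serves the second adjustment; vectors
  orthogonal to \<open>p\<close> cost one extra step.\<close>

lemma norm_vectors_connected:
  assumes fixed: "\<sigma> a = a" "a \<noteq> 0" "a \<noteq> 1" and U0: "U \<noteq> {}" and v: "v \<in> Y" "h v v = c"
  shows "v \<in> U"
proof -
  let ?Z = "perp Y {p, q}"
  note sZ = subspace_perp[OF Y, of "{p, q}"]
  have reach_z: "\<exists>x'. x' *s p + y *s q + z' \<in> U"
    if u: "x *s p + y *s q + z \<in> U" "z \<in> ?Z" "y \<noteq> 0" and z': "z' \<in> ?Z" for x y z z'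
  proof -
    \<comment> \<open>The component is changed while the \<open>q\<close>-coordinate is scaled by
      \<open>\<kappa>\<close> and back by its inverse \<open>1 - \<rho>\<close>. In this form the
      condition of \<open>change_component\<close> concerns the norm of \<open>\<rho>\<close>
      alone.\<close>
    obtain \<rho> where \<rho>: "\<sigma> \<rho> \<noteq> \<rho>" "\<rho> * \<sigma> \<rho> \<noteq> h (z - z') (z - z') / c" using nonfixed_norms[OF fixed] by blast
    have \<rho>1: "1 - \<rho> \<noteq> 0" using \<rho>(1) by auto
    define \<kappa> where "\<kappa> = inverse (1 - \<rho>)"
    have \<kappa>: "\<sigma> \<kappa> \<noteq> \<kappa>" "\<kappa> \<noteq> 0" unfolding \<kappa>_def using \<rho>(1) \<rho>1 by auto
    have i\<kappa>: "\<sigma> (1 - \<rho>) \<noteq> 1 - \<rho>" using \<rho>(1) by simp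
    obtain x1 where x1: "x1 *s p + (\<kappa> * y) *s q + \<kappa> *s z \<in> U" using reach_scaled[OF u \<kappa>(1)] by blast
    have kz: "\<kappa> *s z \<in> ?Z" using u(2) sZ by (simp add: subspace_scale)
    have ky: "\<kappa> * y \<noteq> 0" using \<kappa> u by simp
    have inv: "(1 - \<rho>) *s (\<kappa> *s z) = z" "(1 - \<rho>) * (\<kappa> * y) = y" unfolding \<kappa>_def using \<rho>1 by simp_all
    have "c * (((1 - \<rho>) - 1) * \<sigma> ((1 - \<rho>) - 1)) = c * (\<rho> * \<sigma> \<rho>)" by simp
    also have "\<dots> \<noteq> h (z - z') (z - z')" using \<rho>(2) c by (simp add: field_simps)
    finally have ne: "c * (((1 - \<rho>) - 1) * \<sigma> ((1 - \<rho>) - 1)) \<noteq>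
       h ((1 - \<rho>) *s (\<kappa> *s z) - z') ((1 - \<rho>) *s (\<kappa> *s z) - z')" unfolding inv(1) .
    show ?thesis
      using change_component[OF x1 coords(1)[OF kz, symmetric] coords(3)[OF kz, symmetric] ky i\<kappa> z' ne]
      unfolding inv(2) .
  qed
  have reach_y: "\<exists>x' z'. z' \<in> ?Z \<and> x' *s p + y' *s q + z' \<in> U"
    if u: "x *s p + y *s q + z \<in> U" "z \<in> ?Z" "y \<noteq> 0" and y': "y' \<noteq> 0" for x y z y'
  proof (cases "\<sigma> (y' / y) = y' / y")
    case False
    then show ?thesis using reach_scaled[OF u False] u(2,3) sZ subspace_scale by fastforce
  next
    case True
    \<comment> \<open>A fixed ratio is a product of two nonfixed ones, each of which is an
      admissible scaling.\<close>
    obtain \<kappa> where \<kappa>: "\<sigma> \<kappa> \<noteq> \<kappa>" using exists_nonfixed by blast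
    then have k0: "\<kappa> \<noteq> 0" by auto
    obtain x1 where x1: "x1 *s p + (\<kappa> * y) *s q + \<kappa> *s z \<in> U" using reach_scaled[OF u \<kappa>] by blast
    have kz: "\<kappa> *s z \<in> ?Z" using u(2) sZ by (simp add: subspace_scale)
    have r: "y' / (\<kappa> * y) = (y' / y) * inverse \<kappa>" by (simp add: divide_inverse)
    have "\<sigma> (y' / (\<kappa> * y)) \<noteq> y' / (\<kappa> * y)"
      unfolding r \<sigma>_mult True \<sigma>_inverse using \<kappa> k0 u(3) y' by simp
    then obtain x2 where "x2 *s p + (y' / (\<kappa> * y) * (\<kappa> * y)) *s q + (y' / (\<kappa> * y)) *s (\<kappa> *s z) \<in> U"
      using reach_scaled[OF x1 kz _ _] k0 u(3) mult_eq_0_iff by blast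
    moreover have "y' / (\<kappa> * y) * (\<kappa> * y) = y'" using k0 u(3) by simp
    moreover have "(y' / (\<kappa> * y)) *s (\<kappa> *s z) \<in> ?Z" by (rule subspace_scale[OF sZ kz])
    ultimately show ?thesis by auto
  qed
  obtain u where u: "u \<in> U" "h u p \<noteq> 0"
  proof -
    obtain u0 where u0: "u0 \<in> U" using U0 by blast
    show ?thesis
    proof (cases "h u0 p = 0")
      case True
      then obtain w where "w \<in> Y" "h w w = 0" "h u0 w \<noteq> 0" "h (u0 + w) (u0 + w) = c" "h (u0 + w) p \<noteq> 0"
        using leave_p_perp[of u0] u0 U by blast
      then show ?thesis using that closed[OF u0] by blast
    qed (use that u0 in blast)
  qed
  have dec: "\<exists>z\<in>?Z. v = h v q *s p + h v p *s q + z" if "v \<in> Y" for v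
    using hpair_decomp[OF Y pq that] by blast
  have main: "v \<in> U" if v: "v \<in> Y" "h v v = c" "h v p \<noteq> 0" for v
  proof -
    obtain z where z: "z \<in> ?Z" "u = h u q *s p + h u p *s q + z" using dec u U by blast
    obtain zv where zv: "zv \<in> ?Z" "v = h v q *s p + h v p *s q + zv" using dec v by blast
    obtain x1 z1 where 1: "z1 \<in> ?Z" "x1 *s p + h v p *s q + z1 \<in> U"
      using reach_y[OF _ z(1) u(2) v(3)] u(1) z(2) by metis
    obtain x2 where 2: "x2 *s p + h v p *s q + zv \<in> U" using reach_z[OF 1(2,1) v(3) zv(1)] by blast
    have eq: "x2 *s p + h v p *s q + zv + (h v q - x2) *s p = h v q *s p + h v p *s q + zv"
      by (simp add: algebra_simps)
    then have eq: "x2 *s p + h v p *s q + zv + (h v q - x2) *s p = v" using zv(2) by simp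
    have "h (x2 *s p + h v p *s q + zv) p \<noteq> 0" using coords(1)[OF zv(1)] v(3) by simp
    then show ?thesis using move_p[OF 2, of "h v q - x2"] v unfolding eq by blast
  qed
  show ?thesis
  proof (cases "h v p = 0")
    case False
    then show ?thesis using main v by blast
  next
    case True
    then obtain w where w: "w \<in> Y" "h w w = 0" "h v w \<noteq> 0" "h (v + w) (v + w) = c" "h (v + w) p \<noteq> 0"
      using leave_p_perp[of v] v by blast
    have "v + w \<in> U" using main w v Y by (simp add: subspace_add)
    moreover have "- w \<in> Y" "h (- w) (- w) = 0" "h (v + w) (- w) \<noteq> 0"
      using w Y by (auto simp: h_simps subspace_neg)
    ultimately have "v + w + - w \<in> U" using closed[of "v + w" "- w"] v by simp
    then show ?thesis by simp
  qed
qed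

end

section \<open>Generation by hyperbolic lines\<close>

definition hclosed :: "'v set \<Rightarrow> nat \<Rightarrow> 'v set set \<Rightarrow> bool" where
  "hclosed A k X \<longleftrightarrow> (\<forall>d M x y z. k = Suc d \<and> M \<in> ti A d \<and> x \<in> perp A M \<and> y \<in> perp A M \<and> z \<in> span {x, y} \<and>
     h x x = 0 \<and> h y y = 0 \<and> h z z = 0 \<and> h x y \<noteq> 0 \<and> z \<noteq> 0 \<and>
     span (insert x M) \<in> X \<and> span (insert y M) \<in> X \<longrightarrow> span (insert z M) \<in> X)"

text \<open>Generation relative to \<open>Y\<close>: the \<open>k\<close>-spaces meeting
  \<open>Y\<close> nontrivially are given for free.\<close>

definition hgen :: "'v set \<Rightarrow> 'v set \<Rightarrow> nat \<Rightarrow> nat \<Rightarrow> bool" where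
  "hgen A Y k b \<longleftrightarrow> (\<exists>S. finite S \<and> card S \<le> b \<and> S \<subseteq> ti A k \<and>
     (\<forall>X. hclosed A k X \<and> S \<subseteq> X \<and> (\<forall>K\<in>ti A k. K \<inter> Y \<noteq> {0} \<longrightarrow> K \<in> X) \<longrightarrow> ti A k \<subseteq> X))"

definition star :: "'v set \<Rightarrow> nat \<Rightarrow> 'v set set \<Rightarrow> 'v set" where
  "star A k X = {x. \<forall>K\<in>ti A k. x \<in> K \<longrightarrow> K \<in> X}"

lemma span_pair:
  assumes "z \<in> span {x, y}" obtains a b where "z = a *s x + b *s y"
proof -
  obtain a where "z - a *s x \<in> span {y}" using assms span_breakdown_eq by blast
  then obtain b where "z - a *s x = b *s y" by (auto simp: span_singleton)
  then show ?thesis using that[of a b] by (simp add: algebra_simps)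
qed

text \<open>If \<open>K\<close> contains \<open>z = a *s x + b *s y\<close> with nonzero
  \<open>a\<close> and \<open>b\<close>, then \<open>perp K {x}\<close> is orthogonal to
  \<open>z\<close>, hence to \<open>y\<close>. So \<open>K\<close> is on the hyperbolic line joining
  its extensions by \<open>x\<close> and by \<open>y\<close>.\<close>

lemma star_hyperbolic_line:
  assumes A: "subspace A" and X: "hclosed A (Suc d) X" and x: "x \<in> star A (Suc d) X" and y: "y \<in> star A (Suc d) X"
    and xy: "x \<in> A" "y \<in> A" "h x x = 0" "h y y = 0" "h x y \<noteq> 0"
    and z: "z \<in> span {x, y}" "h z z = 0" "z \<noteq> 0"
  shows "z \<in> star A (Suc d) X"
  unfolding star_def
proof (intro CollectI ballI impI)
  fix K assume K: "K \<in> ti A (Suc d)" "z \<in> K"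
  note sK = ti_subspace[OF K(1)]
  obtain a b where z': "z = a *s x + b *s y" using span_pair[OF z(1)] .
  have mem: "v \<in> K" if "t *s v \<in> K" "t \<noteq> 0" for t v
    using subspace_scale[OF sK that(1), of "inverse t"] that(2) by simp
  show "K \<in> X"
  proof (cases "a = 0 \<or> b = 0")
    case True
    then have "x \<in> K \<or> y \<in> K" using z' z(3) K(2) mem[of a x] mem[of b y] by auto
    then show ?thesis using x y K(1) by (auto simp: star_def)
  next
    case False
    have hyx: "h y x \<noteq> 0" using xy(5) h_eq_0_sym by blast
    then have "h z x \<noteq> 0" unfolding z' using xy False by (simp add: h_simps)
    note M = ti_hyperplane_perp[OF K this]
    let ?M = "perp K {x}"
    have m: "h m x = 0" "h m y = 0" "m \<in> A" if "m \<in> ?M" for m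
    proof -
      show "h m x = 0" "m \<in> A" using that ti_sub[OF K(1)] by (auto simp: perp_def)
      have "h m z = 0" using that ti_h[OF K(1) _ K(2)] by (auto simp: perp_def)
      then show "h m y = 0" unfolding z' using \<open>h m x = 0\<close> False by (simp add: h_simps)
    qed
    have xM: "x \<notin> ?M" "y \<notin> ?M" using m xy(5) hyx by blast+
    have p: "x \<in> perp A ?M" "y \<in> perp A ?M" using m xy h_eq_0_sym by (auto simp: perp_def)
    have "span (insert x ?M) \<in> X" "span (insert y ?M) \<in> X"
      using ti_insert[OF A M(1) p(1) xy(3) xM(1)] ti_insert[OF A M(1) p(2) xy(4) xM(2)] x y
      by (auto simp: star_def span_base)
    then have "span (insert z ?M) \<in> X" using X M(1) p z xy unfolding hclosed_def by blast
    then show ?thesis using M(3) by simp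
  qed
qed

lemma star_scale: "t *s x \<in> star A k X \<Longrightarrow> x \<in> star A k X"
  unfolding star_def using ti_subspace subspace_scale[of _ x t] by auto

text \<open>A step from \<open>u\<close> to \<open>u + w\<close> among the vectors of norm
  \<open>c\<close> lifts to the hyperbolic line through the star vectors \<open>u + b\<close> and
  \<open>w\<close>. Up to scaling, the isotropic vectors of the larger span outside \<open>Y\<close>
  are the \<open>v + b\<close> with \<open>v\<close> of norm \<open>c\<close>.\<close>

lemma star_extend:
  assumes A: "subspace A" and X: "hclosed A (Suc d) X" and Y: "subspace Y" "Y \<subseteq> A" and pq: "hpair Y p q"
    and fixed: "\<sigma> f = f" "f \<noteq> 0" "f \<noteq> 1"
    and star: "\<And>x. x \<in> Y \<Longrightarrow> h x x = 0 \<Longrightarrow> x \<noteq> 0 \<Longrightarrow> x \<in> star A (Suc d) X"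
    and b: "b \<in> perp A Y" "h b b = - c" "c \<noteq> 0" and a: "a \<in> Y" "h a a = c" "a + b \<in> star A (Suc d) X"
    and s: "s \<in> span (insert b Y)" "h s s = 0" "s \<noteq> 0"
  shows "s \<in> star A (Suc d) X"
proof -
  have bY: "h b y = 0" "h y b = 0" if "y \<in> Y" for y using that b by (auto simp: perp_def h_eq_0_sym)
  have bA: "b \<in> A" using b perpD1 by blast
  define U where "U = {u \<in> Y. h u u = c \<and> u + b \<in> star A (Suc d) X}"
  have all: "v \<in> U" if "v \<in> Y" "h v v = c" for v
  proof (rule norm_vectors_connected[OF Y(1) pq b(3) _ _ fixed _ that])
    show "U \<subseteq> {u \<in> Y. h u u = c}" by (auto simp: U_def)
    show "U \<noteq> {}" using a by (auto simp: U_def)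
    fix u w assume u: "u \<in> U" and w: "w \<in> Y" "h w w = 0" "h u w \<noteq> 0" "h (u + w) (u + w) = c"
    have u': "u \<in> Y" "h u u = c" "u + b \<in> star A (Suc d) X" using u by (auto simp: U_def)
    have "w \<noteq> 0" using w(3) by auto
    then have "w \<in> star A (Suc d) X" using star w by blast
    moreover have "u + b \<in> A" "w \<in> A" using u' w Y bA A by (auto simp: subspace_add)
    moreover have "h (u + b) (u + b) = 0" "h (u + b) w \<noteq> 0" using u' w b bY by (simp_all add: h_simps)
    moreover have "u + w + b \<in> span {u + b, w}"
    proof -
      have "u + w + b = (u + b) + w" by simp
      then show ?thesis by (metis insertCI span_add span_base)
    qed
    moreover have uwY: "u + w \<in> Y" using u' w Y by (simp add: subspace_add)
    moreover have "h (u + w + b) (u + w + b) = 0"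
      using w(4) bY[OF uwY] b(2) unfolding h_add_left[of "u + w" b] h_add_right[of _ "u + w" b] by simp
    moreover have "h (u + w + b) b = - c" using bY[OF uwY] b(2) unfolding h_add_left[of "u + w" b] by simp
    then have "u + w + b \<noteq> 0" using b(3) by auto
    ultimately have "u + w + b \<in> star A (Suc d) X"
      using star_hyperbolic_line[OF A X u'(3)] w(2) by blast
    then show "u + w \<in> U" using uwY w(4) by (simp add: U_def)
  qed
  obtain y t where y: "y \<in> Y" "s = y + t *s b" using s(1) mem_span_insert[OF Y(1)] by blast
  show ?thesis
  proof (cases "t = 0")
    case True
    then show ?thesis using y s star by simp
  next
    case False
    define v where "v = inverse t *s y"
    have sv: "inverse t *s s = v + b" unfolding y v_def using False by (simp add: scale_right_distrib)
    have vY: "v \<in> Y" unfolding v_def using y Y by (simp add: subspace_scale)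
    have "h (inverse t *s s) (inverse t *s s) = 0" using s(2) by (simp add: h_simps)
    then have "h v v = c" unfolding sv using bY[OF vY] b(2) by (simp add: h_simps)
    then have "inverse t *s s \<in> star A (Suc d) X" using all vY unfolding sv by (simp add: U_def)
    then show ?thesis by (rule star_scale)
  qed
qed

lemma hclosed_residue:
  assumes A: "subspace A" and pq: "hpair A p q" and X: "hclosed A (Suc d) X"
  shows "hclosed (perp A {p, q}) d {K. span (insert p K) \<in> X}"
  unfolding hclosed_def
proof (intro allI impI, elim conjE)
  let ?W = "perp A {p, q}" and ?c = "\<lambda>K. span (insert p K)"
  fix e M x y z
  assume d: "d = Suc e" and M: "M \<in> ti ?W e" and x: "x \<in> perp ?W M" "h x x = 0" and y: "y \<in> perp ?W M" "h y y = 0"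
    and z: "z \<in> span {x, y}" "h z z = 0" "z \<noteq> 0" and xy: "h x y \<noteq> 0"
    and cX: "span (insert x M) \<in> {K. ?c K \<in> X}" "span (insert y M) \<in> {K. ?c K \<in> X}"
  have cM: "?c M \<in> ti A d" using ti_cone(1)[OF A pq M] d by simp
  have comm: "?c (span (insert v M)) = span (insert v (?c M))" for v by (rule span_insert_commute)
  have "v \<in> perp A (?c M)" if "v \<in> perp ?W M" for v using that unfolding perp_span by (auto simp: perp_def)
  moreover have "span (insert x (?c M)) \<in> X" "span (insert y (?c M)) \<in> X" using cX comm by simp_all
  ultimately have "span (insert z (?c M)) \<in> X" using X cM x y z xy unfolding hclosed_def by blast
  then show "span (insert z M) \<in> {K. ?c K \<in> X}" using comm by simp
qed

section \<open>Induction along an orthogonal basis\<close>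

lemma alt_length: "alt L \<Longrightarrow> even (length L)"
  and alt_norm: "alt L \<Longrightarrow> i < length L \<Longrightarrow> h (L ! i) (L ! i) = (- 1) ^ i"
  and alt_orth: "alt L \<Longrightarrow> i < length L \<Longrightarrow> j < length L \<Longrightarrow> i \<noteq> j \<Longrightarrow> h (L ! i) (L ! j) = 0"
  by (auto simp: alt_def)

text \<open>Deleting two neighbours moves the later positions by an even amount, so the signs of the
  norms still alternate.\<close>

lemma alt_remove:
  assumes L: "alt L" "Suc i < length L"
  defines "L' \<equiv> take i L @ drop (Suc (Suc i)) L"
  shows "alt L'" "length L' + 2 = length L" "span (set L') = perp (span (set L)) {L ! i, L ! Suc i}"
proof -
  show len: "length L' + 2 = length L" unfolding L'_def using L(2) by auto
  define g where "g j = (if j < i then j else Suc (Suc j))" for j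
  have nth: "L' ! j = L ! g j" "g j < length L" "g j \<noteq> i" "g j \<noteq> Suc i" if "j < length L'" for j
    using that L(2) unfolding L'_def g_def by (auto simp: nth_append)
  have g: "g j = g l \<longleftrightarrow> j = l" for j l unfolding g_def by auto
  show "alt L'"
    unfolding alt_def
  proof (intro conjI allI impI)
    show "even (length L')" using alt_length[OF L(1)] len by (metis even_add even_numeral)
    fix j l assume "j < length L'" "l < length L'"
    then show "h (L' ! j) (L' ! l) = (if j = l then (- 1) ^ j else 0)"
      using nth[of j] nth[of l] alt_norm[OF L(1), of "g j"] alt_orth[OF L(1), of "g j" "g l"] g[of j l]
      by (auto simp: g_def)
  qed
  let ?a = "L ! i" and ?b = "L ! Suc i"
  have L'_perp: "set L' \<subseteq> perp (span (set L)) {?a, ?b}"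
  proof
    fix x assume "x \<in> set L'"
    then obtain j where j: "j < length L'" "x = L' ! j" by (metis in_set_conv_nth)
    then show "x \<in> perp (span (set L)) {?a, ?b}"
      using nth[OF j(1)] alt_orth[OF L(1), of "g j"] L(2) by (auto simp: perp_def intro: span_base)
  qed
  show "span (set L') = perp (span (set L)) {?a, ?b}"
  proof
    show "span (set L') \<subseteq> perp (span (set L)) {?a, ?b}"
      using L'_perp by (rule span_minimal) (simp add: subspace_perp)
    show "perp (span (set L)) {?a, ?b} \<subseteq> span (set L')"
    proof
      fix x assume x: "x \<in> perp (span (set L)) {?a, ?b}"
      have "L = take i L @ ?a # ?b # drop (Suc (Suc i)) L"
        using L(2) by (metis Cons_nth_drop_Suc Suc_lessD append_take_drop_id)
      then have "set L = set (take i L @ ?a # ?b # drop (Suc (Suc i)) L)" by simp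
      then have "set L = insert ?a (insert ?b (set L'))" unfolding L'_def by auto
      then have "x \<in> span (insert ?a (insert ?b (set L')))" using x perpD1 by simp
      then obtain s t where st: "x - s *s ?a - t *s ?b \<in> span (set L')" unfolding span_breakdown_eq by blast
      define l where "l = x - s *s ?a - t *s ?b"
      have "l \<in> perp (span (set L)) {?a, ?b}"
        using st L'_perp unfolding l_def by (meson span_minimal subsetD subspace_perp subspace_span)
      then have hl: "h l ?a = 0" "h l ?b = 0" "h x ?a = 0" "h x ?b = 0" using x by (auto simp: perp_def)
      have ab: "h ?a ?b = 0" "h ?b ?a = 0" "h ?a ?a \<noteq> 0" "h ?b ?b \<noteq> 0"
        using alt_orth[OF L(1), of i "Suc i"] alt_orth[OF L(1), of "Suc i" i] alt_norm[OF L(1), of i]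
          alt_norm[OF L(1), of "Suc i"] L(2) by auto
      have "h l ?a = - s * h ?a ?a" "h l ?b = - t * h ?b ?b" unfolding l_def using hl ab by (simp_all add: h_simps)
      then have "s = 0" "t = 0" using hl ab by auto
      then show "x \<in> span (set L')" using st by simp
    qed
  qed
qed

text \<open>The partner \<open>w\<close> is chosen in the plane of the two basis vectors, so the
  residue is obtained by deleting them. With coefficients \<open>\<theta>\<close> and
  \<open>\<sigma> \<theta>\<close>, \<open>h v w\<close> is the trace of \<open>\<theta>\<close> and
  the two parts of \<open>h w w\<close> cancel.\<close>

lemma alt_hpair:
  assumes L: "alt L" "Suc i < length L" and \<omega>: "\<omega> * \<sigma> \<omega> = 1" and Y: "subspace Y" "L ! i \<in> Y" "L ! Suc i \<in> Y"
  obtains w where "hpair Y (L ! i + \<omega> *s L ! Suc i) w" "perp A {L ! i + \<omega> *s L ! Suc i, w} = perp A {L ! i, L ! Suc i}"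
proof -
  define a b \<epsilon> v where "a = L ! i" and "b = L ! Suc i" and "\<epsilon> = ((- 1) ^ i :: 'f)" and "v = a + \<omega> *s b"
  define w where "w = (\<epsilon> * \<theta>) *s a - (\<epsilon> * \<sigma> \<theta> * \<omega>) *s b"
  have \<epsilon>: "\<epsilon> * \<epsilon> = 1" "\<sigma> \<epsilon> = \<epsilon>" unfolding \<epsilon>_def by (cases "even i"; simp)+
  then have \<epsilon>': "\<epsilon> * (\<epsilon> * x) = x" for x by (simp flip: mult.assoc)
  have \<omega>': "\<omega> * (\<sigma> \<omega> * x) = x" "\<sigma> \<omega> * (\<omega> * x) = x" for x
    using \<omega> by (simp_all flip: mult.assoc) (simp add: mult.commute[of "\<sigma> \<omega>"])
  have ab: "h a a = \<epsilon>" "h b b = - \<epsilon>" "h a b = 0" "h b a = 0"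
    unfolding a_def b_def \<epsilon>_def
    using alt_orth[OF L(1), of i "Suc i"] alt_orth[OF L(1), of "Suc i" i] alt_norm[OF L(1), of i]
          alt_norm[OF L(1), of "Suc i"] L(2) by auto
  have "v \<in> Y" "w \<in> Y" unfolding v_def w_def a_def b_def using Y by (simp_all add: subspace_add subspace_diff subspace_scale)
  moreover have "h v v = 0" unfolding v_def using ab by (simp add: h_simps \<epsilon> \<epsilon>' \<omega>' ac_simps \<omega>)
  moreover have "h w w = 0" unfolding w_def using ab by (simp add: h_simps \<epsilon> \<epsilon>' \<omega>' ac_simps)
  moreover have "h v w = 1"
  proof -
    have "h v w = (\<epsilon> * \<epsilon>) * \<sigma> \<theta> + (\<epsilon> * \<epsilon>) * (\<omega> * \<sigma> \<omega>) * \<theta>" unfolding v_def w_def using ab by (simp add: h_simps \<epsilon> \<epsilon>' ac_simps)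
    then show ?thesis unfolding \<epsilon>(1) \<omega> using \<theta> by (simp add: add.commute)
  qed
  ultimately have "hpair Y v w" using h_one_sym by (simp add: hpair_def)
  moreover have "perp A {v, w} = perp A {a, b}"
  proof -
    have "h x v = 0 \<and> h x w = 0 \<longleftrightarrow> h x a = 0 \<and> h x b = 0" for x
    proof
      assume 0: "h x v = 0 \<and> h x w = 0"
      have nz: "\<sigma> \<omega> \<noteq> 0" "\<epsilon> \<noteq> 0" using \<omega> \<epsilon> by auto
      have e1: "h x a = - \<sigma> \<omega> * h x b" using 0 unfolding v_def by (simp add: h_simps eq_neg_iff_add_eq_0)
      have "\<epsilon> * (\<sigma> \<theta> * h x a - \<theta> * (\<sigma> \<omega> * h x b)) = 0"
        using 0 unfolding w_def by (simp add: h_simps \<epsilon> algebra_simps)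
      then have "\<sigma> \<theta> * h x a - \<theta> * (\<sigma> \<omega> * h x b) = 0" using nz by simp
      moreover have "(\<sigma> \<theta> + \<theta>) * (\<sigma> \<omega> * h x b) = - (\<sigma> \<theta> * h x a - \<theta> * (\<sigma> \<omega> * h x b))"
        unfolding e1 by (simp add: algebra_simps)
      ultimately have "(\<sigma> \<theta> + \<theta>) * (\<sigma> \<omega> * h x b) = 0" by simp
      moreover have "\<sigma> \<theta> + \<theta> = 1" using \<theta> by (simp add: add.commute)
      ultimately have "h x b = 0" using nz by simp
      then show "h x a = 0 \<and> h x b = 0" using e1 by simp
    next
      assume "h x a = 0 \<and> h x b = 0"
      then show "h x v = 0 \<and> h x w = 0" unfolding v_def w_def by (simp add: h_simps)
    qed
    then show ?thesis by (auto simp: perp_def)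
  qed
  ultimately show ?thesis using that unfolding v_def a_def b_def by blast
qed

definition hbound :: "nat \<Rightarrow> nat \<Rightarrow> nat \<Rightarrow> nat" where
  "hbound N j k = (if k = 0 then 1 else if j = 1 then N choose k
     else ((N - j) choose k) + (if j \<le> k then (N - j) choose (k - j) else 0))"

text \<open>The count mirrors the expected dimension of the quotient of the exterior power of \<open>V\<close> by the span of
  the \<open>k\<close>-spaces meeting \<open>Y\<close>, where \<open>j = dim Y\<close>: besides the part coming from \<open>V / Y\<close> the products with the top
  power of \<open>Y\<close> survive.\<close>

lemma hbound_step:
  assumes j: "2 \<le> j" "j < 2 * n" and n: "0 < n"
  shows "hbound (2 * (n - 1)) (j - 1) d + hbound (2 * n) (Suc j) (Suc d) = hbound (2 * n) j (Suc d)"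
proof -
  define N where "N = 2 * n - Suc j"
  have N: "2 * n - j = Suc N" "2 * (n - 1) - (j - 1) = N" "2 * n - Suc j = N" using j n by (auto simp: N_def)
  show ?thesis
  proof (cases "d = 0")
    case True
    then show ?thesis using j N unfolding hbound_def by auto
  next
    case d: False
    show ?thesis
    proof (cases "j = 2")
      case True
      have M: "2 * (n - 1) = Suc N" using N True n by simp
      obtain e where e: "d = Suc e" using d by (cases d) auto
      have "hbound (2 * n) (Suc j) (Suc d) = (N choose Suc d) + (if 1 \<le> e then N choose (e - 1) else 0)"
        unfolding hbound_def N using True e by simp
      moreover have "hbound (2 * n) j (Suc d) = (Suc N choose Suc d) + (Suc N choose e)"
        unfolding hbound_def N using True e by simp
      moreover have "hbound (2 * (n - 1)) (j - 1) d = Suc N choose d"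
        unfolding hbound_def M using True d by simp
      moreover have "Suc N choose e = (N choose e) + (if 1 \<le> e then N choose (e - 1) else 0)" by (cases e) auto
      ultimately show ?thesis by (simp add: e)
    next
      case False
      then have j3: "3 \<le> j" using j by simp
      have "j - 1 \<noteq> 1" using j3 by simp
      then have "hbound (2 * (n - 1)) (j - 1) d = (N choose d) + (if j - 1 \<le> d then N choose (d - (j - 1)) else 0)"
        unfolding hbound_def N using d by simp
      moreover have "hbound (2 * n) (Suc j) (Suc d) = (N choose Suc d) + (if j \<le> d then N choose (d - j) else 0)"
        unfolding hbound_def N using j3 by simp
      moreover have "hbound (2 * n) j (Suc d) = (Suc N choose Suc d) + (if j \<le> Suc d then Suc N choose (Suc d - j) else 0)"
        unfolding hbound_def N using j3 by simp
      moreover have "(if j \<le> Suc d then Suc N choose (Suc d - j) else 0) =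
         (if j - 1 \<le> d then N choose (d - (j - 1)) else 0) + (if j \<le> d then N choose (d - j) else 0)"
      proof (cases "j \<le> d")
        case True
        then have "Suc d - j = Suc (d - j)" "d - (j - 1) = Suc (d - j)" using j3 by auto
        moreover have "j - 1 \<le> d" using True by simp
        ultimately show ?thesis using True by simp
      next
        case False
        then have "Suc d - j = 0" "d - (j - 1) = 0" using j3 by auto
        then show ?thesis using False j3 by auto
      qed
      ultimately show ?thesis by simp
    qed
  qed
qed

text \<open>The step from the line of one basis vector to a plane requires two new isotropic
  vectors, hence the factor two; the identity is Pascal's rule twice.\<close>

lemma hbound_start:
  assumes n: "0 < n"
  shows "2 * hbound (2 * (n - 1)) 1 d + hbound (2 * n) 2 (Suc d) = hbound (2 * n) 1 (Suc d)"
proof -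
  define N where "N = 2 * (n - 1)"
  have N: "2 * n = Suc (Suc N)" using n by (simp add: N_def)
  show ?thesis unfolding N_def[symmetric] hbound_def N by (cases d) auto
qed

text \<open>The price of one new star vector \<open>v\<close>: generators of its residue relative to
  the same \<open>Y\<close>, lifted by cones.\<close>

lemma hgen_cone:
  assumes A: "subspace A" and vw: "hpair A v w" and Y: "subspace Y" and g: "hgen (perp A {v, w}) Y d b"
  obtains S where "finite S" "card S \<le> b" "S \<subseteq> ti A (Suc d)"
    "\<And>X. hclosed A (Suc d) X \<Longrightarrow> S \<subseteq> X \<Longrightarrow> (\<And>K. K \<in> ti A (Suc d) \<Longrightarrow> K \<inter> Y \<noteq> {0} \<Longrightarrow> K \<in> X) \<Longrightarrow> v \<in> star A (Suc d) X"
proof -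
  let ?W = "perp A {v, w}" and ?c = "\<lambda>K. span (insert v K)"
  obtain S where S: "finite S" "card S \<le> b" "S \<subseteq> ti ?W d"
    "\<And>X. hclosed ?W d X \<Longrightarrow> S \<subseteq> X \<Longrightarrow> (\<forall>K\<in>ti ?W d. K \<inter> Y \<noteq> {0} \<longrightarrow> K \<in> X) \<Longrightarrow> ti ?W d \<subseteq> X"
    using g unfolding hgen_def by metis
  show ?thesis
  proof (rule that[of "?c ` S"])
    show "finite (?c ` S)" "card (?c ` S) \<le> b" using S(1,2) card_image_le[OF S(1), of ?c] by auto
    show "?c ` S \<subseteq> ti A (Suc d)" using S(3) ti_cone(1)[OF A vw] by blast
    fix X assume X: "hclosed A (Suc d) X" "?c ` S \<subseteq> X" and meet: "\<And>K. K \<in> ti A (Suc d) \<Longrightarrow> K \<inter> Y \<noteq> {0} \<Longrightarrow> K \<in> X"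
    have "ti ?W d \<subseteq> {K. ?c K \<in> X}"
    proof (rule S(4)[OF hclosed_residue[OF A vw X(1)]])
      show "S \<subseteq> {K. ?c K \<in> X}" using X(2) by blast
      show "\<forall>K\<in>ti ?W d. K \<inter> Y \<noteq> {0} \<longrightarrow> K \<in> {K. ?c K \<in> X}"
      proof (intro ballI impI CollectI)
        fix K assume K: "K \<in> ti ?W d" "K \<inter> Y \<noteq> {0}"
        have "0 \<in> K \<inter> Y" using subspace_0[OF ti_subspace[OF K(1)]] subspace_0[OF Y] by simp
        moreover have "K \<subseteq> ?c K" by (auto intro: span_base)
        ultimately have "?c K \<inter> Y \<noteq> {0}" using K(2) by blast
        then show "?c K \<in> X" using meet ti_cone(1)[OF A vw K(1)] by blast
      qed
    qed
    then show "v \<in> star A (Suc d) X"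
      unfolding star_def using ti_residue[OF vw] by blast
  qed
qed

lemma alt_anisotropic_line:
  assumes "alt L" "x \<in> span (set (take 1 L))" "h x x = 0" shows "x = 0"
proof (cases L)
  case (Cons a L')
  then obtain t where t: "x = t *s a" using assms(2) by (auto simp: span_singleton)
  have "h a a = 1" using alt_norm[OF assms(1), of 0] Cons by simp
  then have "t * \<sigma> t = 0" using assms(3) unfolding t by (simp add: h_simps)
  then show ?thesis unfolding t by simp
qed (use assms in simp)

text \<open>Relative to the line of the first basis vector nothing is given for free, so relative
  generation is generation outright.\<close>

lemma alt_anisotropic_meet:
  assumes L: "alt L" and K: "K \<in> ti A k"
  shows "K \<inter> span (set (take 1 L)) = {0}"
proof
  show "K \<inter> span (set (take 1 L)) \<subseteq> {0}"
  proof
    fix x assume "x \<in> K \<inter> span (set (take 1 L))"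
    then show "x \<in> {0}" using alt_anisotropic_line[OF L, of x] ti_h[OF K, of x x] by blast
  qed
  show "{0} \<subseteq> K \<inter> span (set (take 1 L))"
    using subspace_0[OF ti_subspace[OF K]] span_zero by simp
qed

lemma star_meets:
  assumes star: "\<And>x. x \<in> Y \<Longrightarrow> h x x = 0 \<Longrightarrow> x \<noteq> 0 \<Longrightarrow> x \<in> star A k X" and Y: "subspace Y"
    and K: "K \<in> ti A k" "K \<inter> Y \<noteq> {0}"
  shows "K \<in> X"
proof -
  have "0 \<in> K \<inter> Y" using subspace_0[OF ti_subspace[OF K(1)]] subspace_0[OF Y] by simp
  then obtain x where "x \<in> K" "x \<in> Y" "x \<noteq> 0" using K(2) by auto
  then show ?thesis using star ti_h[OF K(1)] K(1) unfolding star_def by blast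
qed

text \<open>The outer induction on the degree handles residues, the inner one descends from
  \<open>Y = A\<close>. For \<open>k = 0\<close> the position \<open>j\<close> is left free, because
  the list of a residue may be empty.\<close>

lemma hgen_alt:
  assumes fixed: "\<sigma> f = f" "f \<noteq> 0" "f \<noteq> 1" and L: "alt L" and k: "2 * k \<le> length L"
    and j: "k = 0 \<or> (1 \<le> j \<and> j \<le> length L)"
  shows "hgen (span (set L)) (span (set (take j L))) k (hbound (length L) j k)"
  using L k j
proof (induction k arbitrary: L j)
  case 0
  show ?case unfolding hgen_def hbound_def
    by (rule exI[of _ "{{0}}"]) (simp add: ti_0)
next
  case (Suc d)
  note IH = Suc.IH
  define n where "n = length L div 2"
  have len: "length L = 2 * n" using alt_length[OF Suc.prems(1)] by (simp add: n_def)
  have n: "0 < n" "d \<le> n - 1" using Suc.prems(2) len by auto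
  note L = Suc.prems(1)
  let ?A = "span (set L)"
  have mem: "L ! i \<in> ?A" if "i < length L" for i using that by (simp add: span_base)
  have memt: "L ! i \<in> span (set (take l L))" if "i < l" "l \<le> length L" for i l
  proof -
    have "take l L ! i \<in> set (take l L)" using that by (intro nth_mem) simp
    then show ?thesis using that by (simp add: span_base)
  qed
  have sub: "span (set (take l L)) \<subseteq> ?A" for l by (intro span_mono) (rule set_take_subset)
  have large: "hgen ?A (span (set (take l L))) (Suc d) (hbound (2 * n) l (Suc d))" if "2 \<le> l" "l \<le> 2 * n" for l
    using that
  proof (induction "2 * n - l" arbitrary: l)
    case 0
    then have l: "take l L = L" using len by simp
    have "K \<inter> ?A \<noteq> {0}" if K: "K \<in> ti ?A (Suc d)" for K
    proof
      assume "K \<inter> ?A = {0}"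
      then have "K \<subseteq> {0}" using ti_sub[OF K] by blast
      then have "dim K = 0" by simp
      then show False using ti_dim[OF K] by simp
    qed
    then show ?case unfolding hgen_def l by (intro exI[of _ "{}"]) auto
  next
    case (Suc i)
    then have l: "2 \<le> l" "l < 2 * n" by auto
    let ?Y = "span (set (take l L))"
    \<comment> \<open>Neighbouring basis vectors have opposite norms, so their sum is isotropic; in
      its residue \<open>Y\<close> shrinks to the span of the first \<open>l - 1\<close>
      vectors.\<close>
    define v L' where "v = L ! (l - 1) + 1 *s L ! l" and "L' = take (l - 1) L @ drop (Suc l) L"
    have sl: "Suc (l - 1) = l" "Suc (Suc (l - 1)) = Suc l" using l by auto
    note rem = alt_remove[OF L, of "l - 1", unfolded sl, folded L'_def]
    have lL: "l < length L" using l len by simp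
    obtain w where w: "hpair ?A v w" "perp ?A {v, w} = perp ?A {L ! (l - 1), L ! l}"
    proof (rule alt_hpair[OF L, of "l - 1" 1 ?A ?A, unfolded sl, folded v_def])
      show "l < length L" by (rule lL)
      show "L ! (l - 1) \<in> ?A" "L ! l \<in> ?A" using lL mem by simp_all
    qed (use that in auto)
    have W: "perp ?A {v, w} = span (set L')" unfolding w(2) using rem(3)[OF lL] by simp
    have tk: "take (l - 1) L' = take (l - 1) L" unfolding L'_def using lL by simp
    have len': "length L' = 2 * (n - 1)" using rem(2)[OF lL] len by simp
    have "hgen (span (set L')) (span (set (take (l - 1) L'))) d (hbound (length L') (l - 1) d)"
    proof (rule IH[OF rem(1)[OF lL]])
      show "2 * d \<le> length L'" using len' n by simp
      have "1 \<le> l - 1" "l - 1 \<le> length L'" using len' l n by linarith+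
      then show "d = 0 \<or> (1 \<le> l - 1 \<and> l - 1 \<le> length L')" by blast
    qed
    then have "hgen (perp ?A {v, w}) (span (set (take (l - 1) L))) d (hbound (2 * (n - 1)) (l - 1) d)"
      unfolding W tk len' .
    from hgen_cone[OF subspace_span w(1) subspace_span this]
    obtain S1 where S1: "finite S1" "card S1 \<le> hbound (2 * (n - 1)) (l - 1) d" "S1 \<subseteq> ti ?A (Suc d)"
      "\<And>X. hclosed ?A (Suc d) X \<Longrightarrow> S1 \<subseteq> X \<Longrightarrow>
        (\<And>K. K \<in> ti ?A (Suc d) \<Longrightarrow> K \<inter> span (set (take (l - 1) L)) \<noteq> {0} \<Longrightarrow> K \<in> X) \<Longrightarrow> v \<in> star ?A (Suc d) X"
      by metis
    have "hgen ?A (span (set (take (Suc l) L))) (Suc d) (hbound (2 * n) (Suc l) (Suc d))"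
      using Suc.hyps(1)[of "Suc l"] Suc.hyps(2) l by simp
    then obtain S2 where S2: "finite S2" "card S2 \<le> hbound (2 * n) (Suc l) (Suc d)" "S2 \<subseteq> ti ?A (Suc d)"
      "\<And>X. hclosed ?A (Suc d) X \<Longrightarrow> S2 \<subseteq> X \<Longrightarrow>
        (\<forall>K\<in>ti ?A (Suc d). K \<inter> span (set (take (Suc l) L)) \<noteq> {0} \<longrightarrow> K \<in> X) \<Longrightarrow> ti ?A (Suc d) \<subseteq> X"
      unfolding hgen_def by metis
    have Y': "span (set (take (Suc l) L)) = span (insert (L ! l) ?Y)"
      unfolding span_insert_span take_Suc_conv_app_nth[OF lL] by simp
    have "card (S1 \<union> S2) \<le> hbound (2 * n) l (Suc d)"
      using card_Un_le[of S1 S2] S1(2) S2(2) hbound_step[OF l n(1), of d] by linarith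
    moreover have "ti ?A (Suc d) \<subseteq> X"
      if X: "hclosed ?A (Suc d) X" "S1 \<union> S2 \<subseteq> X" and meet: "\<forall>K\<in>ti ?A (Suc d). K \<inter> ?Y \<noteq> {0} \<longrightarrow> K \<in> X" for X
    proof (rule S2(4)[OF X(1)])
      show "S2 \<subseteq> X" using X by blast
      have "span (set (take (l - 1) L)) \<subseteq> ?Y" by (intro span_mono set_take_subset_set_take) simp
      then have "K \<inter> ?Y \<noteq> {0}" if "K \<in> ti ?A (Suc d)" "K \<inter> span (set (take (l - 1) L)) \<noteq> {0}" for K
        using that subspace_0[OF ti_subspace[OF that(1)]] span_zero[of "set (take (l - 1) L)"] by blast
      then have v: "v \<in> star ?A (Suc d) X" using S1(4)[OF X(1)] X(2) meet by blast
      have Ystar: "x \<in> star ?A (Suc d) X" if "x \<in> ?Y" "x \<noteq> 0" for x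
        using meet that unfolding star_def by blast
      obtain w0 where pq: "hpair ?Y (L ! 0 + 1 *s L ! Suc 0) w0"
        by (rule alt_hpair[OF L, of 0 1 ?Y]) (use l len memt in auto)
      have norms: "h (L ! (l - 1)) (L ! (l - 1)) = (- 1) ^ (l - 1)" "h (L ! l) (L ! l) = - ((- 1) ^ (l - 1))"
        using alt_norm[OF L, of "l - 1"] alt_norm[OF L lL] lL sl by (simp, metis power_Suc mult_minus1)
      have orth: "L ! l \<in> perp ?A ?Y"
        unfolding perp_span
      proof (rule perpI)
        show "L ! l \<in> ?A" using mem lL by blast
        fix x assume "x \<in> set (take l L)"
        then obtain i where "i < l" "x = L ! i" by (auto simp: in_set_conv_nth)
        then show "h (L ! l) x = 0" using alt_orth[OF L lL, of i] lL by simp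
      qed
      have ext: "s \<in> star ?A (Suc d) X" if "s \<in> span (insert (L ! l) ?Y)" "h s s = 0" "s \<noteq> 0" for s
        using star_extend[OF subspace_span X(1) subspace_span sub pq fixed Ystar orth norms(2) _ memt norms(1) _ that]
          v lL l unfolding v_def by simp
      show "\<forall>K\<in>ti ?A (Suc d). K \<inter> span (set (take (Suc l) L)) \<noteq> {0} \<longrightarrow> K \<in> X"
        unfolding Y' using star_meets[OF ext subspace_span] by blast
    qed
    ultimately show ?case unfolding hgen_def using S1 S2 by (intro exI[of _ "S1 \<union> S2"]) auto
  qed
  show ?case
  proof (cases "j = 1")
    case False
    then show ?thesis using large[of j] Suc.prems(3) len by auto
  next
    case True
    have two: "Suc 0 < length L" using len n by simp
    \<comment> \<open>A line \<open>Y\<close> contains no hyperbolic pair, so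
      \<open>star_extend\<close> cannot be applied. The star vectors \<open>v1\<close> and
      \<open>v2\<close> span the plane of the first two basis vectors, and a single hyperbolic line
      covers its isotropic vectors.\<close>
    obtain \<omega> where \<omega>: "\<omega> * \<sigma> \<omega> = 1" "\<omega> \<noteq> 1" using exists_norm_one by blast
    define a b v1 v2 L' where "a = L ! 0" and "b = L ! Suc 0" and "v1 = a + 1 *s b" and "v2 = a + \<omega> *s b" and "L' = drop 2 L"
    have L'': "take 0 L @ drop (Suc (Suc 0)) L = L'" unfolding L'_def by (simp add: numeral_2_eq_2)
    note rem = alt_remove[OF L two, unfolded L'']
    have len': "length L' = 2 * (n - 1)" using rem(2) len by simp
    have abA: "a \<in> ?A" "b \<in> ?A" unfolding a_def b_def using mem[OF Suc_lessD[OF two]] mem[OF two] .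
    have "hgen (span (set L')) (span (set (take 1 L'))) d (hbound (length L') 1 d)"
    proof (rule IH[OF rem(1)])
      show "2 * d \<le> length L'" using len' n by simp
      show "d = 0 \<or> (1 \<le> (1::nat) \<and> 1 \<le> length L')" using len' n by linarith
    qed
    then have g: "hgen (perp ?A {a, b}) (span (set (take 1 L'))) d (hbound (2 * (n - 1)) 1 d)"
      unfolding rem(3) len' a_def b_def .
    have cone: "\<exists>S. finite S \<and> card S \<le> hbound (2 * (n - 1)) 1 d \<and> S \<subseteq> ti ?A (Suc d) \<and>
       (\<forall>X. hclosed ?A (Suc d) X \<longrightarrow> S \<subseteq> X \<longrightarrow> v \<in> star ?A (Suc d) X)"
      if v: "v = a + \<zeta> *s b" "\<zeta> * \<sigma> \<zeta> = 1" for v \<zeta>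
    proof -
      obtain w where w: "hpair ?A v w" "perp ?A {v, w} = perp ?A {a, b}"
        using alt_hpair[OF L two v(2) subspace_span, of "set L" ?A] abA unfolding v a_def b_def by blast
      from hgen_cone[OF subspace_span w(1) subspace_span g[folded w(2)]]
      obtain S where S: "finite S" "card S \<le> hbound (2 * (n - 1)) 1 d" "S \<subseteq> ti ?A (Suc d)"
        "\<And>X. hclosed ?A (Suc d) X \<Longrightarrow> S \<subseteq> X \<Longrightarrow>
         (\<And>K. K \<in> ti ?A (Suc d) \<Longrightarrow> K \<inter> span (set (take 1 L')) \<noteq> {0} \<Longrightarrow> K \<in> X) \<Longrightarrow> v \<in> star ?A (Suc d) X"
        by metis
      have "v \<in> star ?A (Suc d) X" if "hclosed ?A (Suc d) X" "S \<subseteq> X" for X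
        using S(4)[OF that] alt_anisotropic_meet[OF rem(1)] by metis
      then show ?thesis using S(1-3) by blast
    qed
    obtain S1 where S1: "finite S1" "card S1 \<le> hbound (2 * (n - 1)) 1 d" "S1 \<subseteq> ti ?A (Suc d)"
       "\<And>X. hclosed ?A (Suc d) X \<Longrightarrow> S1 \<subseteq> X \<Longrightarrow> v1 \<in> star ?A (Suc d) X"
      using cone[of v1 1] v1_def by auto
    obtain S2 where S2: "finite S2" "card S2 \<le> hbound (2 * (n - 1)) 1 d" "S2 \<subseteq> ti ?A (Suc d)"
       "\<And>X. hclosed ?A (Suc d) X \<Longrightarrow> S2 \<subseteq> X \<Longrightarrow> v2 \<in> star ?A (Suc d) X"
      using cone[of v2 \<omega>] v2_def \<omega> by auto
    let ?Y = "span (set (take 2 L))"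
    obtain S3 where S3: "finite S3" "card S3 \<le> hbound (2 * n) 2 (Suc d)" "S3 \<subseteq> ti ?A (Suc d)"
      "\<And>X. hclosed ?A (Suc d) X \<Longrightarrow> S3 \<subseteq> X \<Longrightarrow> (\<forall>K\<in>ti ?A (Suc d). K \<inter> ?Y \<noteq> {0} \<longrightarrow> K \<in> X) \<Longrightarrow> ti ?A (Suc d) \<subseteq> X"
      using large[of 2] n unfolding hgen_def by auto
    have hab: "h a a = 1" "h b b = - 1" "h a b = 0" "h b a = 0"
      unfolding a_def b_def using alt_norm[OF L Suc_lessD[OF two]] alt_norm[OF L two]
        alt_orth[OF L Suc_lessD[OF two] two] alt_orth[OF L two Suc_lessD[OF two]] by simp_all
    have hv: "h v1 v1 = 0" "h v2 v2 = 0" "h v1 v2 \<noteq> 0"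
    proof -
      have "\<sigma> \<omega> \<noteq> 1" "\<sigma> \<omega> * \<omega> = 1" using \<omega> \<sigma>_eq_iff[of \<omega> 1] by (simp_all add: mult.commute)
      then show "h v1 v1 = 0" "h v2 v2 = 0" "h v1 v2 \<noteq> 0"
        unfolding v1_def v2_def using hab \<omega> by (simp_all add: h_simps)
    qed
    have "set (take 2 L) = {a, b}"
    proof -
      have "L = a # b # L'" unfolding a_def b_def L''[symmetric] using two
        by (metis Cons_nth_drop_Suc Suc_lessD append_Nil drop0 take0)
      then show ?thesis by (metis (no_types, lifting) empty_set list.simps(15) numeral_2_eq_2 take0 take_Suc_Cons)
    qed
    then have Yab: "?Y = span {a, b}" by simp
    have Yv: "?Y \<subseteq> span {v1, v2}"
    proof -
      have m: "v1 \<in> span {v1, v2}" "v2 \<in> span {v1, v2}" by (auto intro: span_base)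
      have "(\<omega> - 1) *s b = v2 - v1" unfolding v1_def v2_def by (simp add: algebra_simps)
      then have "b = inverse (\<omega> - 1) *s (v2 - v1)" using \<omega>(2) by (metis eq_iff_diff_eq_0 left_inverse scale_one scale_scale)
      then have b: "b \<in> span {v1, v2}" using m by (metis span_diff span_scale)
      have "a = v1 - b" unfolding v1_def by simp
      then have "a \<in> span {v1, v2}" using b m by (metis span_diff)
      then show ?thesis unfolding Yab using b by (intro span_minimal) auto
    qed
    have "card (S1 \<union> S2 \<union> S3) \<le> hbound (2 * n) 1 (Suc d)"
      using card_Un_le[of "S1 \<union> S2" S3] card_Un_le[of S1 S2] S1(2) S2(2) S3(2) hbound_start[OF n(1), of d] by linarith
    moreover have "ti ?A (Suc d) \<subseteq> X" if X: "hclosed ?A (Suc d) X" "S1 \<union> S2 \<union> S3 \<subseteq> X" for X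
    proof (rule S3(4)[OF X(1)])
      show "S3 \<subseteq> X" using X by blast
      have v12: "v1 \<in> ?A" "v2 \<in> ?A" unfolding v1_def v2_def using abA by (simp_all add: span_add span_scale)
      have st: "v1 \<in> star ?A (Suc d) X" "v2 \<in> star ?A (Suc d) X" using S1(4)[OF X(1)] S2(4)[OF X(1)] X(2) by auto
      have ext: "s \<in> star ?A (Suc d) X" if "s \<in> ?Y" "h s s = 0" "s \<noteq> 0" for s
        using star_hyperbolic_line[OF subspace_span X(1) st v12 hv _ that(2,3)] that(1) Yv by blast
      show "\<forall>K\<in>ti ?A (Suc d). K \<inter> ?Y \<noteq> {0} \<longrightarrow> K \<in> X"
        using star_meets[OF ext subspace_span] by blast
    qed
    ultimately show ?thesis unfolding hgen_def len True using S1 S2 S3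
      by (intro exI[of _ "S1 \<union> S2 \<union> S3"]) auto
  qed
qed

lemma gen_top:
  assumes fixed: "\<sigma> f = f" "f \<noteq> 0" "f \<noteq> 1" and A: "hyp A m" and m: "0 < m"
  shows "gen A m m ((2 * m) choose m)"
proof -
  obtain L where L: "alt L" "length L = 2 * m" "span (set L) = A" using hyp_alt[OF A] by blast
  let ?Y = "span (set (take 1 L))"
  have "hgen A ?Y m (hbound (2 * m) 1 m)" using hgen_alt[OF fixed L(1), of m 1] L(2,3) m by simp
  then obtain S where S: "finite S" "card S \<le> (2 * m) choose m" "S \<subseteq> ti A m"
     "\<And>X. hclosed A m X \<Longrightarrow> S \<subseteq> X \<Longrightarrow> (\<forall>K\<in>ti A m. K \<inter> ?Y \<noteq> {0} \<longrightarrow> K \<in> X) \<Longrightarrow> ti A m \<subseteq> X"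
    unfolding hgen_def hbound_def using m by auto
  have "K \<inter> ?Y = {0}" if "K \<in> ti A m" for K
    using alt_anisotropic_meet[OF L(1) that] .
  moreover have "hclosed A m X" if X: "pclosed A m m X" for X
    unfolding hclosed_def
  proof (intro allI impI, elim conjE)
    fix d M x y z
    assume m: "m = Suc d" and M: "M \<in> ti A d" and x: "x \<in> perp A M" "h x x = 0" and y: "y \<in> perp A M" "h y y = 0"
      and z: "z \<in> span {x, y}" "h z z = 0" "z \<noteq> 0" and xy: "h x y \<noteq> 0"
      and KX: "span (insert x M) \<in> X" "span (insert y M) \<in> X"
    note sA = hyp_subspace[OF A]
    have "x \<notin> M" "y \<notin> M" using perpD2[OF y(1), of x] perpD2[OF x(1), of y] xy h_eq_0_sym by blast+
    then have K: "span (insert x M) \<in> ti A m" "span (insert y M) \<in> ti A m"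
      using ti_insert[OF sA M] x y m by simp_all
    have "x \<in> span (insert x M)" "y \<in> span (insert y M)" by (simp_all add: span_base)
    then have ne: "span (insert x M) \<noteq> span (insert y M)" using ti_h[OF K(1)] xy by metis
    have "span {x, y} \<subseteq> perp A M" using x y by (intro span_minimal) (auto simp: subspace_perp sA)
    then have zp: "z \<in> perp A M" using z by blast
    obtain a b where z': "z = a *s x + b *s y" using span_pair[OF z(1)] .
    have "z \<notin> M"
    proof
      assume "z \<in> M"
      then have "h x z = 0" "h y z = 0" using x y perpD2 by blast+
      moreover have "h x z = \<sigma> b * h x y" "h y z = \<sigma> a * h y x" unfolding z' using x y by (simp_all add: h_simps)
      ultimately have "a = 0" "b = 0" using xy h_eq_0_sym by auto
      then show False using z' z by simp
    qed
    then have Kz: "span (insert z M) \<in> ti A m" using ti_insert[OF sA M zp z(2)] m by simp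
    have sup: "M \<subseteq> span (insert v M)" for v by (auto intro: span_base)
    show "span (insert z M) \<in> X"
      using X M K KX Kz ne sup m unfolding pclosed_def by (metis IntI diff_Suc_1 less_irrefl)
  qed
  ultimately show ?thesis unfolding gen_def using S by (intro exI[of _ S]) auto
qed

section \<open>Alternating forms vanishing on totally isotropic subspaces\<close>

text \<open>Linearity and alternation are demanded at the front of the list only; further inside
  they are inherited by fixing the first argument, which suits induction on lists.\<close>

primrec altform :: "nat \<Rightarrow> ('v list \<Rightarrow> 'f) \<Rightarrow> bool" where
  "altform 0 = (\<lambda>D. True)"
| "altform (Suc k) = (\<lambda>D. (\<forall>v. altform k (\<lambda>vs. D (v # vs))) \<and>
     (\<forall>a u w vs. length vs = k \<longrightarrow> D ((a *s u + w) # vs) = a * D (u # vs) + D (w # vs)) \<and>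
     (\<forall>v vs. Suc (length vs) = k \<longrightarrow> D (v # v # vs) = 0))"

lemma altform_Cons: "altform (Suc k) D \<Longrightarrow> altform k (\<lambda>vs. D (v # vs))"
  and altform_linear: "altform (Suc k) D \<Longrightarrow> length vs = k \<Longrightarrow> D ((a *s u + w) # vs) = a * D (u # vs) + D (w # vs)"
  and altform_repeat: "altform (Suc k) D \<Longrightarrow> Suc (length vs) = k \<Longrightarrow> D (v # v # vs) = 0"
  by simp_all

lemma altform_add:
  assumes "altform (Suc k) D" "length vs = k" shows "D ((u + w) # vs) = D (u # vs) + D (w # vs)"
  using altform_linear[OF assms, of 1 u w] by simp

lemma altform_zero:
  assumes "altform (Suc k) D" "length vs = k" shows "D (0 # vs) = 0"
  using altform_linear[OF assms, of "- 1" 0 0] by simp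

lemma altform_swap:
  assumes D: "altform (Suc (Suc k)) D" and vs: "length vs = k"
  shows "D (u # v # vs) = - D (v # u # vs)"
proof -
  have l: "length (x # vs) = Suc k" for x using vs by simp
  have add2: "D (x # (u + v) # vs) = D (x # u # vs) + D (x # v # vs)" for x
    using altform_add[OF altform_Cons[OF D, of x] vs, of u v] by simp
  have rep: "D (x # x # vs) = 0" for x using altform_repeat[OF D, of vs x] vs by simp
  have "D ((u + v) # (u + v) # vs) = D (u # v # vs) + D (v # u # vs)"
    unfolding altform_add[OF D l] add2 by (simp add: rep)
  then show ?thesis using rep by (metis eq_neg_iff_add_eq_0)
qed

text \<open>Moving an argument changes the value by a sign. Recording only whether the value is zero
  avoids signs of permutations.\<close>

lemma altform_front:
  assumes "altform k D" "length xs + Suc (length ys) = k"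
  shows "D (xs @ v # ys) = 0 \<longleftrightarrow> D (v # xs @ ys) = 0"
  using assms
proof (induction xs arbitrary: k D)
  case (Cons x xs)
  then obtain k' where k: "k = Suc (Suc k')" by (cases k; cases "k - 1") auto
  have "D (x # xs @ v # ys) = 0 \<longleftrightarrow> D (x # v # xs @ ys) = 0"
    using Cons.IH[OF altform_Cons[OF Cons.prems(1)[unfolded k], of x]] Cons.prems(2) k by simp
  also have "\<dots> \<longleftrightarrow> D (v # x # xs @ ys) = 0"
    using altform_swap[OF Cons.prems(1)[unfolded k], of "xs @ ys" x v] Cons.prems(2) k by simp
  finally show ?case by simp
qed simp

lemma altform_zero_mset:
  assumes "altform k D" "length vs = k" "mset vs = mset ws" "D vs = 0"
  shows "D ws = 0"
  using assms
proof (induction vs arbitrary: k D ws)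
  case (Cons v vs)
  then obtain k' where k: "k = Suc k'" "length vs = k'" by (cases k) auto
  have "v \<in> set ws" using Cons.prems(3) by (metis list.set_intros(1) set_mset_mset)
  then obtain xs ys where ws: "ws = xs @ v # ys" by (metis split_list)
  have "mset vs = mset (xs @ ys)" using Cons.prems(3) ws by simp
  then have "D (v # xs @ ys) = 0"
    using Cons.IH[OF altform_Cons[OF Cons.prems(1)[unfolded k(1)], of v] k(2)] Cons.prems(4) by blast
  moreover have "length xs + Suc (length ys) = k" using Cons.prems(2,3) ws by (metis length_Cons length_append size_mset)
  ultimately show ?case using altform_front[OF Cons.prems(1)] ws by simp
qed simp

lemma altform_not_distinct:
  assumes D: "altform k D" "length vs = k" and nd: "\<not> distinct vs"
  shows "D vs = 0"
proof -
  obtain xs ys zs y where vs: "vs = xs @ [y] @ ys @ [y] @ zs" using not_distinct_decomp[OF nd] by blast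
  let ?ws = "y # y # xs @ ys @ zs"
  obtain k' where k: "k = Suc k'" "Suc (length (xs @ ys @ zs)) = k'" using D(2) vs by auto
  have "D ?ws = 0" using altform_repeat[OF D(1)[unfolded k(1)] k(2)] .
  moreover have "mset ?ws = mset vs" "length ?ws = k" using vs k by auto
  ultimately show ?thesis using altform_zero_mset[OF D(1)] by blast
qed

lemma altform_vanish_span:
  assumes "altform k D" "\<And>vs. length vs = k \<Longrightarrow> set vs \<subseteq> B \<Longrightarrow> D vs = 0" "length vs = k" "set vs \<subseteq> span B"
  shows "D vs = 0"
  using assms
proof (induction k arbitrary: D vs)
  case (Suc k)
  obtain v ws where vs: "vs = v # ws" "length ws = k" using Suc.prems(3) by (cases vs) auto
  have B: "D (b # ws) = 0" if "b \<in> B" for b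
    by (rule Suc.IH[OF altform_Cons[OF Suc.prems(1), of b]]) (use Suc.prems vs that in auto)
  have "v \<in> span B" using Suc.prems(4) vs by simp
  then have "D (v # ws) = 0"
  proof (induction rule: span_induct_alt)
    case base
    then show ?case by (rule altform_zero[OF Suc.prems(1) vs(2)])
  next
    case (step c x y)
    then show ?case using altform_linear[OF Suc.prems(1) vs(2)] B by simp
  qed
  then show ?case using vs by simp
qed simp

text \<open>A \<open>k\<close>-tuple from \<open>bs\<close> repeats an entry or rearranges
  \<open>bs\<close>. Thus annihilating a \<open>k\<close>-space is a single equation.\<close>

lemma altform_vanish_basis:
  assumes D: "altform k D" and bs: "length bs = k" "D bs = 0" and vs: "length vs = k" "set vs \<subseteq> span (set bs)"
  shows "D vs = 0"
proof (rule altform_vanish_span[OF D _ vs])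
  fix ws assume ws: "length ws = k" "set ws \<subseteq> set bs"
  show "D ws = 0"
  proof (cases "distinct ws")
    case True
    then have "card (set ws) = k" using ws distinct_card by blast
    moreover have "card (set bs) \<le> k" using bs(1) card_length by metis
    moreover have "card (set ws) \<le> card (set bs)" using card_mono[OF _ ws(2)] by simp
    ultimately have "set ws = set bs" "distinct bs"
      using ws(2) bs(1) card_subset_eq[OF _ ws(2)] card_distinct[of bs] by simp_all
    then have "mset bs = mset ws" using True set_eq_iff_mset_eq_distinct by blast
    then show ?thesis using altform_zero_mset[OF D bs(1) _ bs(2)] by blast
  next
    case False
    then show ?thesis using altform_not_distinct[OF D ws(1)] by blast
  qed
qed

text \<open>A \<open>k\<close>-tuple of basis vectors leaves out some basis vector \<open>b\<close> whose norm is opposite to that of one of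
  its members \<open>a\<close>; then \<open>a + \<omega> b\<close> is isotropic for all \<open>\<omega>\<close> of norm one, and two values of \<open>\<omega>\<close> separate \<open>a\<close> from \<open>b\<close>.\<close>

lemma altform_vanish_isotropic:
  assumes "altform k D" and "finite P" "finite N" "card P = n" "card N = n" "k \<le> n"
    and "\<And>a b. a \<in> P \<union> N \<Longrightarrow> b \<in> P \<union> N \<Longrightarrow> a \<noteq> b \<Longrightarrow> h a b = 0"
    and "\<And>a. a \<in> P \<Longrightarrow> h a a = 1" "\<And>a. a \<in> N \<Longrightarrow> h a a = - 1"
    and "P \<inter> N = {}"
    and "\<And>vs. length vs = k \<Longrightarrow> set vs \<subseteq> span (P \<union> N) \<Longrightarrow> (\<forall>u\<in>set vs. \<forall>v\<in>set vs. h u v = 0) \<Longrightarrow> D vs = 0"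
    and "length vs = k" "set vs \<subseteq> P \<union> N"
  shows "D vs = 0"
  using assms
proof (induction k arbitrary: D P N n vs)
  case 0
  then show ?case by simp
next
  case (Suc k)
  note D = Suc.prems(1) and fin = Suc.prems(2,3) and cards = Suc.prems(4,5) and kn = Suc.prems(6)
    and orth = Suc.prems(7) and norm = Suc.prems(8,9) and disj = Suc.prems(10) and iso = Suc.prems(11)
    and vs = Suc.prems(12,13)
  show ?case
  proof (cases "distinct vs")
    case False
    then show ?thesis using altform_not_distinct[OF D vs(1)] by blast
  next
    case dist: True
    have cvs: "card (set vs) = Suc k" using dist vs(1) distinct_card by metis
    \<comment> \<open>The tuple has at most \<open>n\<close> entries, so it cannot contain all of
      \<open>N\<close> together with a vector of \<open>P\<close>.\<close>
    obtain a b where ab: "a \<in> set vs" "b \<notin> set vs" "(a \<in> P \<and> b \<in> N) \<or> (a \<in> N \<and> b \<in> P)"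
    proof (cases "set vs \<inter> P = {}")
      case True
      obtain a where "a \<in> set vs" using vs(1) by (cases vs) auto
      moreover obtain b where "b \<in> P" using cards(1) kn by (metis card.empty equals0I not_less_eq_eq le0)
      ultimately show ?thesis using that True vs(2) by blast
    next
      case False
      then obtain a where a: "a \<in> set vs" "a \<in> P" by blast
      have "\<not> N \<subseteq> set vs"
      proof
        assume "N \<subseteq> set vs"
        then have "insert a N \<subseteq> set vs" using a by simp
        then have "card (insert a N) \<le> Suc k" using cvs card_mono[of "set vs" "insert a N"] by simp
        moreover have "a \<notin> N" using a disj by blast
        ultimately show False using fin cards kn by simp
      qed
      then show ?thesis using that a by blast
    qed
    obtain xs ys where split: "vs = xs @ a # ys" using ab(1) by (metis split_list)
    define rest where "rest = xs @ ys"
    have rest: "length rest = k" "set rest \<subseteq> (P \<union> N) - {a, b}"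
      using split vs ab(2) dist unfolding rest_def by auto
    have ab': "a \<in> P \<union> N" "b \<in> P \<union> N" "a \<noteq> b" using ab by auto
    let ?P = "P - {a, b}" and ?N = "N - {a, b}"
    have PN: "?P \<union> ?N = (P \<union> N) - {a, b}" by blast
    have hab: "h a b = 0" "h b a = 0" using orth ab' by auto
    \<comment> \<open>With first argument \<open>a + \<omega> b\<close>, the form satisfies the
      hypotheses again on the remaining basis vectors, which are orthogonal to \<open>a\<close> and
      \<open>b\<close>.\<close>
    have ind: "D (a # rest) + \<omega> * D (b # rest) = 0" if \<omega>: "\<omega> * \<sigma> \<omega> = 1" for \<omega>
    proof -
      let ?v = "\<omega> *s b + a"
      have "h ?v ?v = h a a + (\<omega> * \<sigma> \<omega>) * h b b" using hab by (simp add: h_simps)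
      then have vv: "h ?v ?v = 0" unfolding \<omega> using norm ab(3) by auto
      have "D (?v # rest) = 0"
      proof (rule Suc.IH[OF altform_Cons[OF D, of ?v], where P = ?P and N = ?N and n = "n - 1"])
        show "finite ?P" "finite ?N" using fin by auto
        obtain x y where xy: "x \<in> P" "y \<in> N" "?P = P - {x}" "?N = N - {y}"
          using ab(3)
        proof
          assume "a \<in> P \<and> b \<in> N"
          moreover from this have "a \<notin> N" "b \<notin> P" using disj by blast+
          ultimately show ?thesis using that[of a b] by blast
        next
          assume "a \<in> N \<and> b \<in> P"
          moreover from this have "a \<notin> P" "b \<notin> N" using disj by blast+
          ultimately show ?thesis using that[of b a] by blast
        qed
        show "card ?P = n - 1" unfolding xy(3) using card_Diff_singleton[OF xy(1)] cards(1) by simp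
        show "card ?N = n - 1" unfolding xy(4) using card_Diff_singleton[OF xy(2)] cards(2) by simp
        show "k \<le> n - 1" using kn by simp
        show "h x y = 0" if "x \<in> ?P \<union> ?N" "y \<in> ?P \<union> ?N" "x \<noteq> y" for x y using that orth by blast
        show "h x x = 1" if "x \<in> ?P" for x using that norm by blast
        show "h x x = - 1" if "x \<in> ?N" for x using that norm by blast
        show "?P \<inter> ?N = {}" using disj by blast
        show "length rest = k" "set rest \<subseteq> ?P \<union> ?N" using rest PN by auto
        fix us assume us: "length us = k" "set us \<subseteq> span (?P \<union> ?N)" "\<forall>u\<in>set us. \<forall>v\<in>set us. h u v = 0"
        have "?v \<in> span (P \<union> N)" using ab'(1,2) by (intro span_add span_scale span_base)
        moreover have "span (?P \<union> ?N) \<subseteq> span (P \<union> N)" by (intro span_mono) blast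
        ultimately have sv: "set (?v # us) \<subseteq> span (P \<union> N)" using us(2) by simp
        have vx: "h ?v x = 0" "h x ?v = 0" if "x \<in> set us" for x
        proof -
          have "x \<in> perp UNIV {a, b}"
          proof -
            have "?P \<union> ?N \<subseteq> perp UNIV {a, b}" using orth ab' by (auto simp: perp_def)
            then have "span (?P \<union> ?N) \<subseteq> perp UNIV {a, b}" by (rule span_minimal) (simp add: subspace_perp)
            then show ?thesis using us(2) that by blast
          qed
          then have "h x a = 0" "h x b = 0" by (auto simp: perp_def)
          then show "h x ?v = 0" by (simp add: h_simps)
          then show "h ?v x = 0" using h_eq_0_sym by blast
        qed
        have "\<forall>u\<in>set (?v # us). \<forall>w\<in>set (?v # us). h u w = 0"
          using us(3) vx vv by (metis set_ConsD)
        then show "D (?v # us) = 0" using iso[OF _ sv] us(1) by simp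
      qed
      then show ?thesis using altform_linear[OF D rest(1), of \<omega> b a] by (simp add: add.commute)
    qed
    obtain \<omega> where \<omega>: "\<omega> * \<sigma> \<omega> = 1" "\<omega> \<noteq> 1" using exists_norm_one by blast
    have e1: "D (a # rest) + D (b # rest) = 0" using ind[of 1] by simp
    have e2: "D (a # rest) + \<omega> * D (b # rest) = 0" using ind[OF \<omega>(1)] .
    have "(\<omega> - 1) * D (b # rest) = (D (a # rest) + \<omega> * D (b # rest)) - (D (a # rest) + D (b # rest))"
      by (simp add: algebra_simps)
    then have "D (b # rest) = 0" unfolding e1 e2 using \<omega>(2) by simp
    then have "D (a # rest) = 0" using e1 by simp
    then show ?thesis using altform_front[OF D, of xs ys a] split vs(1) unfolding rest_def by simp
  qed
qed

section \<open>Alternating forms with prescribed coefficients\<close>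

context
  fixes L :: "'v list" and N :: nat
begin

text \<open>The function \<open>c\<close> on index sets encodes an alternating form on the span of \<open>L\<close> with coefficients \<open>\<plusminus> c J\<close>, and
  \<open>contract\<close> is the interior product; only index sets inside \<open>{..<N}\<close> matter.\<close>

definition coord :: "nat \<Rightarrow> 'v \<Rightarrow> 'f" where
  "coord i v = (- 1) ^ i * h v (L ! i)"

definition contract :: "'v \<Rightarrow> (nat set \<Rightarrow> 'f) \<Rightarrow> nat set \<Rightarrow> 'f" where
  "contract v c J = (\<Sum>i\<in>{..<N} - J. (- 1) ^ card {j \<in> J. j < i} * coord i v * c (insert i J))"

primrec form :: "(nat set \<Rightarrow> 'f) \<Rightarrow> 'v list \<Rightarrow> 'f" where
  "form c [] = c {}"
| "form c (v # vs) = form (contract v c) vs"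

lemma coord_linear: "coord i (a *s u + w) = a * coord i u + coord i w"
  by (simp add: coord_def h_simps algebra_simps)

lemma contract_linear: "contract v (\<lambda>J. a * c J + d J) = (\<lambda>J. a * contract v c J + contract v d J)"
  unfolding contract_def by (simp add: sum.distrib[symmetric] sum_distrib_left algebra_simps)

lemma contract_linear_vector: "contract (a *s u + w) c = (\<lambda>J. a * contract u c J + contract w c J)"
  unfolding contract_def coord_linear by (simp add: sum.distrib[symmetric] sum_distrib_left algebra_simps)

lemma form_linear: "form (\<lambda>J. a * c J + d J) vs = a * form c vs + form d vs"
  by (induction vs arbitrary: c d) (simp_all add: contract_linear)

lemma form_zero: "form (\<lambda>J. 0) vs = 0"
  using form_linear[of "- 1" "\<lambda>J. 0" "\<lambda>J. 0" vs] by simp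

text \<open>The double sum cancels in pairs: removing the smaller index first raises the exponent
  belonging to the larger one by one, so exchanging the two indices changes the sign.\<close>

lemma contract_contract: "contract v (contract v c) = (\<lambda>J. 0)"
proof
  fix J
  let ?s = "\<lambda>J i. (- 1 :: 'f) ^ card {j \<in> J. j < i}"
  define I where "I = {..<N} - J"
  define t where "t i l = ?s J i * coord i v * (?s (insert i J) l * coord l v * c (insert l (insert i J)))" for i l
  have finI: "finite I" by (simp add: I_def)
  have anti: "t l i = - t i l" if "i < l" "i \<in> I" "l \<in> I" for i l
  proof -
    have "i \<notin> J" "l \<notin> J" using that by (auto simp: I_def)
    have 1: "{j \<in> insert l J. j < i} = {j \<in> J. j < i}" using that by auto
    have 2: "{j \<in> insert i J. j < l} = insert i {j \<in> J. j < l}" using that by auto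
    have "finite {j \<in> J. j < l}" by (rule finite_subset[of _ "{..<l}"]) auto
    then have "card {j \<in> insert i J. j < l} = Suc (card {j \<in> J. j < l})" unfolding 2 using \<open>i \<notin> J\<close> by simp
    then show ?thesis unfolding t_def 1 by (simp add: insert_commute algebra_simps)
  qed
  have "contract v (contract v c) J = (\<Sum>i\<in>I. \<Sum>l\<in>{..<N} - insert i J. t i l)"
    unfolding contract_def I_def t_def by (simp add: sum_distrib_left)
  also have "\<dots> = (\<Sum>i\<in>I. \<Sum>l\<in>I - {i}. t i l)"
    by (intro sum.cong refl arg_cong2[where f = sum]) (auto simp: I_def)
  also have "\<dots> = (\<Sum>i\<in>I. (\<Sum>l\<in>{l \<in> I. i < l}. t i l) + (\<Sum>l\<in>{l \<in> I. l < i}. t i l))"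
  proof (rule sum.cong[OF refl])
    fix i assume "i \<in> I"
    have "I - {i} = {l \<in> I. i < l} \<union> {l \<in> I. l < i}" by auto
    then show "(\<Sum>l\<in>I - {i}. t i l) = (\<Sum>l\<in>{l \<in> I. i < l}. t i l) + (\<Sum>l\<in>{l \<in> I. l < i}. t i l)"
      using finI by (simp only: \<open>I - {i} = _\<close>) (rule sum.union_disjoint; auto)
  qed
  also have "\<dots> = (\<Sum>i\<in>I. \<Sum>l\<in>{l \<in> I. i < l}. t i l) + (\<Sum>i\<in>I. \<Sum>l\<in>{l \<in> I. l < i}. t i l)"
    by (rule sum.distrib)
  also have "(\<Sum>i\<in>I. \<Sum>l\<in>{l \<in> I. l < i}. t i l) = (\<Sum>l\<in>I. \<Sum>i\<in>{i \<in> I. l < i}. t i l)"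
    using sum.swap_restrict[OF finI finI, of t "\<lambda>i l. l < i"] .
  also have "\<dots> = (\<Sum>l\<in>I. \<Sum>i\<in>{i \<in> I. l < i}. - t l i)"
    by (intro sum.cong refl anti) auto
  finally show "contract v (contract v c) J = 0" by (simp add: sum_negf)
qed

lemma altform_form: "altform k (form c)"
proof (induction k arbitrary: c)
  case (Suc k)
  show ?case
    using Suc by (simp add: contract_linear_vector form_linear contract_contract form_zero)
qed simp

text \<open>The sign in \<open>coord\<close> is the inverse of the norm, so the coordinates are dual
  to the basis and at most one term survives.\<close>

lemma contract_basis:
  assumes L: "alt L" "length L = N" and l: "l < N"
  shows "contract (L ! l) c J = (if l \<in> J then 0 else (- 1) ^ card {j \<in> J. j < l} * c (insert l J))"
proof -
  have co: "coord i (L ! l) = (if i = l then 1 else 0)" if "i < N" for i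
  proof -
    have "h (L ! l) (L ! i) = (if l = i then (- 1) ^ l else 0)" using L l that unfolding alt_def by blast
    then show ?thesis unfolding coord_def by (simp add: power_mult_distrib[symmetric])
  qed
  have "contract (L ! l) c J = (\<Sum>i\<in>{..<N} - J. if i = l then (- 1) ^ card {j \<in> J. j < l} * c (insert l J) else 0)"
    unfolding contract_def by (intro sum.cong) (auto simp: co)
  then show ?thesis using l by (simp add: sum.delta)
qed

lemma form_basis:
  assumes L: "alt L" "length L = N" and "distinct is" "set is \<subseteq> {..<N}"
  shows "form c (map ((!) L) is) = 0 \<longleftrightarrow> c (set is) = 0"
  using assms(3,4)
proof (induction "is" arbitrary: c)
  case (Cons l ls)
  then have "form c (map ((!) L) (l # ls)) = 0 \<longleftrightarrow> contract (L ! l) c (set ls) = 0" by simp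
  then show ?case using contract_basis[OF L, of l c "set ls"] Cons.prems by simp
qed simp

end

text \<open>More unknowns than equations. Two solutions of the remaining equations, the second zero
  at an index where the first is not, are independent, and some combination of them also satisfies
  \<open>g\<close>.\<close>

lemma nonzero_solution:
  fixes gs :: "(('i \<Rightarrow> 'f) \<Rightarrow> 'f) list"
  assumes "finite I" "length gs < card I"
    and "\<And>g a c d. g \<in> set gs \<Longrightarrow> g (\<lambda>J. a * c J + d J) = a * g c + g d"
  shows "\<exists>c. (\<exists>i\<in>I. c i \<noteq> 0) \<and> (\<forall>i. i \<notin> I \<longrightarrow> c i = 0) \<and> (\<forall>g\<in>set gs. g c = 0)"
  using assms
proof (induction gs arbitrary: I)
  case Nil
  then obtain i where "i \<in> I" by fastforce
  then show ?case by (intro exI[of _ "\<lambda>j. if j = i then 1 else 0"]) auto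
next
  case (Cons g gs)
  note lin = Cons.prems(3)
  have lin': "\<And>g' a c d. g' \<in> set gs \<Longrightarrow> g' (\<lambda>J. a * c J + d J) = a * g' c + g' d" using lin by simp
  have IH: "\<exists>c. (\<exists>i\<in>I - {i0}. c i \<noteq> 0) \<and> (\<forall>i. i \<notin> I - {i0} \<longrightarrow> c i = 0) \<and> (\<forall>g\<in>set gs. g c = 0)" if "i0 \<in> I" for i0
    using Cons.IH[OF _ _ lin', of "I - {i0}"] Cons.prems(1,2) that by simp
  obtain i0 where "i0 \<in> I" using Cons.prems(2) by fastforce
  then obtain c1 i1 where c1': "i1 \<in> I - {i0}" "c1 i1 \<noteq> 0" "\<forall>i. i \<notin> I - {i0} \<longrightarrow> c1 i = 0" "\<forall>g\<in>set gs. g c1 = 0"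
    using IH[OF \<open>i0 \<in> I\<close>] by blast
  have c1: "i1 \<in> I" "c1 i1 \<noteq> 0" "\<forall>i. i \<notin> I \<longrightarrow> c1 i = 0" "\<forall>g\<in>set gs. g c1 = 0"
    using c1' by simp_all
  obtain c2 i2 where c2': "i2 \<in> I - {i1}" "c2 i2 \<noteq> 0" "\<forall>i. i \<notin> I - {i1} \<longrightarrow> c2 i = 0" "\<forall>g\<in>set gs. g c2 = 0"
    using IH[OF c1(1)] by blast
  have c2: "i2 \<in> I" "c2 i2 \<noteq> 0" "c2 i1 = 0" "\<forall>i. i \<notin> I \<longrightarrow> c2 i = 0" "\<forall>g\<in>set gs. g c2 = 0"
    using c2' by simp_all
  show ?case
  proof (cases "g c1 = 0 \<or> g c2 = 0")
    case True
    then show ?thesis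
    proof
      assume "g c1 = 0"
      then show ?thesis using c1 by (intro exI[of _ c1]) auto
    next
      assume "g c2 = 0"
      then show ?thesis using c2 by (intro exI[of _ c2]) auto
    qed
  next
    case False
    have z: "g' (\<lambda>J. 0) = 0" if "g' \<in> set (g # gs)" for g' using lin[OF that, of "- 1" "\<lambda>J. 0" "\<lambda>J. 0"] by simp
    have sc: "g' (\<lambda>J. a * c J) = a * g' c" if "g' \<in> set (g # gs)" for g' a c
      using lin[OF that, of a c "\<lambda>J. 0"] z[OF that] by simp
    define c where "c = (\<lambda>J. g c2 * c1 J + (- g c1) * c2 J)"
    have val: "g' c = g c2 * g' c1 + (- g c1) * g' c2" if "g' \<in> set (g # gs)" for g'
      unfolding c_def using lin[OF that] sc[OF that] by metis
    have "g c = 0" using val[of g] by simp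
    moreover have "g' c = 0" if "g' \<in> set gs" for g' using val[of g'] that bspec[OF c1(4) that] bspec[OF c2(5) that] by simp
    ultimately have "\<forall>g'\<in>set (g # gs). g' c = 0" by simp
    moreover have "c i1 \<noteq> 0" unfolding c_def using c2(3) c1(2) False by simp
    moreover have "\<forall>i. i \<notin> I \<longrightarrow> c i = 0" unfolding c_def using c1 c2 by simp
    ultimately show ?thesis using c1(1) by blast
  qed
qed

section \<open>The lower bound by an annihilating form\<close>

lemma lower_bound:
  assumes A: "hyp A n" and k: "k \<le> n" and S: "finite S" "S \<subseteq> ti A k"
    and gen: "\<And>X. pclosed A n k X \<Longrightarrow> S \<subseteq> X \<Longrightarrow> ti A k \<subseteq> X"
  shows "(2 * n) choose k \<le> card S"
proof (rule ccontr)
  assume "\<not> ?thesis"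
  then have small: "card S < (2 * n) choose k" by simp
  obtain L where L: "alt L" "length L = 2 * n" "span (set L) = A" using hyp_alt[OF A] by blast
  note sA = hyp_subspace[OF A]
  define N where "N = 2 * n"
  define I where "I = {J. J \<subseteq> {..<N} \<and> card J = k}"
  have I: "finite I" "card I = (2 * n) choose k"
    unfolding I_def N_def using n_subsets[of "{..<2 * n}" k] by simp_all
  have "\<exists>bs. length bs = k \<and> span (set bs) = K" if "K \<in> S" for K
  proof -
    have K: "K \<in> ti A k" using that S by blast
    obtain B where B: "finite B" "B \<subseteq> K" "independent B" "span B = K" "card B = dim K"
      using basis_subspace_exists[OF ti_subspace[OF K]] by metis
    obtain bs where "set bs = B" "distinct bs" using finite_distinct_list[OF B(1)] by blast
    then show ?thesis using B ti_dim[OF K] distinct_card[of bs] by auto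
  qed
  then obtain bs where bs: "\<And>K. K \<in> S \<Longrightarrow> length (bs K) = k" "\<And>K. K \<in> S \<Longrightarrow> span (set (bs K)) = K" by metis
  obtain Ks where Ks: "set Ks = S" "distinct Ks" using finite_distinct_list[OF S(1)] by blast
  \<comment> \<open>The unknowns are the coefficients at the \<open>k\<close>-subsets; each
    \<open>K\<close> of \<open>S\<close> contributes one equation, the value at a basis of
    \<open>K\<close>.\<close>
  have "\<exists>c. (\<exists>i\<in>I. c i \<noteq> 0) \<and> (\<forall>i. i \<notin> I \<longrightarrow> c i = 0) \<and> (\<forall>g\<in>set (map (\<lambda>K c. form L N c (bs K)) Ks). g c = 0)"
  proof (rule nonzero_solution[OF I(1)])
    show "length (map (\<lambda>K c. form L N c (bs K)) Ks) < card I" using small I(2) Ks distinct_card[of Ks] by simp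
  qed (auto simp: form_linear)
  then obtain c J where c: "J \<in> I" "c J \<noteq> 0" "\<And>K. K \<in> S \<Longrightarrow> form L N c (bs K) = 0" using Ks(1) by auto
  let ?D = "form L N c"
  have D: "altform k ?D" by (rule altform_form)
  define X where "X = {K. \<forall>vs. length vs = k \<longrightarrow> set vs \<subseteq> K \<longrightarrow> ?D vs = 0}"
  have SX: "S \<subseteq> X"
    unfolding X_def using altform_vanish_basis[OF D bs(1) c(3)] bs(2) by blast
  have X: "pclosed A n k X"
    unfolding pclosed_def
  proof (intro ballI impI, elim conjE)
    fix D0 K1 K2 K
    assume D0: "D0 \<in> ti A (k - 1)" and K12: "K1 \<in> ti A k \<inter> X" "K2 \<in> ti A k \<inter> X" and K: "K \<in> ti A k"
      and ne: "K1 \<noteq> K2" and sub: "D0 \<subseteq> K1" "D0 \<subseteq> K2" "D0 \<subseteq> K"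
      and U: "k < n \<longrightarrow> (\<exists>U\<in>ti A (k + 1). K1 \<subseteq> U \<and> K2 \<subseteq> U \<and> K \<subseteq> U)"
    obtain d where kd: "k = Suc d"
      using K12 ne ti_0[OF sA] by (cases k) auto
    have D0: "D0 \<in> ti A d" using D0 kd by simp
    note sD = ti_subspace[OF D0] and K1 = IntD1[OF K12(1), unfolded kd] and K2 = IntD1[OF K12(2), unfolded kd]
    note K = K[unfolded kd]
    obtain x1 where x1: "x1 \<in> K1" "x1 \<notin> D0" "K1 = span (insert x1 D0)" "x1 \<in> perp A D0" "h x1 x1 = 0"
      using ti_extension_vector[OF K1 sD ti_dim[OF D0] sub(1)] .
    obtain x2 where x2: "x2 \<in> K2" "x2 \<notin> D0" "K2 = span (insert x2 D0)" "x2 \<in> perp A D0" "h x2 x2 = 0"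
      using ti_extension_vector[OF K2 sD ti_dim[OF D0] sub(2)] .
    obtain x where x: "x \<in> K" "x \<notin> D0" "K = span (insert x D0)" "x \<in> perp A D0" "h x x = 0"
      using ti_extension_vector[OF K sD ti_dim[OF D0] sub(3)] .
    have x2K1: "x2 \<notin> K1" using span_insert_eq[OF sD, of x2 x1] x1(3) x2 ne by auto
    have dim2: "dim (span (insert x2 K1)) = Suc (Suc d)"
      using dim_span_insert[OF ti_subspace[OF K1] x2K1] ti_dim[OF K1] by simp
    \<comment> \<open>Both kinds of line live in a \<open>(k + 1)\<close>-space over
      \<open>D0\<close>: in \<open>U\<close> below the top rank, in the complement of
      \<open>D0\<close> at the top. Linearity in one argument then carries the vanishing over to
      \<open>K\<close>.\<close>
    have "x \<in> span (insert x2 K1)"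
    proof (cases "k < n")
      case True
      then obtain U where U: "U \<in> ti A (Suc k)" "K1 \<subseteq> U" "K2 \<subseteq> U" "K \<subseteq> U" using U by auto
      have "span (insert x2 K1) \<subseteq> U" using span_insert_subset[OF ti_subspace[OF U(1)] U(2)] x2(1) U(3) by blast
      then have "span (insert x2 K1) = U"
        using subspace_dim_equal[OF subspace_span ti_subspace[OF U(1)]] dim2 ti_dim[OF U(1)] kd by simp
      then show ?thesis using x(1) U(4) by blast
    next
      case False
      then have n: "n = Suc d" using k kd by simp
      have "insert x2 (insert x1 D0) \<subseteq> perp A D0"
        using x1(4) x2(4) ti_h[OF D0] ti_sub[OF D0] by (auto intro: perpI)
      then have "span (insert x2 K1) \<subseteq> perp A D0"
        unfolding x1(3) span_insert_span by (rule span_minimal) (rule subspace_perp[OF sA])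
      moreover have "dim (perp A D0) = Suc (Suc d)"
        using dim_perp[OF sA hyp_nondeg[OF A] sD ti_sub[OF D0]] ti_dim[OF D0] hyp_dim[OF A] n by simp
      ultimately have "span (insert x2 K1) = perp A D0"
        using subspace_dim_equal[OF subspace_span subspace_perp[OF sA]] dim2 by simp
      then show ?thesis using x(4) by blast
    qed
    then obtain b y where b: "y \<in> K1" "x = y + b *s x2" using mem_span_insert[OF ti_subspace[OF K1]] by blast
    obtain B where B: "finite B" "B \<subseteq> D0" "independent B" "span B = D0" "card B = dim D0"
      using basis_subspace_exists[OF sD] by metis
    obtain ds where ds: "set ds = B" "distinct ds" using finite_distinct_list[OF B(1)] by blast
    have ld: "length ds = d" using ds B(5) ti_dim[OF D0] distinct_card[of ds] by simp
    have X12: "K1 \<in> X" "K2 \<in> X" using K12 by auto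
    have "length (z # ds) = k" for z using ld kd by simp
    moreover have "set (y # ds) \<subseteq> K1" "set (x2 # ds) \<subseteq> K2" using b(1) x2(1) B(2) ds(1) sub by auto
    ultimately have "?D (y # ds) = 0" "?D (x2 # ds) = 0" using X12 unfolding X_def by blast+
    then have "?D (x # ds) = 0"
      using altform_linear[OF D[unfolded kd] ld, of b x2 y] unfolding b(2) by (simp add: add.commute)
    moreover have "span (set (x # ds)) = K"
      using span_insert_span[of x B] B(4) x(3) ds(1) by simp
    moreover have "length (x # ds) = k" using ld kd by simp
    ultimately show "K \<in> X" unfolding X_def using altform_vanish_basis[OF D] by blast
  qed
  have ti_X: "ti A k \<subseteq> X" using gen[OF X SX] .
  \<comment> \<open>The entries may be dependent; their span is then enlarged to a t.i.
    \<open>k\<close>-space.\<close>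
  have iso: "?D vs = 0" if vs: "length vs = k" "set vs \<subseteq> A" "\<forall>u\<in>set vs. \<forall>v\<in>set vs. h u v = 0" for vs
  proof -
    let ?U = "span (set vs)"
    have "set vs \<subseteq> perp A (set vs)" using vs by (auto simp: perp_def)
    then have "?U \<subseteq> perp A (set vs)" by (rule span_minimal) (rule subspace_perp[OF sA])
    then have "?U \<subseteq> perp A ?U" unfolding perp_span .
    then have U: "?U \<in> ti A (dim ?U)" by (auto simp: ti_iff perp_def)
    have "dim ?U \<le> card (set vs)" using dim_le_card[of "set vs" "set vs"] by (simp add: span_superset)
    then have "dim ?U \<le> k" using card_length[of vs] vs(1) by simp
    moreover obtain T where T: "T \<in> ti A n" "?U \<subseteq> T" using ti_extend[OF A U] .
    ultimately obtain M where "M \<in> ti A k" "?U \<subseteq> M" using ti_subspace_exists[OF T(1) U T(2) _ k] by blast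
    then show ?thesis using ti_X vs(1) span_superset[of "set vs"] unfolding X_def by blast
  qed
  have J: "J \<subseteq> {..<N}" "card J = k" using c(1) by (auto simp: I_def)
  then have "finite J" using finite_subset by blast
  then obtain js where js: "set js = J" "distinct js" using finite_distinct_list by blast
  have LN: "length L = N" using L N_def by simp
  define f where "f = (!) L"
  have inj: "inj_on f {..<N}"
  proof (rule inj_onI)
    fix i j assume "i \<in> {..<N}" "j \<in> {..<N}" "f i = f j"
    then show "i = j" using alt_orth[OF L(1), of i j] alt_norm[OF L(1), of i] LN unfolding f_def by (cases "i = j") auto
  qed
  define E O' where "E = {i. i < N \<and> even i}" and "O' = {i. i < N \<and> odd i}"
  have cards: "card E = n" "card O' = n" "E \<subseteq> {..<N}" "O' \<subseteq> {..<N}" "E \<inter> O' = {}" "E \<union> O' = {..<N}"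
  proof -
    have "E = (\<lambda>i. 2 * i) ` {..<n}" unfolding E_def N_def by (auto elim!: evenE)
    moreover have "O' = (\<lambda>i. Suc (2 * i)) ` {..<n}" unfolding O'_def N_def by (auto elim!: oddE)
    ultimately show "card E = n" "card O' = n" by (simp_all add: card_image inj_on_def)
  qed (auto simp: E_def O'_def)
  have "?D (map f js) = 0"
  proof (rule altform_vanish_isotropic[OF D, of "f ` E" "f ` O'" n])
    show "finite (f ` E)" "finite (f ` O')" using cards(3,4) finite_subset by blast+
    show "card (f ` E) = n" "card (f ` O') = n"
      using cards card_image inj_on_subset[OF inj] by metis+
    show "k \<le> n" by (rule k)
    have EO: "f ` E \<union> f ` O' = set L" unfolding f_def image_Un[symmetric] cards(6) LN[symmetric]
      by (auto simp: in_set_conv_nth)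
    show "h a b = 0" if ab: "a \<in> f ` E \<union> f ` O'" "b \<in> f ` E \<union> f ` O'" "a \<noteq> b" for a b
      using ab alt_orth[OF L(1)] unfolding EO in_set_conv_nth by metis
    show "h a a = 1" if "a \<in> f ` E" for a using that alt_norm[OF L(1)] LN unfolding f_def E_def by auto
    show "h a a = - 1" if "a \<in> f ` O'" for a using that alt_norm[OF L(1)] LN unfolding f_def O'_def by auto
    show "f ` E \<inter> f ` O' = {}" using inj_on_image_Int[OF inj cards(3,4)] cards(5) by simp
    show "?D vs = 0" if "length vs = k" "set vs \<subseteq> span (f ` E \<union> f ` O')" "\<forall>u\<in>set vs. \<forall>v\<in>set vs. h u v = 0" for vs
      using iso that unfolding EO L(3) by blast
    show "length (map f js) = k" using js J distinct_card[of js] by simp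
    show "set (map f js) \<subseteq> f ` E \<union> f ` O'" using js(1) J(1) unfolding image_Un[symmetric] cards(6) by auto
  qed
  then show False using form_basis[OF L(1) LN js(2)] js(1) J(1) c(2) unfolding f_def by simp
qed

section \<open>The generating rank\<close>

text \<open>If only \<open>0\<close> and \<open>1\<close> are fixed, the characteristic is two and
  all traces are \<open>0\<close> or \<open>1\<close>; subtracting the trace times
  \<open>\<theta>\<close> from \<open>x\<close> leaves a fixed element, so there are four elements.
  Infinite fields have \<open>card\<close> zero and are covered.\<close>

lemma exists_fixed:
  assumes "card (UNIV :: 'f set) \<noteq> 4" shows "\<exists>f. \<sigma> f = f \<and> f \<noteq> 0 \<and> f \<noteq> 1"
proof (rule ccontr)
  assume "\<not> ?thesis"
  then have fixed: "f = 0 \<or> f = 1" if "\<sigma> f = f" for f using that by blast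
  have "\<sigma> (1 + 1) = 1 + 1" by (simp only: \<sigma>_add \<sigma>_1)
  then have "(1 :: 'f) + 1 = 0 \<or> (1 :: 'f) + 1 = 1" by (rule fixed)
  then have two: "(1 :: 'f) + 1 = 0" by (metis add_cancel_left_right zero_neq_one)
  then have double: "a + a = 0" for a :: 'f by (metis distrib_left mult.right_neutral mult_zero_right)
  have "x \<in> {0, 1, \<theta>, \<theta> + 1}" for x
  proof -
    have "\<sigma> (x + \<sigma> x) = x + \<sigma> x" by (simp add: add.commute)
    then have t: "x + \<sigma> x = 0 \<or> x + \<sigma> x = 1" by (rule fixed)
    then have "\<sigma> (x - (x + \<sigma> x) * \<theta>) = x - (x + \<sigma> x) * \<theta>"
    proof
      assume "x + \<sigma> x = 0"
      then have "\<sigma> x = x" using double[of x] by (metis add_left_imp_eq)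
      then show ?thesis unfolding \<open>x + \<sigma> x = 0\<close> by simp
    next
      assume 1: "x + \<sigma> x = 1"
      have "\<sigma> x - \<sigma> \<theta> = (x + \<sigma> x) - (\<theta> + \<sigma> \<theta>) - (x - \<theta>)" by (simp add: algebra_simps)
      also have "\<dots> = - (x - \<theta>)" unfolding 1 \<theta> by simp
      also have "\<dots> = x - \<theta>" using double[of "x - \<theta>"] by (metis minus_unique)
      finally show ?thesis unfolding 1 by simp
    qed
    then have "x - (x + \<sigma> x) * \<theta> = 0 \<or> x - (x + \<sigma> x) * \<theta> = 1" by (rule fixed)
    then have "x = (x + \<sigma> x) * \<theta> \<or> x = 1 + (x + \<sigma> x) * \<theta>" by (simp only: diff_eq_eq add_0_left)
    then show ?thesis using t by (elim disjE) (simp_all add: add.commute)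
  qed
  then have U: "(UNIV :: 'f set) = {0, 1, \<theta>, \<theta> + 1}" by blast
  have "\<theta> \<noteq> 0" "\<theta> \<noteq> 1" using \<theta> two by auto
  then have "card {0, 1, \<theta>, \<theta> + 1} = 4" using two by (auto simp: card_insert_if add_eq_0_iff2)
  then show False using assms U by simp
qed

lemma lines_pclosed:
  assumes w: "witt_index scale h = n" and X: "X \<subseteq> ti UNIV k"
  shows "geometry_subspace (polar_grassmannian_points scale h k) (polar_grassmannian_lines scale h k) X \<longleftrightarrow>
    pclosed UNIV n k X"
proof -
  let ?T = "ti_spaces scale h"
  have ti: "ti UNIV d = ?T d" for d by (simp add: ti_def)
  have X': "X \<subseteq> ?T k" using X ti by simp
  let ?L = "polar_grassmannian_lines scale h k"
  show ?thesis
  proof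
    assume g: "geometry_subspace (polar_grassmannian_points scale h k) ?L X"
    have line: "K \<in> X" if "l \<in> ?L" "K1 \<in> l" "K2 \<in> l" "K1 \<in> X" "K2 \<in> X" "K1 \<noteq> K2" "K \<in> l" for l K K1 K2
      using g that unfolding geometry_subspace_def by blast
    show "pclosed UNIV n k X"
      unfolding pclosed_def ti
    proof (intro ballI impI, elim conjE)
      fix D K1 K2 K
      assume D: "D \<in> ?T (k - 1)" and K: "K1 \<in> ?T k \<inter> X" "K2 \<in> ?T k \<inter> X" "K \<in> ?T k" "K1 \<noteq> K2"
        and sub: "D \<subseteq> K1" "D \<subseteq> K2" "D \<subseteq> K"
        and U: "k < n \<longrightarrow> (\<exists>U\<in>?T (k + 1). K1 \<subseteq> U \<and> K2 \<subseteq> U \<and> K \<subseteq> U)"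
      show "K \<in> X"
      proof (cases "k < n")
        case True
        then obtain U where U: "U \<in> ?T (k + 1)" "K1 \<subseteq> U" "K2 \<subseteq> U" "K \<subseteq> U" using U by blast
        then have "D \<subseteq> U" using sub by blast
        then have "{K \<in> ?T k. D \<subseteq> K \<and> K \<subseteq> U} \<in> ?L" unfolding polar_grassmannian_lines_def w using True D U(1) by auto
        then show ?thesis by (rule line[of _ K1 K2]) (use K sub U in auto)
      next
        case False
        then have "{K \<in> ?T k. D \<subseteq> K} \<in> ?L" unfolding polar_grassmannian_lines_def w using D by auto
        then show ?thesis by (rule line[of _ K1 K2]) (use K sub in auto)
      qed
    qed
  next
    assume p: "pclosed UNIV n k X"
    have "l \<subseteq> X" if l: "l \<in> ?L" and x: "x \<in> l \<inter> X" and y: "y \<in> l \<inter> X" and xy: "x \<noteq> y" for l x y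
    proof
      fix K assume K: "K \<in> l"
      obtain D where D: "D \<in> ?T (k - 1)" "\<forall>M\<in>l. D \<subseteq> M" "l \<subseteq> ?T k"
          "k < n \<longrightarrow> (\<exists>U\<in>?T (k + 1). \<forall>M\<in>l. M \<subseteq> U)"
        using l unfolding polar_grassmannian_lines_def w by (auto split: if_splits)
      have "x \<in> ?T k \<inter> X" "y \<in> ?T k \<inter> X" "K \<in> ?T k" using D(3) x y K by auto
      note * = p[unfolded pclosed_def ti, THEN bspec, OF D(1), THEN bspec, OF this(1), THEN bspec, OF this(2),
          THEN bspec, OF this(3), THEN mp]
      have "k < n \<longrightarrow> (\<exists>U\<in>?T (k + 1). x \<subseteq> U \<and> y \<subseteq> U \<and> K \<subseteq> U)" using D(4) x y K by (meson IntD1)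
      then show "K \<in> X" using D(2) x y K xy by (intro *) auto
    qed
    then show "geometry_subspace (polar_grassmannian_points scale h k) ?L X"
      unfolding geometry_subspace_def polar_grassmannian_points_def using X' by blast
  qed
qed

lemma generating_set_iff:
  assumes w: "witt_index scale h = n"
  shows "generating_set (polar_grassmannian_points scale h k) (polar_grassmannian_lines scale h k) S \<longleftrightarrow>
    S \<subseteq> ti UNIV k \<and> (\<forall>X. pclosed UNIV n k X \<and> S \<subseteq> X \<longrightarrow> ti UNIV k \<subseteq> X)"
proof -
  let ?P = "polar_grassmannian_points scale h k" and ?L = "polar_grassmannian_lines scale h k"
  have P: "?P = ti UNIV k" by (simp add: polar_grassmannian_points_def ti_def)
  have sub: "geometry_subspace ?P ?L X \<Longrightarrow> X \<subseteq> ti UNIV k" for X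
    unfolding geometry_subspace_def P by blast
  \<comment> \<open>A \<open>pclosed\<close> family may contain sets that are no points, a subspace
    of the geometry may not; cutting down to \<open>ti UNIV k\<close> mediates.\<close>
  have int: "pclosed UNIV n k (X \<inter> ti UNIV k)" if "pclosed UNIV n k X" for X
  proof -
    have eq: "ti UNIV k \<inter> (X \<inter> ti UNIV k) = ti UNIV k \<inter> X" by blast
    show ?thesis
      unfolding pclosed_def eq
    proof (intro ballI impI)
      fix D K1 K2 K
      assume *: "D \<in> ti UNIV (k - 1)" "K1 \<in> ti UNIV k \<inter> X" "K2 \<in> ti UNIV k \<inter> X" "K \<in> ti UNIV k"
        "K1 \<noteq> K2 \<and> D \<subseteq> K1 \<and> D \<subseteq> K2 \<and> D \<subseteq> K \<and>
          (k < n \<longrightarrow> (\<exists>U\<in>ti UNIV (k + 1). K1 \<subseteq> U \<and> K2 \<subseteq> U \<and> K \<subseteq> U))"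
      have "K \<in> X"
        using that[unfolded pclosed_def, THEN bspec, OF *(1), THEN bspec, OF *(2), THEN bspec, OF *(3),
            THEN bspec, OF *(4), THEN mp, OF *(5)] .
      then show "K \<in> X \<inter> ti UNIV k" using *(4) by blast
    qed
  qed
  have top: "pclosed UNIV n k (ti UNIV k)" unfolding pclosed_def by blast
  show ?thesis
  proof
    assume g: "generating_set ?P ?L S"
    then have S: "S \<subseteq> ti UNIV k" unfolding generating_set_def P by blast
    have "ti UNIV k \<subseteq> X" if X: "pclosed UNIV n k X" "S \<subseteq> X" for X
    proof -
      have "geometry_subspace ?P ?L (X \<inter> ti UNIV k)" using lines_pclosed[OF w, of "X \<inter> ti UNIV k" k] int[OF X(1)] by simp
      moreover have "S \<subseteq> X \<inter> ti UNIV k" using S X by blast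
      ultimately have "geometry_span ?P ?L S \<subseteq> X \<inter> ti UNIV k" unfolding geometry_span_def by (intro Inter_lower) simp
      moreover have "geometry_span ?P ?L S = ti UNIV k" using g unfolding generating_set_def P by simp
      ultimately show ?thesis by simp
    qed
    then show "S \<subseteq> ti UNIV k \<and> (\<forall>X. pclosed UNIV n k X \<and> S \<subseteq> X \<longrightarrow> ti UNIV k \<subseteq> X)" using S by blast
  next
    assume g: "S \<subseteq> ti UNIV k \<and> (\<forall>X. pclosed UNIV n k X \<and> S \<subseteq> X \<longrightarrow> ti UNIV k \<subseteq> X)"
    have "geometry_subspace ?P ?L (ti UNIV k)" using lines_pclosed[OF w order_refl] top by blast
    then have "geometry_span ?P ?L S \<subseteq> ti UNIV k" unfolding geometry_span_def using g by (intro Inter_lower) simp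
    moreover have "ti UNIV k \<subseteq> X" if "geometry_subspace ?P ?L X" "S \<subseteq> X" for X
      using g lines_pclosed[OF w sub[OF that(1)]] that by blast
    then have "ti UNIV k \<subseteq> geometry_span ?P ?L S" unfolding geometry_span_def by (intro Inter_greatest) simp
    ultimately show "generating_set ?P ?L S" unfolding generating_set_def P using g by simp
  qed
qed

lemma hyp_UNIV:
  assumes "nondegenerate h" "witt_index scale h = n" "dim UNIV = 2 * n"
  shows "hyp UNIV n"
proof -
  let ?I = "{U. totally_isotropic scale h U}"
  have "dim ` ?I \<subseteq> {..dimension}" using dim_subset_UNIV by auto
  then have "finite (dim ` ?I)" by (rule finite_subset) simp
  moreover have "{0} \<in> ?I" by (simp add: totally_isotropic_def)
  ultimately have "n \<in> dim ` ?I" using Max_in[of "dim ` ?I"] assms(2) unfolding witt_index_def by blast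
  then have "ti UNIV n \<noteq> {}" by (auto simp: ti_def ti_spaces_def)
  moreover have "nondeg UNIV" using assms(1) by (auto simp: nondeg_def nondegenerate_def perp_def)
  ultimately show ?thesis using assms(3) by (simp add: hyp_def)
qed

lemma generating_rank_polar_grassmannian:
  assumes nd: "nondegenerate h" and w: "witt_index scale h = n" and dim: "dim UNIV = 2 * n" and k: "k \<le> n"
    and field: "card (UNIV :: 'f set) \<noteq> 4 \<or> k = 1"
  shows "generating_rank (polar_grassmannian_points scale h k) (polar_grassmannian_lines scale h k)
    = enat ((2 * n) choose k)"
proof -
  let ?C = "(2 * n) choose k" and ?P = "polar_grassmannian_points scale h k"
    and ?L = "polar_grassmannian_lines scale h k"
  have V: "hyp UNIV n" by (rule hyp_UNIV[OF nd w dim])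
  have "gen UNIV n k ?C"
  proof (rule gen_below_top[OF _ V k order_refl])
    fix A m assume A: "hyp A m" "0 < m" "m \<le> k"
    show "gen A m m ((2 * m) choose m)"
    proof (cases "k = 1")
      case True
      then have "m = 1" using A by simp
      then show ?thesis using gen_1_1 A by simp
    next
      case False
      then obtain f where "\<sigma> f = f" "f \<noteq> 0" "f \<noteq> 1" using exists_fixed field by blast
      then show ?thesis using gen_top A by blast
    qed
  qed
  then obtain S where S: "finite S" "card S \<le> ?C"
    "generating_set ?P ?L S"
    unfolding gen_def generating_set_iff[OF w] by blast
  have lower: "?C \<le> card S" if "finite S"
    "generating_set ?P ?L S" for S
    using lower_bound[OF V k that(1)] that(2) unfolding generating_set_iff[OF w] by blast
  show ?thesis
    unfolding generating_rank_def
  proof (rule antisym)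
    show "(INF S\<in>{S. generating_set ?P ?L S}.
        if finite S then enat (card S) else \<infinity>) \<le> enat ?C"
      by (rule INF_lower2[of S]) (use S in simp_all)
    show "enat ?C \<le> (INF S\<in>{S. generating_set ?P ?L S}.
        if finite S then enat (card S) else \<infinity>)"
      by (rule INF_greatest) (use lower in auto)
  qed
qed

end

theorem theorem1p1:
  fixes scale :: "'f::field \<Rightarrow> 'v::ab_group_add \<Rightarrow> 'v"
    and \<sigma> :: "'f \<Rightarrow> 'f"
    and h :: "'v \<Rightarrow> 'v \<Rightarrow> 'f"
    and n k :: nat
  assumes "n \<ge> 2" and "1 \<le> k" and "k \<le> n"
    and "field_automorphism \<sigma>" and "\<sigma> \<circ> \<sigma> = id" and "\<sigma> \<noteq> id"
    and "vector_space scale" and "vector_space.dim scale UNIV = 2 * n"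
    and "hermitian_form scale \<sigma> h" and "nondegenerate h" and "witt_index scale h = n"
    and "card (UNIV :: 'f set) \<noteq> 4 \<or> k = 1"
  shows "generating_rank (polar_grassmannian_points scale h k) (polar_grassmannian_lines scale h k)
    = enat ((2 * n) choose k)"
proof -
  interpret vector_space scale by (rule assms(7))
  obtain B where B: "independent B" "UNIV \<subseteq> span B" "card B = 2 * n"
    using basis_exists[of UNIV] assms(8) by metis
  \<comment> \<open>The \<open>card\<close> of an infinite basis would be zero.\<close>
  have "finite B" using B(3) assms(1) by (intro card_ge_0_finite) simp
  then interpret hermitian_space scale B \<sigma> h
    using B assms(4-6,9) by unfold_locales auto
  show ?thesis by (rule generating_rank_polar_grassmannian[OF assms(10,11,8,3,12)])
qed

end
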